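(* Let $p,c,t\in\mathbb{N}$ be constants and let $\varepsilon>0$ be a constant. There exists a randomized polynomial-time algorithm for \textsc{Packing-Covering Multiple Submodular Maximization} that, for every target values $v_1,\dots,v_t$, either (1) finds a set $S\subseteq\mathcal{N}$ with $\mathbf{P}\mathbf{1}_S\leq\mathbf{1}_p$ and $\mathbf{C}\mathbf{1}_S\geq(1-\varepsilon)\mathbf{1}_c$ such that $f_i(S)\geq\left(1-\frac1e-\varepsilon\right)v_i$ for every $1\leq i\leq t$; or (2) returns a certificate that there is no $S\subseteq\mathcal{N}$ with $\mathbf{P}\mathbf{1}_S\leq\mathbf{1}_p$ and $\mathbf{C}\mathbf{1}_S\geq\mathbf{1}_c$ such that $f_i(S)\geq v_i$ for every $1\leq i\leq t$.
   Context: \textsc{Packing-Covering Multiple Submodular Maximization}: given a ground set $\mathcal{N}=\{1,\dots,n\}$, $t$ monotone submodular functions $f_1,\dots,f_t:2^{\mathcal{N}}\to\mathbb{R}_+$ (value oracles), $\mathbf{P}\in\mathbb{R}_+^{p\times n}$ and $\mathbf{C}\in\mathbb{R}_+^{c\times n}$; feasible sets are $S\subseteq\mathcal{N}$ with $\mathbf{P}\mathbf{1}_S\leq\mathbf{1}_p$ and $\mathbf{C}\mathbf{1}_S\geq\mathbf{1}_c$, where $\mathbf{1}_S$ is the indicator vector of $S$ and $\mathbf{1}_k$ the all-ones vector in $\mathbb{R}^k$. The instance is assumed feasible.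
   Formalization: The target values v_1,…,v_t are assumed nonnegative; for negative v_i and ε > 1 − 1/e the claim fails, since (1 − 1/e − ε)v_i is positive while f_i(S) ≥ v_i holds for every S. *)

theory Defs
  imports
    "HOL-Probability.Probability_Mass_Function"
    "HOL-Computational_Algebra.Polynomial"
    "Jordan_Normal_Form.Matrix"
begin

no_notation vec_nth (infixl \<open>$\<close> 90)

section \<open>Instances\<close>

text \<open>The ground set is \<open>{..<n}\<close>, so that its elements are the column indices of the
  constraint matrices; functions and target values are indexed by \<open>{..<t}\<close>.\<close>

definition ind_vec :: "nat \<Rightarrow> nat set \<Rightarrow> real vec" where
  "ind_vec n S = Matrix.vec n (indicator S)"

definition ones_vec :: "nat \<Rightarrow> real vec" where
  "ones_vec k = Matrix.vec k (\<lambda>_. 1)"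

definition submodular_on :: "nat \<Rightarrow> (nat set \<Rightarrow> real) \<Rightarrow> bool" where
  "submodular_on n f \<longleftrightarrow>
    (\<forall>A B. A \<subseteq> {..<n} \<longrightarrow> B \<subseteq> {..<n} \<longrightarrow> f (A \<union> B) + f (A \<inter> B) \<le> f A + f B)"

definition feasible :: "nat \<Rightarrow> nat \<Rightarrow> nat \<Rightarrow> real mat \<Rightarrow> real mat \<Rightarrow> nat set \<Rightarrow> bool" where
  "feasible p c n P C S \<longleftrightarrow> S \<subseteq> {..<n} \<and>
     P *\<^sub>v ind_vec n S \<le> ones_vec p \<and> C *\<^sub>v ind_vec n S \<ge> ones_vec c"

definition pcmsm_instance ::
  "nat \<Rightarrow> nat \<Rightarrow> nat \<Rightarrow> nat \<Rightarrow> (nat \<Rightarrow> nat set \<Rightarrow> real) \<Rightarrow> real mat \<Rightarrow> real mat \<Rightarrow> bool" where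
  "pcmsm_instance p c t n f P C \<longleftrightarrow>
     (\<forall>i<t. (\<forall>S\<subseteq>{..<n}. 0 \<le> f i S) \<and> mono_on (Pow {..<n}) (f i) \<and> submodular_on n (f i)) \<and>
     P \<in> carrier_mat p n \<and> (\<forall>q<p. \<forall>j<n. 0 \<le> P $$ (q, j)) \<and>
     C \<in> carrier_mat c n \<and> (\<forall>q<c. \<forall>j<n. 0 \<le> C $$ (q, j)) \<and>
     (\<exists>S. feasible p c n P C S)"


section \<open>Oracle programs\<close>

text \<open>Algorithms are programs for a real RAM with a value oracle. The memory consists of named
  arrays of natural numbers and of reals, indexed by lists of naturals (a scalar is an array entry
  with index \<open>[]\<close>); a given program uses only finitely many arrays of bounded dimension.

  Reals are handled exactly, with unit-cost field operations (\<open>x / 0 = 0\<close>) and comparisons.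
  Naturals, which serve as indices and counters, only have addition and truncated subtraction, so
  their bit length stays linear in the running time. There is no rounding of reals to naturals, and
  the only constants in programs are naturals and rationals.

  \<open>OracleVal i a js\<close> is the value of the \<open>i\<close>-th function at the subset of the ground set whose
  characteristic function is stored in the slice \<open>a[js, _]\<close>. This is the only access to the
  functions.\<close>

datatype iexp =
    Nat nat
  | IGet string "iexp list"
  | IAdd iexp iexp
  | ISub iexp iexp

datatype rexp =
    Rat rat
  | OfNat iexp
  | RGet string "iexp list"
  | RAdd rexp rexp
  | RSub rexp rexp
  | RMul rexp rexp
  | RDiv rexp rexp
  | OracleVal iexp string "iexp list"

datatype bexp =
    ILess iexp iexp
  | RLess rexp rexp
  | Neg bexp
  | Conj bexp bexp

datatype com =
    Skip
  | ISet string "iexp list" iexp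
  | RSet string "iexp list" rexp
  | Seq com com
  | Cond bexp com com
  | While bexp com

record state =
  imem :: "string \<Rightarrow> nat list \<Rightarrow> nat"
  rmem :: "string \<Rightarrow> nat list \<Rightarrow> real"

primrec ival :: "state \<Rightarrow> iexp \<Rightarrow> nat" where
  "ival s (Nat k) = k"
| "ival s (IGet a es) = imem s a (map (ival s) es)"
| "ival s (IAdd e1 e2) = ival s e1 + ival s e2"
| "ival s (ISub e1 e2) = ival s e1 - ival s e2"

primrec rval :: "nat \<Rightarrow> (nat \<Rightarrow> nat set \<Rightarrow> real) \<Rightarrow> state \<Rightarrow> rexp \<Rightarrow> real" where
  "rval n f s (Rat x) = of_rat x"
| "rval n f s (OfNat e) = of_nat (ival s e)"
| "rval n f s (RGet a es) = rmem s a (map (ival s) es)"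
| "rval n f s (RAdd e1 e2) = rval n f s e1 + rval n f s e2"
| "rval n f s (RSub e1 e2) = rval n f s e1 - rval n f s e2"
| "rval n f s (RMul e1 e2) = rval n f s e1 * rval n f s e2"
| "rval n f s (RDiv e1 e2) = rval n f s e1 / rval n f s e2"
| "rval n f s (OracleVal e a es) =
     f (ival s e) {j. j < n \<and> imem s a (map (ival s) es @ [j]) \<noteq> 0}"

primrec bval :: "nat \<Rightarrow> (nat \<Rightarrow> nat set \<Rightarrow> real) \<Rightarrow> state \<Rightarrow> bexp \<Rightarrow> bool" where
  "bval n f s (ILess e1 e2) \<longleftrightarrow> ival s e1 < ival s e2"
| "bval n f s (RLess e1 e2) \<longleftrightarrow> rval n f s e1 < rval n f s e2"
| "bval n f s (Neg b) \<longleftrightarrow> \<not> bval n f s b"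
| "bval n f s (Conj b1 b2) \<longleftrightarrow> bval n f s b1 \<and> bval n f s b2"

text \<open>\<open>big_step n f cmd s k s'\<close>: started in \<open>s\<close>, the program \<open>cmd\<close> halts in \<open>s'\<close> after \<open>k\<close> steps.
  Evaluating an expression costs one step in total; since expressions are part of the program, this
  changes running times (including the number of oracle calls) by a constant factor only.\<close>

inductive big_step ::
  "nat \<Rightarrow> (nat \<Rightarrow> nat set \<Rightarrow> real) \<Rightarrow> com \<Rightarrow> state \<Rightarrow> nat \<Rightarrow> state \<Rightarrow> bool"
  for n :: nat and f :: "nat \<Rightarrow> nat set \<Rightarrow> real" where
  Skip: "big_step n f Skip s 1 s"
| ISet: "big_step n f (ISet a es e) s 1
     (s\<lparr>imem := (imem s)(a := (imem s a)(map (ival s) es := ival s e))\<rparr>)"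
| RSet: "big_step n f (RSet a es e) s 1
     (s\<lparr>rmem := (rmem s)(a := (rmem s a)(map (ival s) es := rval n f s e))\<rparr>)"
| Seq: "big_step n f c1 s k1 s' \<Longrightarrow> big_step n f c2 s' k2 s'' \<Longrightarrow>
     big_step n f (Seq c1 c2) s (k1 + k2) s''"
| CondTrue: "bval n f s b \<Longrightarrow> big_step n f c1 s k s' \<Longrightarrow>
     big_step n f (Cond b c1 c2) s (k + 1) s'"
| CondFalse: "\<not> bval n f s b \<Longrightarrow> big_step n f c2 s k s' \<Longrightarrow>
     big_step n f (Cond b c1 c2) s (k + 1) s'"
| WhileFalse: "\<not> bval n f s b \<Longrightarrow> big_step n f (While b c1) s 1 s"
| WhileTrue: "bval n f s b \<Longrightarrow> big_step n f c1 s k1 s' \<Longrightarrow>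
     big_step n f (While b c1) s' k2 s'' \<Longrightarrow> big_step n f (While b c1) s (k1 + k2 + 1) s''"

inductive_cases SkipE: "big_step n f Skip s k s'"
  and ISetE: "big_step n f (ISet a es e) s k s'"
  and RSetE: "big_step n f (RSet a es e) s k s'"
  and SeqE: "big_step n f (Seq c1 c2) s k s'"
  and CondE: "big_step n f (Cond b c1 c2) s k s'"
  and WhileE: "big_step n f (While b c1) s k s'"

lemma big_step_determ:
  assumes "big_step n f cmd s k s'" and "big_step n f cmd s k' s''"
  shows "k' = k \<and> s'' = s'"
  using assms
proof (induction arbitrary: k' s'' rule: big_step.induct)
  case (Skip s)
  then show ?case by (elim SkipE) simp
next
  case (ISet a es e s)
  then show ?case by (elim ISetE) simp
next
  case (RSet a es e s)
  then show ?case by (elim RSetE) simp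
next
  case (Seq c1 s k1 s1 c2 k2 s2)
  from Seq.prems obtain l1 l2 s3
    where l: "k' = l1 + l2" "big_step n f c1 s l1 s3" "big_step n f c2 s3 l2 s''"
    by (rule SeqE)
  from Seq.IH(1)[OF l(2)] Seq.IH(2)[of l2 s''] l(1,3) show ?case by simp
next
  case (CondTrue s b c1 k s1 c2)
  from CondTrue.prems obtain l where "k' = l + 1" "big_step n f c1 s l s''"
    by (rule CondE) (simp_all add: CondTrue.hyps(1))
  with CondTrue.IH[of l s''] show ?case by simp
next
  case (CondFalse s b c2 k s1 c1)
  from CondFalse.prems obtain l where "k' = l + 1" "big_step n f c2 s l s''"
    by (rule CondE) (simp_all add: CondFalse.hyps(1))
  with CondFalse.IH[of l s''] show ?case by simp
next
  case (WhileFalse s b c1)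
  from WhileFalse.prems show ?case by (rule WhileE) (simp_all add: WhileFalse.hyps)
next
  case (WhileTrue s b c1 k1 s1 k2 s2)
  from WhileTrue.prems obtain l1 l2 s3
    where l: "k' = l1 + l2 + 1" "big_step n f c1 s l1 s3" "big_step n f (While b c1) s3 l2 s''"
    by (rule WhileE) (simp_all add: WhileTrue.hyps(1))
  from WhileTrue.IH(1)[OF l(2)] WhileTrue.IH(2)[of l2 s''] l(1,3) show ?case by simp
qed

text \<open>Input of a program: the instance with its target values, and a bit string, which holds the
  random bits of an algorithm or the alleged certificate given to a verifier. All other cells are 0.
  The functions are not part of the input.\<close>

definition input :: "nat \<Rightarrow> real mat \<Rightarrow> real mat \<Rightarrow> real vec \<Rightarrow> bool list \<Rightarrow> state" where
  "input n P C v bs = \<lparr>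
     imem = (\<lambda>a js. case js of
         [] \<Rightarrow> if a = ''n'' then n else 0
       | [k] \<Rightarrow> if a = ''bits'' \<and> k < length bs \<and> bs ! k then 1 else 0
       | _ \<Rightarrow> 0),
     rmem = (\<lambda>a js. case js of
         [i] \<Rightarrow> if a = ''v'' \<and> i < dim_vec v then v $ i else 0
       | [q, j] \<Rightarrow>
           if a = ''P'' \<and> q < dim_row P \<and> j < dim_col P then P $$ (q, j)
           else if a = ''C'' \<and> q < dim_row C \<and> j < dim_col C then C $$ (q, j)
           else 0
       | _ \<Rightarrow> 0)\<rparr>"

definition halts_within ::
  "nat \<Rightarrow> (nat \<Rightarrow> nat set \<Rightarrow> real) \<Rightarrow> com \<Rightarrow> state \<Rightarrow> nat \<Rightarrow> state \<Rightarrow> bool" where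
  "halts_within n f cmd s T s' \<longleftrightarrow> (\<exists>k\<le>T. big_step n f cmd s k s')"

datatype answer = Solution "nat set" | Certificate "bool list"

text \<open>The answer is either a subset of the ground set or a certificate of \<open>l\<close> bits, depending on the
  variable \<open>flag\<close>; both are read from the array \<open>out\<close>.\<close>

definition answer_of :: "nat \<Rightarrow> nat \<Rightarrow> state \<Rightarrow> answer" where
  "answer_of n l s =
     (if imem s ''flag'' [] = 0 then Solution {j. j < n \<and> imem s ''out'' [j] \<noteq> 0}
      else Certificate (map (\<lambda>k. imem s ''out'' [k] \<noteq> 0) [0..<l]))"

definition accepts :: "state \<Rightarrow> bool" where
  "accepts s \<longleftrightarrow> imem s ''flag'' [] \<noteq> 0"

definition random_bits :: "nat \<Rightarrow> bool list pmf" where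
  "random_bits m = pmf_of_set {r. length r = m}"


section \<open>Randomized algorithms with certificates\<close>

text \<open>A certificate for the non-existence of a set meeting all constraints and all target values is a
  bit string accepted by a deterministic verifier that accepts nothing unless no such set exists.\<close>

definition sound_verifier_on :: "nat \<Rightarrow> nat \<Rightarrow> nat \<Rightarrow> nat \<Rightarrow> (nat \<Rightarrow> nat set \<Rightarrow> real) \<Rightarrow>
    real mat \<Rightarrow> real mat \<Rightarrow> real vec \<Rightarrow> com \<Rightarrow> nat \<Rightarrow> nat \<Rightarrow> bool" where
  "sound_verifier_on p c t n f P C v ver T l \<longleftrightarrow>
     (\<forall>w. length w = l \<longrightarrow>
       (\<exists>s. halts_within n f ver (input n P C v w) T s \<and>
          (accepts s \<longrightarrow> \<not> (\<exists>S. feasible p c n P C S \<and> (\<forall>i<t. f i S \<ge> v $ i)))))"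

definition correct_answer :: "nat \<Rightarrow> nat \<Rightarrow> nat \<Rightarrow> real \<Rightarrow> nat \<Rightarrow> (nat \<Rightarrow> nat set \<Rightarrow> real) \<Rightarrow>
    real mat \<Rightarrow> real mat \<Rightarrow> real vec \<Rightarrow> com \<Rightarrow> nat \<Rightarrow> answer \<Rightarrow> bool" where
  "correct_answer p c t \<epsilon> n f P C v ver T ans \<longleftrightarrow>
     (case ans of
        Solution S \<Rightarrow> S \<subseteq> {..<n} \<and>
          P *\<^sub>v ind_vec n S \<le> ones_vec p \<and>
          C *\<^sub>v ind_vec n S \<ge> (1 - \<epsilon>) \<cdot>\<^sub>v ones_vec c \<and>
          (\<forall>i<t. f i S \<ge> (1 - 1 / exp 1 - \<epsilon>) * v $ i)
      | Certificate w \<Rightarrow>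
          (\<exists>s. halts_within n f ver (input n P C v w) T s \<and> accepts s))"

end

theory Submission
  imports Defs
begin

text \<open>
  Guess the boundedly many elements of a solution that have a large marginal value, and discard the
  elements that are large compared with the remaining packing budgets. On the remaining elements run
  a discretized continuous greedy algorithm for all functions at once: a step estimates the
  gradients of the multilinear extensions from samples and must choose a set satisfying one linear
  row per function, covering constraint and packing constraint. Instead of solving a linear program,
  it takes the best set for the aggregation of the rows with their positive accumulated residuals as
  weights. If this set violates the aggregated row, then no solution is compatible with the guess,
  whatever the samples were, because the sampled rows are valid for every solution. Otherwise
  Blackwell's argument bounds all residuals. The final fractional point is rounded independently;
  as the remaining elements are small, Chebyshev's inequality with a self-bounding variance suffices.
  The runs are repeated, so that with high probability every guess is refuted by one of its runs or
  leads to a solution. If all guesses are refuted, then the random bits of the execution form a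
  certificate: it is verified by replaying the execution.
\<close>

section \<open>Monotone submodular functions and the multilinear extension\<close>

text \<open>The certificate shapes everything: it must be sound for every bit string, although the
  algorithm only sees random estimates. So the refutation test must not rely on an estimate being
  accurate. The sampled rows achieve this: for a monotone submodular \<open>f\<close>, any sample
  \<open>R\<close> and any solution \<open>S\<close>, \<open>f S\<close> is at most
  \<open>f R\<close> plus the sum over \<open>S\<close> of the marginals at \<open>R\<close>. Hence
  a solution satisfies the rows at all samples, and bad luck can only spoil the point that is
  reached. The time bound depends on \<open>n\<close> alone while the data are arbitrary reals, so
  every row is normalized: functions by their targets, packing rows by the remaining budgets, and
  functions and covering rows are truncated at 1. Then all payoffs are bounded and the number of
  steps does not depend on magnitudes. Step size and coordinates are fractions with denominator
  \<open>2 ^ b\<close>, so that comparing \<open>b\<close> random bits with a counter realizes a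
  coordinate exactly as a probability. The run stops a fraction \<open>2 * h\<close> early; this is
  the slack in the packing rows that the residuals and the rounding use up.\<close>

definition msub :: "(nat set \<Rightarrow> real) \<Rightarrow> bool" where
  "msub g \<longleftrightarrow> mono g \<and>
     (\<forall>S T j. S \<subseteq> T \<longrightarrow> g (insert j T) - g T \<le> g (insert j S) - g S)"

lemma msub_mono: "msub g \<Longrightarrow> S \<subseteq> T \<Longrightarrow> g S \<le> g T"
  unfolding msub_def by (meson monoD)

lemma msub_marginal: "msub g \<Longrightarrow> S \<subseteq> T \<Longrightarrow> g (insert j T) - g T \<le> g (insert j S) - g S"
  unfolding msub_def by blast

lemma msub_marginal_nonneg: "msub g \<Longrightarrow> 0 \<le> g (insert j S) - g S"
  using msub_mono[of g S "insert j S"] by auto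

lemma msub_insert: "msub g \<Longrightarrow> msub (\<lambda>S. g (insert k S))"
  unfolding msub_def mono_def by (metis insert_commute insert_mono)

lemma msub_Un: "msub g \<Longrightarrow> msub (\<lambda>S. g (A \<union> S))"
  unfolding msub_def mono_def by (metis Un_insert_right Un_mono subset_refl)

lemma msub_combine:
  assumes "msub g" "msub h" "0 \<le> a" "0 \<le> b"
  shows "msub (\<lambda>S. a * g S + b * h S)"
  unfolding msub_def mono_def
proof (intro conjI allI impI)
  fix S T :: "nat set" and j assume st: "S \<subseteq> T"
  show "a * g S + b * h S \<le> a * g T + b * h T"
    using st assms by (intro add_mono mult_left_mono msub_mono) auto
  have "a * (g (insert j T) - g T) + b * (h (insert j T) - h T)
      \<le> a * (g (insert j S) - g S) + b * (h (insert j S) - h S)"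
    using st assms by (intro add_mono mult_left_mono msub_marginal) auto
  then show "a * g (insert j T) + b * h (insert j T) - (a * g T + b * h T)
      \<le> a * g (insert j S) + b * h (insert j S) - (a * g S + b * h S)"
    by (simp add: algebra_simps)
qed

text \<open>Adding the elements of \<open>T\<close> one by one, each marginal is at most its
  marginal at \<open>S\<close>. This inequality makes the sampled rows valid for every
  solution.\<close>

lemma msub_sum_marginals:
  assumes "msub g" "finite T"
  shows "g (S \<union> T) - g S \<le> (\<Sum>j\<in>T. g (insert j S) - g S)"
  using assms(2)
proof induction
  case (insert j T)
  have "g (S \<union> insert j T) - g (S \<union> T) \<le> g (insert j S) - g S"
    using msub_marginal[OF assms(1), of S "S \<union> T" j] by simp
  then show ?case using insert by simp
qed simp

text \<open>The multilinear extension: the expectation of \<open>g\<close> at a random set that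
  contains each \<open>j < k\<close> independently with probability \<open>x j\<close>. Recursion on
  the coordinates avoids a probability space.\<close>

primrec mean :: "nat \<Rightarrow> (nat \<Rightarrow> real) \<Rightarrow> (nat set \<Rightarrow> real) \<Rightarrow> real" where
  "mean 0 x g = g {}"
| "mean (Suc k) x g = x k * mean k x (\<lambda>S. g (insert k S)) + (1 - x k) * mean k x g"

lemma mean_lin: "mean k x (\<lambda>S. a * g S + b * h S) = a * mean k x g + b * mean k x h"
proof (induction k arbitrary: g h)
  case (Suc k)
  show ?case by (simp add: Suc algebra_simps)
qed simp

lemma mean_const [simp]: "mean k x (\<lambda>_. a) = a"
  by (induction k) (auto simp: algebra_simps)

lemma mean_cmult: "mean k x (\<lambda>S. a * g S) = a * mean k x g"
  using mean_lin[of k x a g 0 g] by simp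

lemma mean_add: "mean k x (\<lambda>S. g S + h S) = mean k x g + mean k x h"
  using mean_lin[of k x 1 g 1 h] by simp

lemma mean_diff: "mean k x (\<lambda>S. g S - h S) = mean k x g - mean k x h"
  using mean_lin[of k x 1 g "-1" h] by simp

lemma mean_le:
  assumes "\<And>j. j < k \<Longrightarrow> 0 \<le> x j \<and> x j \<le> 1" "\<And>S. S \<subseteq> {..<k} \<Longrightarrow> g S \<le> h S"
  shows "mean k x g \<le> mean k x h"
  using assms
proof (induction k arbitrary: g h)
  case (Suc k)
  have sub: "S \<subseteq> {..<Suc k}" "insert k S \<subseteq> {..<Suc k}" if "S \<subseteq> {..<k}" for S
    using that by force+
  show ?case unfolding mean.simps
    by (intro add_mono mult_left_mono Suc.IH Suc.prems sub) (use Suc.prems(1) in auto)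
qed simp

lemma mean_cong:
  assumes "\<And>S. S \<subseteq> {..<k} \<Longrightarrow> g S = h S"
  shows "mean k x g = mean k x h"
  using assms
proof (induction k arbitrary: g h)
  case (Suc k)
  have sub: "S \<subseteq> {..<Suc k}" "insert k S \<subseteq> {..<Suc k}" if "S \<subseteq> {..<k}" for S
    using that by force+
  have "mean k x g = mean k x h"
    "mean k x (\<lambda>S. g (insert k S)) = mean k x (\<lambda>S. h (insert k S))"
    by (intro Suc.IH Suc.prems sub; assumption)+
  then show ?case by simp
qed simp

text \<open>Averages over coordinate \<open>k\<close> first. This turns inductions over the
  coordinates into statements about the mixed function on the first \<open>k\<close>
  coordinates.\<close>

lemma mean_mix:
  "mean (Suc k) x g = mean k x (\<lambda>S. x k * g (insert k S) + (1 - x k) * g S)"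
  by (simp add: mean_lin)

text \<open>Coordinates are changed one at a time; each change costs at most \<open>d\<close>,
  because a function with values in the unit interval has marginals of absolute value at most
  1.\<close>

lemma mean_lipschitz:
  assumes "\<And>j. j < k \<Longrightarrow> 0 \<le> x j \<and> x j \<le> 1" "\<And>j. j < k \<Longrightarrow> 0 \<le> x' j \<and> x' j \<le> 1"
    and "\<And>j. j < k \<Longrightarrow> \<bar>x' j - x j\<bar> \<le> d" "\<And>S. 0 \<le> g S \<and> g S \<le> 1"
  shows "mean k x g - real k * d \<le> mean k x' g"
  using assms
proof (induction k arbitrary: g)
  case (Suc k)
  let ?h = "\<lambda>a S. a * g (insert k S) + (1 - a) * g S"
  have range: "0 \<le> ?h a S \<and> ?h a S \<le> 1" if "0 \<le> a" "a \<le> 1" for a S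
  proof
    show "0 \<le> ?h a S" using that Suc.prems(4) by simp
    have "?h a S \<le> a * 1 + (1 - a) * 1"
      by (intro add_mono mult_left_mono) (use that Suc.prems(4) in auto)
    then show "?h a S \<le> 1" by simp
  qed
  have le: "?h (x k) S - d \<le> ?h (x' k) S" for S
  proof -
    have "\<bar>(x' k - x k) * (g (insert k S) - g S)\<bar> \<le> d * 1"
      unfolding abs_mult
      by (intro mult_mono) (use Suc.prems(3)[of k] Suc.prems(4)[of S] Suc.prems(4)[of "insert k S"] in auto)
    then show ?thesis by (simp add: algebra_simps abs_le_iff)
  qed
  have "mean (Suc k) x g - d = mean k x (\<lambda>S. ?h (x k) S - d)"
    by (simp only: mean_mix mean_diff mean_const)
  also have "\<dots> \<le> mean k x (?h (x' k))"
    by (rule mean_le) (use Suc.prems le in auto)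
  also have "\<dots> - real k * d \<le> mean k x' (?h (x' k))"
    by (rule Suc.IH) (use Suc.prems range in auto)
  finally show ?case by (simp add: mean_mix algebra_simps del: mean.simps)
qed simp

text \<open>The multilinear extension along a small nonnegative step: the second-order loss is at most
  \<open>d\<^sup>2\<close> per pair of coordinates.\<close>

lemma mean_progress:
  assumes "\<And>j. j < k \<Longrightarrow> 0 \<le> x j \<and> x j \<le> 1" "\<And>j. j < k \<Longrightarrow> 0 \<le> x' j \<and> x' j \<le> 1"
    and "\<And>j. j < k \<Longrightarrow> x' j = x j + (if j \<in> Y then d else 0)" "0 \<le> d"
    and "msub g" "\<And>S. 0 \<le> g S \<and> g S \<le> 1"
  shows "mean k x g + d * (\<Sum>j\<in>Y \<inter> {..<k}. mean k x (\<lambda>S. g (insert j S) - g S))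
      - (real k)\<^sup>2 * d\<^sup>2 \<le> mean k x' g"
  using assms
proof (induction k arbitrary: g)
  case (Suc k)
  let ?h = "\<lambda>a S. a * g (insert k S) + (1 - a) * g S"
  let ?D = "\<lambda>S. g (insert k S) - g S"
  define e where "e = (if k \<in> Y then d else 0)"
  have xk: "0 \<le> x k" "x k \<le> 1" "x' k = x k + e" using Suc.prems(1,3)[of k] by (auto simp: e_def)
  have range: "0 \<le> ?h (x k) S \<and> ?h (x k) S \<le> 1" for S
  proof
    show "0 \<le> ?h (x k) S" using xk Suc.prems(6) by simp
    have "?h (x k) S \<le> x k * 1 + (1 - x k) * 1"
      by (intro add_mono mult_left_mono) (use xk Suc.prems(6) in auto)
    then show "?h (x k) S \<le> 1" by simp
  qed
  have D: "0 \<le> ?D S \<and> ?D S \<le> 1" for S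
    using msub_marginal_nonneg[OF Suc.prems(5)] Suc.prems(6)[of S] Suc.prems(6)[of "insert k S"] by force
  have ms: "msub (?h (x k))"
    by (intro msub_combine msub_insert Suc.prems(5)) (use xk in auto)
  have IH: "mean k x (?h (x k))
      + d * (\<Sum>j\<in>Y \<inter> {..<k}. mean k x (\<lambda>S. ?h (x k) (insert j S) - ?h (x k) S))
      - (real k)\<^sup>2 * d\<^sup>2 \<le> mean k x' (?h (x k))"
    by (rule Suc.IH) (use Suc.prems ms range in auto)
  \<comment> \<open>The sum to be bounded takes the marginal of \<open>k\<close> at
    \<open>x\<close>, but the actual increase sees it at \<open>x'\<close>. The Lipschitz bound,
    multiplied by \<open>e \<le> d\<close>, charges \<open>k * d^2\<close> for the
    difference.\<close>
  have lip: "mean k x ?D - real k * d \<le> mean k x' ?D"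
    by (rule mean_lipschitz) (use Suc.prems D in auto)
  \<comment> \<open>The marginal of \<open>k\<close> itself vanishes when \<open>k\<close> is
    already in the random set, hence the factor \<open>1 - x k\<close>. It may be dropped, since the
    marginals are nonnegative.\<close>
  have split: "(\<Sum>j\<in>Y \<inter> {..<Suc k}. mean (Suc k) x (\<lambda>S. g (insert j S) - g S))
      = (\<Sum>j\<in>Y \<inter> {..<k}. mean k x (\<lambda>S. ?h (x k) (insert j S) - ?h (x k) S))
        + (if k \<in> Y then (1 - x k) * mean k x ?D else 0)"
  proof -
    have "Y \<inter> {..<Suc k} = (if k \<in> Y then insert k (Y \<inter> {..<k}) else Y \<inter> {..<k})"
      by (auto simp: less_Suc_eq)
    moreover have "mean (Suc k) x (\<lambda>S. g (insert j S) - g S)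
        = mean k x (\<lambda>S. ?h (x k) (insert j S) - ?h (x k) S)" if "j < k" for j
    proof -
      have "mean (Suc k) x (\<lambda>S. g (insert j S) - g S) = mean k x
         (\<lambda>S. x k * (g (insert j (insert k S)) - g (insert k S)) + (1 - x k) * (g (insert j S) - g S))"
        by (rule mean_mix)
      also have "\<dots> = mean k x (\<lambda>S. ?h (x k) (insert j S) - ?h (x k) S)"
        by (simp add: algebra_simps insert_commute)
      finally show ?thesis .
    qed
    ultimately show ?thesis
      by (simp add: sum.insert)
  qed
  have Dpos: "0 \<le> mean k x ?D"
    using mean_le[of k x "\<lambda>_. 0" ?D] Suc.prems(1) D by simp
  have De: "d * (if k \<in> Y then (1 - x k) * mean k x ?D else 0) \<le> e * mean k x ?D"
    using Dpos xk \<open>0 \<le> d\<close> by (auto simp: e_def intro!: mult_left_mono mult_left_le_one_le)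
  have "e * (mean k x ?D - real k * d) \<le> e * mean k x' ?D"
    using lip \<open>0 \<le> d\<close> by (intro mult_left_mono) (auto simp: e_def)
  moreover have "e * (real k * d) \<le> d * (real k * d)"
    using \<open>0 \<le> d\<close> by (intro mult_right_mono) (auto simp: e_def)
  ultimately have eD: "e * mean k x ?D - real k * d\<^sup>2 \<le> e * mean k x' ?D"
    by (simp add: algebra_simps power2_eq_square)
  have "mean (Suc k) x' g = mean k x' (\<lambda>S. ?h (x k) S + e * ?D S)"
    unfolding mean_mix xk(3) by (rule mean_cong) (simp add: algebra_simps)
  also have "\<dots> = mean k x' (?h (x k)) + e * mean k x' ?D"
    by (simp only: mean_add mean_cmult)
  finally have x': "mean (Suc k) x' g = mean k x' (?h (x k)) + e * mean k x' ?D" .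
  have x: "mean (Suc k) x g = mean k x (?h (x k))" by (rule mean_mix)
  have sq: "(real k)\<^sup>2 * d\<^sup>2 + real k * d\<^sup>2 \<le> (real (Suc k))\<^sup>2 * d\<^sup>2"
    using \<open>0 \<le> d\<close> by (simp add: power2_eq_square algebra_simps)
  show ?case
    unfolding split x x' distrib_left using IH De eD sq by linarith
qed simp

text \<open>Tensorization of the variance; summing it up uses that an element contributes less on
  average than in isolation.\<close>

lemma mean_variance:
  assumes "\<And>j. j < k \<Longrightarrow> 0 \<le> x j \<and> x j \<le> 1" "msub g"
    and "\<And>j S. j < k \<Longrightarrow> x j \<noteq> 0 \<Longrightarrow> g (insert j S) - g S \<le> a"
  shows "mean k x (\<lambda>S. (g S)\<^sup>2) - (mean k x g)\<^sup>2 \<le> a * (mean k x g - g {})"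
  using assms
proof (induction k arbitrary: g)
  case (Suc k)
  let ?g1 = "\<lambda>S. g (insert k S)"
  define p where "p = x k"
  define m0 m1 where "m0 = mean k x g" and "m1 = mean k x ?g1"
  define q0 q1 where "q0 = mean k x (\<lambda>S. (g S)\<^sup>2)" and "q1 = mean k x (\<lambda>S. (?g1 S)\<^sup>2)"
  have p: "0 \<le> p" "p \<le> 1" using Suc.prems(1)[of k] by (auto simp: p_def)
  have IH0: "q0 - m0\<^sup>2 \<le> a * (m0 - g {})"
    unfolding q0_def m0_def by (rule Suc.IH) (use Suc.prems in auto)
  have IH1: "q1 - m1\<^sup>2 \<le> a * (m1 - g {k})"
    unfolding q1_def m1_def
  proof (rule Suc.IH)
    show "g (insert k (insert j S)) - g (insert k S) \<le> a" if "j < k" "x j \<noteq> 0" for j S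
      using Suc.prems(3)[of j "insert k S"] that by (simp add: insert_commute)
  qed (use Suc.prems msub_insert in auto)
  have diff: "m1 - m0 = mean k x (\<lambda>S. ?g1 S - g S)" by (simp add: mean_diff m0_def m1_def)
  have d0: "0 \<le> m1 - m0"
    unfolding diff using mean_le[of k x "\<lambda>_. 0"] Suc.prems(1) msub_marginal_nonneg[OF Suc.prems(2)] by simp
  have d1: "m1 - m0 \<le> g {k} - g {}"
    unfolding diff using mean_le[of k x _ "\<lambda>_. g {k} - g {}"] Suc.prems(1)
      msub_marginal[OF Suc.prems(2), of "{}" _ k] by simp
  \<comment> \<open>The bound \<open>a\<close> on the marginals of \<open>k\<close>, and with it
    \<open>0 \<le> a\<close>, is available only if \<open>k\<close> has nonzero probability;
    otherwise the factor \<open>p\<close> removes the term.\<close>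
  have cross: "p * (1 - p) * (m1 - m0)\<^sup>2 \<le> p * (1 - p) * (a * (m1 - m0))"
    and a0: "p \<noteq> 0 \<Longrightarrow> 0 \<le> a"
  proof -
    have "m1 - m0 \<le> a" if "p \<noteq> 0"
      unfolding diff using mean_le[of k x _ "\<lambda>_. a"] Suc.prems(1,3) that by (simp add: p_def)
    then show "p * (1 - p) * (m1 - m0)\<^sup>2 \<le> p * (1 - p) * (a * (m1 - m0))" "p \<noteq> 0 \<Longrightarrow> 0 \<le> a"
      using d0 p by (cases "p = 0"; force simp: power2_eq_square intro!: mult_left_mono mult_right_mono)+
  qed
  have "p * (1 - p) * (a * (m1 - m0)) \<le> p * (a * (g {k} - g {}))"
  proof (cases "p = 0")
    case False
    have "(1 - p) * (a * (m1 - m0)) \<le> 1 * (a * (m1 - m0))"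
      using p a0[OF False] d0 by (intro mult_right_mono) auto
    also have "\<dots> \<le> a * (g {k} - g {})" using d1 a0[OF False] by (simp add: mult_left_mono)
    finally show ?thesis using p by (simp add: mult.assoc mult_left_mono)
  qed simp
  moreover have "p * (q1 - m1\<^sup>2) \<le> p * (a * (m1 - g {k}))" using IH1 p by (intro mult_left_mono)
  moreover have "(1 - p) * (q0 - m0\<^sup>2) \<le> (1 - p) * (a * (m0 - g {}))"
    using IH0 p by (intro mult_left_mono) auto
  \<comment> \<open>Law of total variance, conditioning on whether \<open>k\<close> belongs to the
    set.\<close>
  moreover have "p * q1 + (1 - p) * q0 - (p * m1 + (1 - p) * m0)\<^sup>2
      = p * (q1 - m1\<^sup>2) + (1 - p) * (q0 - m0\<^sup>2) + p * (1 - p) * (m1 - m0)\<^sup>2"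
    by (simp add: power2_eq_square algebra_simps)
  moreover have "a * (p * m1 + (1 - p) * m0 - g {})
      = p * (a * (m1 - g {k})) + (1 - p) * (a * (m0 - g {})) + p * (a * (g {k} - g {}))"
    by (simp add: algebra_simps)
  ultimately show ?case
    using cross by (simp add: p_def m0_def m1_def q0_def q1_def)
qed simp

section \<open>Averages over bit strings\<close>

text \<open>Expectation over uniform bit strings as a finite sum. Independence of disjoint bit
  positions then is just \<open>bavg_split\<close>, and measure theory enters only through
  \<open>prob_random_bits\<close>.\<close>

definition bavg :: "nat \<Rightarrow> (bool list \<Rightarrow> real) \<Rightarrow> real" where
  "bavg m h = (\<Sum>r | length r = m. h r) / 2 ^ m"

lemma finite_bits: "finite {r :: bool list. length r = m}"
  using finite_lists_length_eq[of "UNIV :: bool set" m] by simp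

lemma card_bits: "card {r :: bool list. length r = m} = 2 ^ m"
  using card_lists_length_eq[of "UNIV :: bool set" m] by simp

lemma bavg_0 [simp]: "bavg 0 h = h []"
  by (simp add: bavg_def)

lemma bavg_split: "bavg (a + b) h = bavg a (\<lambda>x. bavg b (\<lambda>y. h (x @ y)))"
proof -
  have bij: "bij_betw (\<lambda>(x, y). x @ y) ({x :: bool list. length x = a} \<times> {y. length y = b})
    {r. length r = a + b}"
    by (rule bij_betwI[where g = "\<lambda>r. (take a r, drop a r)"]) auto
  have "(\<Sum>r | length r = a + b. h r)
      = (\<Sum>(x, y)\<in>{x. length x = a} \<times> {y. length y = b}. h (x @ y))"
    by (subst sum.reindex_bij_betw[OF bij, symmetric]) (simp add: case_prod_unfold)
  also have "\<dots> = (\<Sum>x | length x = a. \<Sum>y | length y = b. h (x @ y))"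
    by (rule sum.cartesian_product[symmetric])
  finally show ?thesis
    by (simp add: bavg_def power_add sum_divide_distrib[symmetric] mult.commute)
qed

lemma bavg_lin: "bavg m (\<lambda>r. a * g r + b * h r) = a * bavg m g + b * bavg m h"
  by (simp add: bavg_def sum.distrib sum_distrib_left add_divide_distrib)

lemma bavg_const [simp]: "bavg m (\<lambda>_. a) = a"
  by (simp add: bavg_def card_bits)

lemma bavg_add: "bavg m (\<lambda>r. g r + h r) = bavg m g + bavg m h"
  using bavg_lin[of m 1 g 1 h] by simp

lemma bavg_diff: "bavg m (\<lambda>r. g r - h r) = bavg m g - bavg m h"
  using bavg_lin[of m 1 g "-1" h] by simp

lemma bavg_cmult: "bavg m (\<lambda>r. a * g r) = a * bavg m g"
  using bavg_lin[of m a g 0 g] by simp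

lemma bavg_sum: "bavg m (\<lambda>r. \<Sum>i\<in>I. g i r) = (\<Sum>i\<in>I. bavg m (g i))"
  unfolding bavg_def by (subst sum.swap) (simp add: sum_divide_distrib)

lemma bavg_le: "(\<And>r. length r = m \<Longrightarrow> g r \<le> h r) \<Longrightarrow> bavg m g \<le> bavg m h"
  unfolding bavg_def by (intro divide_right_mono sum_mono) auto

lemma bavg_cong: "(\<And>r. length r = m \<Longrightarrow> g r = h r) \<Longrightarrow> bavg m g = bavg m h"
  unfolding bavg_def by simp

text \<open>A conditional bound, uniform in the bits already consumed, is averaged over these bits;
  the bits after the block do not matter. This handles randomized steps that depend on the
  history.\<close>

lemma bavg_adaptive:
  assumes "\<And>x. length x = a \<Longrightarrow> bavg k (h x) \<le> e" "a + k \<le> m"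
  shows "bavg m (\<lambda>r. h (take a r) (take k (drop a r))) \<le> e"
proof -
  obtain b where m: "m = a + (k + b)" using assms(2) by (metis le_Suc_ex add.assoc)
  have "bavg m (\<lambda>r. h (take a r) (take k (drop a r)))
      = bavg a (\<lambda>x. bavg k (\<lambda>y. bavg b (\<lambda>z. h x y)))"
    unfolding m bavg_split by (intro bavg_cong) simp
  also have "\<dots> \<le> bavg a (\<lambda>_. e)" by (intro bavg_le) (simp add: assms(1))
  finally show ?thesis by simp
qed

definition blk :: "nat \<Rightarrow> nat \<Rightarrow> bool list \<Rightarrow> bool list" where
  "blk k l r = take k (drop (l * k) r)"

lemma blk_append1: "length x = m * k \<Longrightarrow> l < m \<Longrightarrow> blk k l (x @ y) = blk k l x"
proof -
  assume l: "length x = m * k" "l < m"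
  have "l * k + k \<le> m * k" using l(2) by (metis Suc_leI add.commute mult_Suc mult_le_mono1)
  then show ?thesis using l(1) by (simp add: blk_def)
qed

lemma blk_append2: "length x = m * k \<Longrightarrow> length y = k \<Longrightarrow> blk k m (x @ y) = y"
  by (simp add: blk_def)

lemma bavg_blk_prod:
  "bavg (m * k) (\<lambda>r. \<Prod>l<m. h (blk k l r)) = bavg k h ^ m"
proof (induction m)
  case (Suc m)
  have "bavg (Suc m * k) (\<lambda>r. \<Prod>l<Suc m. h (blk k l r))
      = bavg (m * k) (\<lambda>x. bavg k (\<lambda>y. (\<Prod>l<m. h (blk k l x)) * h y))"
    unfolding mult_Suc add.commute[of k] bavg_split
    by (intro bavg_cong) (simp add: blk_append1[where m = m] blk_append2[where m = m])
  also have "\<dots> = bavg (m * k) (\<lambda>x. bavg k h * (\<Prod>l<m. h (blk k l x)))"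
    by (intro bavg_cong) (subst bavg_cmult, rule mult.commute)
  finally show ?case by (simp add: bavg_cmult Suc)
qed simp

text \<open>Variance of a sum of independent terms: the last block is centered, so the cross term
  averages to 0, and each squared deviation is at most 1.\<close>

lemma bavg_blk_square:
  assumes "\<And>r. 0 \<le> X r \<and> X r \<le> 1" "bavg k X = \<mu>"
  shows "bavg (m * k) (\<lambda>r. ((\<Sum>l<m. X (blk k l r)) - real m * \<mu>)\<^sup>2) \<le> real m"
proof (induction m)
  case (Suc m)
  define Z where "Z x = (\<Sum>l<m. X (blk k l x)) - real m * \<mu>" for x
  have mu: "0 \<le> \<mu>" "\<mu> \<le> 1"
    using bavg_le[of k "\<lambda>_. 0" X] bavg_le[of k X "\<lambda>_. 1"] assms by auto
  have W: "(X y - \<mu>)\<^sup>2 \<le> 1" for y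
    unfolding abs_square_le_1 abs_le_iff using assms(1)[of y] mu by linarith
  have "bavg (Suc m * k) (\<lambda>r. ((\<Sum>l<Suc m. X (blk k l r)) - real (Suc m) * \<mu>)\<^sup>2)
      = bavg (m * k) (\<lambda>x. bavg k (\<lambda>y. (Z x + (X y - \<mu>))\<^sup>2))"
    unfolding mult_Suc add.commute[of k] bavg_split Z_def
    by (intro bavg_cong arg_cong[of _ _ power2])
      (simp add: blk_append1[where m = m] blk_append2[where m = m] algebra_simps)
  also have "\<dots> = bavg (m * k) (\<lambda>x. bavg k (\<lambda>y. (Z x)\<^sup>2 + (2 * Z x * (X y - \<mu>) + (X y - \<mu>)\<^sup>2)))"
    by (simp only: power2_sum ac_simps)
  also have "\<dots> \<le> bavg (m * k) (\<lambda>x. bavg k (\<lambda>y. (Z x)\<^sup>2 + (2 * Z x * (X y - \<mu>) + 1)))"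
    using W by (intro bavg_le) auto
  also have "\<dots> = bavg (m * k) (\<lambda>x. (Z x)\<^sup>2 + 1)"
    by (simp add: bavg_add bavg_cmult bavg_diff assms(2))
  finally show ?case using Suc by (simp add: bavg_add Z_def)
qed simp

text \<open>Chebyshev's inequality. Only the upper tail is stated, since only overestimates can
  mislead the greedy step.\<close>

lemma bavg_blk_deviation:
  assumes "\<And>r. 0 \<le> X r \<and> X r \<le> 1" "bavg k X = \<mu>" "0 < m" "0 < a"
  shows "bavg (m * k) (\<lambda>r. of_bool (\<mu> + a < (\<Sum>l<m. X (blk k l r)) / real m)) \<le> 1 / (real m * a\<^sup>2)"
proof -
  let ?Z = "\<lambda>r. (\<Sum>l<m. X (blk k l r)) - real m * \<mu>"
  have "of_bool (\<mu> + a < (\<Sum>l<m. X (blk k l r)) / real m) \<le> (1 / (real m * a)\<^sup>2) * (?Z r)\<^sup>2" for r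
  proof (cases "\<mu> + a < (\<Sum>l<m. X (blk k l r)) / real m")
    case True
    then have "real m * a \<le> ?Z r" using assms(3) by (simp add: field_simps)
    then have "(real m * a)\<^sup>2 \<le> (?Z r)\<^sup>2" using assms(3,4) by (intro power_mono) auto
    moreover have "0 < (real m * a)\<^sup>2" using assms(3,4) by simp
    ultimately have "1 \<le> (?Z r)\<^sup>2 / (real m * a)\<^sup>2" by (simp only: le_divide_eq_1_pos)
    then show ?thesis using True by (simp only: of_bool_eq times_divide_eq_left mult_1)
  qed auto
  then have "bavg (m * k) (\<lambda>r. of_bool (\<mu> + a < (\<Sum>l<m. X (blk k l r)) / real m))
      \<le> (1 / (real m * a)\<^sup>2) * bavg (m * k) (\<lambda>r. (?Z r)\<^sup>2)"
    unfolding bavg_cmult[symmetric] by (intro bavg_le)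
  also have "\<dots> \<le> (1 / (real m * a)\<^sup>2) * real m"
    by (intro mult_left_mono bavg_blk_square assms) auto
  also have "\<dots> = 1 / (real m * a\<^sup>2)" using assms(3,4) by (simp add: field_simps power2_eq_square)
  finally show ?thesis .
qed

lemma prob_random_bits:
  "measure_pmf.prob (random_bits m) {r. Q r} = bavg m (\<lambda>r. of_bool (Q r))"
proof -
  have "replicate m True \<in> {r. length r = m}" by simp
  then have ne: "{r :: bool list. length r = m} \<noteq> {}" by blast
  have "measure_pmf.prob (random_bits m) {r. Q r}
      = real (card ({r. length r = m} \<inter> {r. Q r})) / 2 ^ m"
    unfolding random_bits_def by (simp add: measure_pmf_of_set[OF ne finite_bits] card_bits)
  also have "real (card ({r. length r = m} \<inter> {r. Q r})) = (\<Sum>r | length r = m. of_bool (Q r))"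
    using finite_bits[of m] by (simp add: of_bool_def sum.If_cases)
  finally show ?thesis by (simp add: bavg_def)
qed

text \<open>Most significant bit first, and doubling written as an addition: this is literally the
  loop in \<open>p_sample\<close>, as naturals of programs cannot be multiplied.\<close>

definition num :: "bool list \<Rightarrow> nat" where
  "num r = foldl (\<lambda>u b. u + u + of_bool b) 0 r"

lemma num_Nil [simp]: "num [] = 0"
  by (simp add: num_def)

lemma num_snoc [simp]: "num (r @ [b]) = num r + num r + of_bool b"
  by (simp add: num_def)

text \<open>A further random bit sends the value \<open>k\<close> to \<open>2 * k\<close> or
  \<open>2 * k + 1\<close>, so uniformity is preserved.\<close>

lemma bavg_num: "bavg b (\<lambda>r. h (num r)) = (\<Sum>k<2 ^ b. h k) / 2 ^ b"
proof (induction b arbitrary: h)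
  case (Suc b)
  have one: "bavg 1 g = (g [True] + g [False]) / 2" for g
  proof -
    have "{r :: bool list. length r = 1} = {[True], [False]}"
      by (auto simp: length_Suc_conv)
    then show ?thesis by (simp add: bavg_def)
  qed
  have "bavg (Suc b) (\<lambda>r. h (num r))
      = bavg b (\<lambda>r. (h (2 * num r) + h (Suc (2 * num r))) / 2)"
    unfolding Suc_eq_plus1 bavg_split one by (simp add: mult_2 add.commute)
  also have "\<dots> = (\<Sum>k<2 ^ b. (h (2 * k) + h (Suc (2 * k))) / 2) / 2 ^ b"
    by (rule Suc)
  also have "(\<Sum>k<2 ^ b. (h (2 * k) + h (Suc (2 * k))) / 2) = (\<Sum>k<2 * 2 ^ b. h k) / 2"
  proof -
    have "(\<Sum>k<a. h (2 * k) + h (Suc (2 * k))) = (\<Sum>k<2 * a. h k)" for a :: nat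
      by (induction a) auto
    then show ?thesis by (simp add: sum_divide_distrib[symmetric])
  qed
  finally show ?case by simp
qed simp

lemma bavg_num_less:
  assumes "c \<le> 2 ^ b" shows "bavg b (\<lambda>r. of_bool (num r < c)) = real c / 2 ^ b"
proof -
  have "(\<Sum>k<2 ^ b. of_bool (k < c)) = (\<Sum>k<c. 1 :: real)"
    using assms by (intro sum.mono_neutral_cong_right) auto
  then show ?thesis using bavg_num[of b "\<lambda>k. of_bool (k < c)"] by simp
qed

text \<open>Independent rounding: \<open>j\<close> enters if the number in the \<open>j\<close>-th
  block of \<open>b\<close> bits is below the threshold \<open>c j\<close>, hence with probability
  exactly \<open>c j / 2 ^ b\<close> as long as \<open>c j \<le> 2 ^ b\<close>.\<close>

definition thr :: "nat \<Rightarrow> nat \<Rightarrow> (nat \<Rightarrow> nat) \<Rightarrow> bool list \<Rightarrow> nat set" where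
  "thr n b c r = {j. j < n \<and> num (blk b j r) < c j}"

lemma bavg_thr:
  assumes "\<And>j. j < n \<Longrightarrow> c j \<le> 2 ^ b"
  shows "bavg (n * b) (\<lambda>r. h (thr n b c r)) = mean n (\<lambda>j. real (c j) / 2 ^ b) h"
  using assms
proof (induction n arbitrary: h)
  case 0
  then show ?case by (simp add: thr_def)
next
  case (Suc n)
  let ?x = "\<lambda>j. real (c j) / 2 ^ b"
  have thr: "thr (Suc n) b c (r @ y)
      = (if num y < c n then insert n (thr n b c r) else thr n b c r)"
    if "length r = n * b" "length y = b" for r y
    using that using blk_append1[OF that(1)] blk_append2[OF that]
    by (auto simp: thr_def less_Suc_eq)
  have "bavg (Suc n * b) (\<lambda>r. h (thr (Suc n) b c r))
      = bavg (n * b) (\<lambda>r. bavg b (\<lambda>y. (h (insert n (thr n b c r)) - h (thr n b c r)) * of_bool (num y < c n)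
          + h (thr n b c r)))"
    unfolding mult_Suc add.commute[of b] bavg_split by (intro bavg_cong) (simp add: thr)
  also have "\<dots> = bavg (n * b) (\<lambda>r. ?x n * h (insert n (thr n b c r)) + (1 - ?x n) * h (thr n b c r))"
  proof (rule bavg_cong)
    fix r
    let ?a = "h (insert n (thr n b c r))" and ?b = "h (thr n b c r)"
    show "bavg b (\<lambda>y. (?a - ?b) * of_bool (num y < c n) + ?b) = ?x n * ?a + (1 - ?x n) * ?b"
      unfolding bavg_add bavg_cmult bavg_const bavg_num_less[OF Suc.prems[OF lessI]]
      by (simp add: algebra_simps)
  qed
  also have "\<dots> = mean n ?x (\<lambda>S. ?x n * h (insert n S) + (1 - ?x n) * h S)"
    using Suc.IH[of "\<lambda>S. ?x n * h (insert n S) + (1 - ?x n) * h S"] Suc.prems by simp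
  finally show ?case by (simp only: mean_mix)
qed

section \<open>The continuous greedy run\<close>

text \<open>\<open>A\<close> is the guess and \<open>U\<close> the set of usable elements;
  \<open>m\<close> samples are drawn per step, \<open>1 / 2 ^ b\<close> is the step size, and
  \<open>M\<close> counts all rows. The targets \<open>\<beta>\<close> are lowered by
  \<open>e\<close> to pay for large elements that a solution may lose outside \<open>U\<close>. Rows
  from \<open>t\<close> on have the fixed right-hand sides \<open>Ds\<close> and coefficients
  \<open>Ws\<close>.\<close>

locale run =
  fixes n t M m b :: nat and G :: "nat \<Rightarrow> nat set \<Rightarrow> real" and \<beta> :: "nat \<Rightarrow> real" and e :: real
    and A U :: "nat set" and Ds :: "nat \<Rightarrow> real" and Ws :: "nat \<Rightarrow> nat \<Rightarrow> real"
begin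

text \<open>A point is represented by counters \<open>c\<close>, with coordinates \<open>c j / 2 ^ b\<close>. Row \<open>i\<close> asks a set \<open>Y\<close>
  for \<open>(\<Sum>j\<in>Y. Wv c r i j) \<ge> Dv c r i\<close>: the rows below \<open>t\<close> linearize the functions at the samples, the
  other rows are static. The residuals \<open>z\<close> of the rows below \<open>t\<close> are discounted, which turns them into
  deficits of the continuous greedy trajectory.\<close>

definition smp :: "(nat \<Rightarrow> nat) \<Rightarrow> bool list \<Rightarrow> nat set" where
  "smp c r = A \<union> thr n b c r"

definition smps :: "(nat \<Rightarrow> nat) \<Rightarrow> bool list \<Rightarrow> nat \<Rightarrow> nat set" where
  "smps c r l = smp c (blk (n * b) l r)"

definition Dv :: "(nat \<Rightarrow> nat) \<Rightarrow> bool list \<Rightarrow> nat \<Rightarrow> real" where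
  "Dv c r i = (if i < t then \<beta> i - e - (\<Sum>l<m. G i (smps c r l) / real m) else Ds i)"

definition Wv :: "(nat \<Rightarrow> nat) \<Rightarrow> bool list \<Rightarrow> nat \<Rightarrow> nat \<Rightarrow> real" where
  "Wv c r i j = (if i < t then \<Sum>l<m. (G i (insert j (smps c r l)) - G i (smps c r l)) / real m
     else Ws i j)"

definition zd :: "(nat \<Rightarrow> real) \<Rightarrow> nat \<Rightarrow> real" where
  "zd z i = (if i < t then z i * (1 - 1 / 2 ^ b) else z i)"

definition lam :: "(nat \<Rightarrow> real) \<Rightarrow> nat \<Rightarrow> real" where
  "lam z i = max 0 (zd z i)"

definition Ys :: "(nat \<Rightarrow> nat) \<Rightarrow> (nat \<Rightarrow> real) \<Rightarrow> bool list \<Rightarrow> nat set" where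
  "Ys c z r = {j \<in> U. 0 < (\<Sum>i<M. lam z i * Wv c r i j)}"

definition dv :: "(nat \<Rightarrow> nat) \<Rightarrow> (nat \<Rightarrow> real) \<Rightarrow> bool list \<Rightarrow> nat \<Rightarrow> real" where
  "dv c z r i = Dv c r i - (\<Sum>j\<in>Ys c z r. Wv c r i j)"

definition viol :: "(nat \<Rightarrow> nat) \<Rightarrow> (nat \<Rightarrow> real) \<Rightarrow> bool list \<Rightarrow> bool" where
  "viol c z r \<longleftrightarrow> 0 < (\<Sum>i<M. lam z i * dv c z r i)"

primrec st :: "nat \<Rightarrow> bool list \<Rightarrow> (nat \<Rightarrow> nat) \<times> (nat \<Rightarrow> real)" where
  "st 0 r = (\<lambda>_. 0, \<lambda>_. 0)"
| "st (Suc s) r = (let (c, z) = st s r; y = blk (m * (n * b)) s r in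
     (\<lambda>j. c j + of_bool (j \<in> Ys c z y), \<lambda>i. zd z i + dv c z y i))"

definition cnt :: "nat \<Rightarrow> bool list \<Rightarrow> nat \<Rightarrow> nat" where
  "cnt s r = fst (st s r)"

definition zs :: "nat \<Rightarrow> bool list \<Rightarrow> nat \<Rightarrow> real" where
  "zs s r = snd (st s r)"

abbreviation sblk :: "nat \<Rightarrow> bool list \<Rightarrow> bool list" where
  "sblk \<equiv> blk (m * (n * b))"

lemma cnt_0 [simp]: "cnt 0 r = (\<lambda>_. 0)"
  and cnt_Suc: "cnt (Suc s) r = (\<lambda>j. cnt s r j + of_bool (j \<in> Ys (cnt s r) (zs s r) (sblk s r)))"
  and zs_0 [simp]: "zs 0 r = (\<lambda>_. 0)"
  and zs_Suc: "zs (Suc s) r = (\<lambda>i. zd (zs s r) i + dv (cnt s r) (zs s r) (sblk s r) i)"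
  by (simp_all add: cnt_def zs_def case_prod_unfold Let_def)

definition violated :: "nat \<Rightarrow> bool list \<Rightarrow> bool" where
  "violated s r \<longleftrightarrow> viol (cnt s r) (zs s r) (sblk s r)"

text \<open>The state after \<open>s\<close> steps is a function of the bits consumed so far; this
  is what makes the following bits fresh in applications of \<open>bavg_adaptive\<close>.\<close>

lemma st_take:
  assumes "s * (m * (n * b)) \<le> k"
  shows "st s (take k r) = st s r"
  using assms
proof (induction s)
  case (Suc s)
  have "sblk s (take k r) = sblk s r"
    using Suc.prems by (simp add: blk_def drop_take min_def)
  then show ?case using Suc by simp
qed simp

lemma cnt_le: "cnt s r j \<le> s"
  by (induction s) (auto simp: cnt_Suc)

lemma Ys_subset: "Ys c z r \<subseteq> U"
  by (auto simp: Ys_def)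

lemma cnt_outside: "j \<notin> U \<Longrightarrow> cnt s r j = 0"
  by (induction s) (use Ys_subset in \<open>auto simp: cnt_Suc\<close>)

lemma lam_nonneg: "0 \<le> lam z i"
  by (simp add: lam_def)

end

locale run_ok = run +
  assumes m_pos: "0 < m" and U_sub: "U \<subseteq> {..<n}"
    and G_msub: "\<And>i. i < t \<Longrightarrow> msub (G i)"
    and G_range: "\<And>i S. i < t \<Longrightarrow> 0 \<le> G i S \<and> G i S \<le> 1"
begin

lemma finite_U: "finite U"
  using U_sub finite_subset by blast

text \<open>The set \<open>Ys\<close> maximizes the aggregated row over all subsets of \<open>U\<close>, so a set satisfying every
  row individually rules out a violation.\<close>

lemma no_violation:
  assumes T: "T \<subseteq> U" and f: "\<And>i. i < t \<Longrightarrow> \<beta> i - e \<le> G i (A \<union> T)"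
    and lin: "\<And>i. t \<le> i \<Longrightarrow> i < M \<Longrightarrow> Ds i \<le> (\<Sum>j\<in>T. Ws i j)"
  shows "\<not> viol c z r"
proof -
  have fT: "finite T" using T finite_U finite_subset by blast
  have row: "Dv c r i \<le> (\<Sum>j\<in>T. Wv c r i j)" if "i < M" for i
  proof (cases "i < t")
    case True
    have "\<beta> i - e = (\<Sum>l<m. (\<beta> i - e) / real m)" using m_pos by simp
    also have "\<dots> \<le> (\<Sum>l<m. (G i (smps c r l) + (\<Sum>j\<in>T. G i (insert j (smps c r l)) - G i (smps c r l))) / real m)"
    proof (intro sum_mono divide_right_mono)
      fix l
      have "\<beta> i - e \<le> G i (A \<union> T)" by (rule f[OF True])
      also have "\<dots> \<le> G i (smps c r l \<union> T)"
        using G_msub[OF True] by (rule msub_mono) (auto simp: smps_def smp_def)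
      also have "\<dots> \<le> G i (smps c r l) + (\<Sum>j\<in>T. G i (insert j (smps c r l)) - G i (smps c r l))"
        using msub_sum_marginals[OF G_msub[OF True] fT] by (simp add: algebra_simps)
      finally show "\<beta> i - e \<le> G i (smps c r l) + (\<Sum>j\<in>T. G i (insert j (smps c r l)) - G i (smps c r l))" .
    qed simp
    also have "\<dots> = (\<Sum>l<m. G i (smps c r l) / real m)
        + (\<Sum>l<m. \<Sum>j\<in>T. (G i (insert j (smps c r l)) - G i (smps c r l)) / real m)"
      by (simp add: add_divide_distrib sum.distrib sum_divide_distrib)
    also have "(\<Sum>l<m. \<Sum>j\<in>T. (G i (insert j (smps c r l)) - G i (smps c r l)) / real m)
        = (\<Sum>j\<in>T. Wv c r i j)"
      using True by (subst sum.swap) (simp add: Wv_def)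
    finally show ?thesis using True by (simp add: Dv_def)
  qed (use that lin in \<open>simp add: Dv_def Wv_def\<close>)
  let ?w = "\<lambda>j. \<Sum>i<M. lam z i * Wv c r i j"
  have agg: "(\<Sum>i<M. lam z i * (\<Sum>j\<in>X. Wv c r i j)) = (\<Sum>j\<in>X. ?w j)" for X
    by (simp add: sum_distrib_left) (rule sum.swap)
  \<comment> \<open>Elements of \<open>U\<close> outside \<open>Ys\<close> have nonpositive weight
    and those inside have positive weight, so dropping the former and adding the latter can only
    help.\<close>
  have "(\<Sum>j\<in>T. ?w j) \<le> (\<Sum>j\<in>T \<inter> Ys c z r. ?w j)"
    using fT T by (intro sum_mono2[of T "T \<inter> Ys c z r" "\<lambda>j. - ?w j", unfolded sum_negf neg_le_iff_le])
      (auto simp: Ys_def)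
  also have "\<dots> \<le> (\<Sum>j\<in>Ys c z r. ?w j)"
    using finite_subset[OF Ys_subset finite_U] by (intro sum_mono2) (auto simp: Ys_def)
  finally have "(\<Sum>i<M. lam z i * (\<Sum>j\<in>T. Wv c r i j)) \<le> (\<Sum>i<M. lam z i * (\<Sum>j\<in>Ys c z r. Wv c r i j))"
    by (simp only: agg)
  moreover have "(\<Sum>i<M. lam z i * Dv c r i) \<le> (\<Sum>i<M. lam z i * (\<Sum>j\<in>T. Wv c r i j))"
    using row by (intro sum_mono mult_left_mono lam_nonneg) auto
  ultimately show ?thesis
    by (simp add: viol_def dv_def right_diff_distrib sum_subtractf)
qed

definition F :: "nat \<Rightarrow> (nat \<Rightarrow> nat) \<Rightarrow> real" where
  "F i c = mean n (\<lambda>j. real (c j) / 2 ^ b) (\<lambda>S. G i (A \<union> S))"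

text \<open>The expected marginal rather than the partial derivative of \<open>F\<close>, from which
  it differs by the factor one minus the coordinate of \<open>j\<close>. It is what averages of
  sampled marginals estimate and what \<open>mean_progress\<close> uses.\<close>

definition Fd :: "nat \<Rightarrow> nat \<Rightarrow> (nat \<Rightarrow> nat) \<Rightarrow> real" where
  "Fd i j c = mean n (\<lambda>j. real (c j) / 2 ^ b) (\<lambda>S. G i (A \<union> insert j S) - G i (A \<union> S))"

text \<open>One-sided accuracy: overestimating the value makes a row too easy, and overestimating
  marginals makes the chosen set look too good; underestimates do no harm.\<close>

definition good :: "real \<Rightarrow> (nat \<Rightarrow> nat) \<Rightarrow> bool list \<Rightarrow> bool" where
  "good a c r \<longleftrightarrow> (\<forall>i<t. (\<Sum>l<m. G i (smps c r l)) / real m \<le> F i c + a \<and>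
     (\<forall>j\<in>U. Wv c r i j \<le> Fd i j c + a))"

text \<open>Chebyshev's inequality and a union bound over one value and at most \<open>n\<close>
  marginals for each of the \<open>t\<close> functions.\<close>

lemma prob_not_good:
  assumes c: "\<And>j. c j \<le> 2 ^ b" and a: "0 < a"
  shows "bavg (m * (n * b)) (\<lambda>r. of_bool (\<not> good a c r)) \<le> real t * (real n + 1) / (real m * a\<^sup>2)"
proof -
  let ?k = "n * b"
  define X0 where "X0 i y = G i (smp c y)" for i y
  define X where "X i j y = G i (insert j (smp c y)) - G i (smp c y)" for i j y
  let ?dev = "\<lambda>\<mu> X r. of_bool (\<mu> + a < (\<Sum>l<m. X (blk ?k l r)) / real m) :: real"
  have b0: "bavg (m * ?k) (?dev (F i c) (X0 i)) \<le> 1 / (real m * a\<^sup>2)" if "i < t" for i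
    using that G_range m_pos a bavg_thr[of n c b "\<lambda>S. G i (A \<union> S)"] c
    by (intro bavg_blk_deviation) (auto simp: X0_def smp_def F_def)
  have b1: "bavg (m * ?k) (?dev (Fd i j c) (X i j)) \<le> 1 / (real m * a\<^sup>2)" if i: "i < t" for i j
  proof (rule bavg_blk_deviation[OF _ _ m_pos a])
    fix y
    show "0 \<le> X i j y \<and> X i j y \<le> 1"
      using msub_marginal_nonneg[OF G_msub[OF i], of j "smp c y"] G_range[OF i, of "smp c y"]
        G_range[OF i, of "insert j (smp c y)"] by (simp add: X_def)
    show "bavg ?k (X i j) = Fd i j c"
      using bavg_thr[of n c b "\<lambda>S. G i (A \<union> insert j S) - G i (A \<union> S)"] c
      by (simp add: X_def smp_def Fd_def cong: bavg_cong)
  qed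
  have "of_bool (\<not> good a c r) \<le> (\<Sum>i<t. ?dev (F i c) (X0 i) r + (\<Sum>j\<in>U. ?dev (Fd i j c) (X i j) r))" for r
  proof (cases "good a c r")
    case False
    then obtain i where i: "i < t" and or: "\<not> (\<Sum>l<m. G i (smps c r l)) / real m \<le> F i c + a
        \<or> (\<exists>j\<in>U. \<not> Wv c r i j \<le> Fd i j c + a)"
      unfolding good_def by blast
    have "1 \<le> ?dev (F i c) (X0 i) r + (\<Sum>j\<in>U. ?dev (Fd i j c) (X i j) r)"
      using or
    proof
      assume "\<not> (\<Sum>l<m. G i (smps c r l)) / real m \<le> F i c + a"
      then have "?dev (F i c) (X0 i) r = 1" by (simp add: X0_def smps_def)
      moreover have "0 \<le> (\<Sum>j\<in>U. ?dev (Fd i j c) (X i j) r)" by (simp add: sum_nonneg)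
      ultimately show ?thesis by linarith
    next
      assume "\<exists>j\<in>U. \<not> Wv c r i j \<le> Fd i j c + a"
      then obtain j where j: "j \<in> U" "\<not> Wv c r i j \<le> Fd i j c + a" by blast
      have "?dev (Fd i j c) (X i j) r = 1"
        using j(2) i by (simp add: X_def smps_def Wv_def sum_divide_distrib)
      then have "1 \<le> (\<Sum>j\<in>U. ?dev (Fd i j c) (X i j) r)"
        using member_le_sum[OF j(1), of "\<lambda>j. ?dev (Fd i j c) (X i j) r"] finite_U by simp
      moreover have "0 \<le> ?dev (F i c) (X0 i) r" by simp
      ultimately show ?thesis by linarith
    qed
    also have "\<dots> \<le> (\<Sum>i<t. ?dev (F i c) (X0 i) r + (\<Sum>j\<in>U. ?dev (Fd i j c) (X i j) r))"
      using i by (intro member_le_sum[of i "{..<t}"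
          "\<lambda>i. ?dev (F i c) (X0 i) r + (\<Sum>j\<in>U. ?dev (Fd i j c) (X i j) r)"]) (auto intro!: add_nonneg_nonneg sum_nonneg)
    finally show ?thesis using False by simp
  qed (auto intro!: sum_nonneg add_nonneg_nonneg)
  then have "bavg (m * ?k) (\<lambda>r. of_bool (\<not> good a c r))
      \<le> bavg (m * ?k) (\<lambda>r. \<Sum>i<t. ?dev (F i c) (X0 i) r + (\<Sum>j\<in>U. ?dev (Fd i j c) (X i j) r))"
    by (intro bavg_le)
  also have "\<dots> = (\<Sum>i<t. bavg (m * ?k) (?dev (F i c) (X0 i))
      + (\<Sum>j\<in>U. bavg (m * ?k) (?dev (Fd i j c) (X i j))))"
    by (simp only: bavg_sum bavg_add)
  also have "\<dots> \<le> (\<Sum>i<t. 1 / (real m * a\<^sup>2) + (\<Sum>j\<in>U. 1 / (real m * a\<^sup>2)))"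
    using b0 b1 by (intro sum_mono add_mono) auto
  also have "\<dots> = real t * (1 + real (card U)) / (real m * a\<^sup>2)"
    by (simp add: distrib_left add_divide_distrib)
  also have "\<dots> \<le> real t * (real n + 1) / (real m * a\<^sup>2)"
    using card_mono[OF _ U_sub] by (intro divide_right_mono mult_left_mono) auto
  finally show ?thesis .
qed

text \<open>The counters of step \<open>s\<close> depend on earlier bits only, so given these the
  samples of the step are fresh and \<open>prob_not_good\<close> applies; a union bound over the
  steps does the rest.\<close>

lemma prob_run_not_good:
  assumes "s \<le> 2 ^ b" "s * (m * (n * b)) \<le> k" "0 < a"
  shows "bavg k (\<lambda>r. of_bool (\<exists>s'<s. \<not> good a (cnt s' r) (sblk s' r)))
    \<le> real s * (real t * (real n + 1) / (real m * a\<^sup>2))"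
  using assms(1,2)
proof (induction s)
  case (Suc s)
  let ?q = "m * (n * b)"
  have "bavg k (\<lambda>r. of_bool (\<not> good a (cnt s r) (sblk s r)))
      = bavg k (\<lambda>r. of_bool (\<not> good a (cnt s (take (s * ?q) r)) (take ?q (drop (s * ?q) r))))"
    by (simp add: cnt_def st_take blk_def)
  also have "\<dots> \<le> real t * (real n + 1) / (real m * a\<^sup>2)"
  proof (rule bavg_adaptive[where h = "\<lambda>x y. of_bool (\<not> good a (cnt s x) y)"])
    fix x
    have "cnt s x j \<le> 2 ^ b" for j using cnt_le[of s x j] Suc.prems(1) by linarith
    then show "bavg ?q (\<lambda>y. of_bool (\<not> good a (cnt s x) y)) \<le> real t * (real n + 1) / (real m * a\<^sup>2)"
      by (intro prob_not_good assms(3))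
  qed (use Suc.prems in simp)
  finally have step: "bavg k (\<lambda>r. of_bool (\<not> good a (cnt s r) (sblk s r)))
      \<le> real t * (real n + 1) / (real m * a\<^sup>2)" .
  have "bavg k (\<lambda>r. of_bool (\<exists>s'<Suc s. \<not> good a (cnt s' r) (sblk s' r)))
      \<le> bavg k (\<lambda>r. of_bool (\<exists>s'<s. \<not> good a (cnt s' r) (sblk s' r))
          + of_bool (\<not> good a (cnt s r) (sblk s r)))"
    by (intro bavg_le) (auto simp: less_Suc_eq)
  also have "\<dots> \<le> real s * (real t * (real n + 1) / (real m * a\<^sup>2))
      + real t * (real n + 1) / (real m * a\<^sup>2)"
    unfolding bavg_add using Suc step by (intro add_mono) auto
  finally show ?case by (simp add: algebra_simps add_divide_distrib)
qed simp

text \<open>Discretized continuous greedy: the deficit of \<open>F\<close> contracts up to the row residuals.\<close>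

lemma deficit_bound:
  assumes "i < t" "s \<le> 2 ^ b" "\<beta> i - e \<le> 1" "0 \<le> a"
    and "\<And>s'. s' < s \<Longrightarrow> good a (cnt s' r) (sblk s' r)"
  shows "\<beta> i - e - F i (cnt s r) \<le> (1 - 1 / 2 ^ b) ^ s + zs s r i / 2 ^ b
    + real s * ((real n + 1) * a / 2 ^ b + (real n)\<^sup>2 / (2 ^ b)\<^sup>2)"
  using assms(2,5)
proof (induction s)
  case 0
  have "0 \<le> F i (cnt 0 r)"
    unfolding F_def using mean_le[of n "\<lambda>j. real (cnt 0 r j) / 2 ^ b" "\<lambda>_. 0"] G_range[OF assms(1)] by simp
  then show ?case using assms(3) by simp
next
  case (Suc s)
  define N :: real where "N = 2 ^ b"
  have N: "1 \<le> N" by (simp add: N_def)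
  let ?c = "cnt s r" and ?Y = "Ys (cnt s r) (zs s r) (sblk s r)"
  let ?g = "\<lambda>S. G i (A \<union> S)"
  have gd: "good a ?c (sblk s r)" using Suc.prems by simp
  have IH: "\<beta> i - e - F i ?c \<le> (1 - 1 / N) ^ s + zs s r i / N
    + real s * ((real n + 1) * a / N + (real n)\<^sup>2 / N\<^sup>2)"
    using Suc unfolding N_def by simp
  have le: "real (cnt s' r j) / 2 ^ b \<le> 1" if "s' \<le> Suc s" for s' j
  proof -
    have "cnt s' r j \<le> 2 ^ b" using cnt_le[of s' r j] that Suc.prems(1) by linarith
    then have "real (cnt s' r j) \<le> 2 ^ b" using of_nat_mono[where 'a = real] by fastforce
    then show ?thesis by simp
  qed
  have "F i ?c + 1 / N * (\<Sum>j\<in>?Y \<inter> {..<n}. mean n (\<lambda>j. real (?c j) / 2 ^ b) (\<lambda>S. ?g (insert j S) - ?g S))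
      - (real n)\<^sup>2 * (1 / N)\<^sup>2 \<le> F i (cnt (Suc s) r)"
    unfolding F_def
    by (rule mean_progress)
      (use le[of s] le[of "Suc s"] G_range[OF assms(1)] G_msub[OF assms(1)] in
        \<open>auto simp: cnt_Suc N_def add_divide_distrib msub_Un\<close>)
  moreover have "?Y \<inter> {..<n} = ?Y" using Ys_subset U_sub by blast
  ultimately have prog: "F i ?c + 1 / N * (\<Sum>j\<in>?Y. Fd i j ?c) - (real n)\<^sup>2 / N\<^sup>2 \<le> F i (cnt (Suc s) r)"
    by (simp add: Fd_def power_divide)
  \<comment> \<open>At most \<open>n\<close> marginals enter, with total error \<open>n * a\<close>;
    together with the error \<open>a\<close> of the value this yields the factor
    \<open>n + 1\<close>.\<close>
  have "(\<Sum>j\<in>?Y. Wv ?c (sblk s r) i j) \<le> (\<Sum>j\<in>?Y. Fd i j ?c + a)"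
    using gd assms(1) by (intro sum_mono) (auto simp: good_def dest!: subsetD[OF Ys_subset])
  also have "\<dots> = (\<Sum>j\<in>?Y. Fd i j ?c) + real (card ?Y) * a" by (simp add: sum.distrib)
  also have "\<dots> \<le> (\<Sum>j\<in>?Y. Fd i j ?c) + real n * a"
    using card_mono[of "{..<n}" ?Y] Ys_subset[of ?c "zs s r" "sblk s r"] U_sub assms(4)
    by (intro add_left_mono mult_right_mono) auto
  finally have W: "(\<Sum>j\<in>?Y. Wv ?c (sblk s r) i j) \<le> (\<Sum>j\<in>?Y. Fd i j ?c) + real n * a" .
  have "(\<Sum>l<m. G i (smps ?c (sblk s r) l) / real m) \<le> F i ?c + a"
    using gd assms(1) by (auto simp: good_def sum_divide_distrib[symmetric])
  then have D: "\<beta> i - e - F i ?c - a \<le> Dv ?c (sblk s r) i"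
    using assms(1) by (simp add: Dv_def)
  let ?d = "dv ?c (zs s r) (sblk s r) i"
  have "\<beta> i - e - F i ?c - ?d - (real n + 1) * a \<le> (\<Sum>j\<in>?Y. Fd i j ?c)"
    using W D by (simp add: dv_def algebra_simps)
  then have "1 / N * (\<beta> i - e - F i ?c - ?d - (real n + 1) * a) \<le> 1 / N * (\<Sum>j\<in>?Y. Fd i j ?c)"
    using N by (intro mult_left_mono) auto
  then have "\<beta> i - e - F i (cnt (Suc s) r) \<le> \<beta> i - e - F i ?c
      - 1 / N * (\<beta> i - e - F i ?c - ?d - (real n + 1) * a) + (real n)\<^sup>2 / N\<^sup>2"
    using prog by linarith
  also have "\<dots> = (1 - 1 / N) * (\<beta> i - e - F i ?c) + ?d / N + ((real n + 1) * a / N + (real n)\<^sup>2 / N\<^sup>2)"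
    by (simp add: algebra_simps diff_divide_distrib add_divide_distrib)
  also have "(1 - 1 / N) * (\<beta> i - e - F i ?c) \<le> (1 - 1 / N) * ((1 - 1 / N) ^ s + zs s r i / N
    + real s * ((real n + 1) * a / N + (real n)\<^sup>2 / N\<^sup>2))"
    using N IH by (intro mult_left_mono) auto
  also have "\<dots> \<le> (1 - 1 / N) ^ Suc s + (1 - 1 / N) * (zs s r i / N)
    + real s * ((real n + 1) * a / N + (real n)\<^sup>2 / N\<^sup>2)"
  proof -
    have "(1 - 1 / N) * (real s * ((real n + 1) * a / N + (real n)\<^sup>2 / N\<^sup>2))
        \<le> 1 * (real s * ((real n + 1) * a / N + (real n)\<^sup>2 / N\<^sup>2))"
      using N assms(4) by (intro mult_right_mono) auto
    then show ?thesis by (simp add: distrib_left)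
  qed
  finally have "\<beta> i - e - F i (cnt (Suc s) r) \<le> (1 - 1 / N) ^ Suc s
      + ((1 - 1 / N) * (zs s r i / N) + ?d / N)
      + real (Suc s) * ((real n + 1) * a / N + (real n)\<^sup>2 / N\<^sup>2)"
    by (simp add: algebra_simps add_divide_distrib)
  \<comment> \<open>The reason for the discount in \<open>zd\<close>: the residual obeys the same
    contracting recursion as the deficit, so it can be carried along without accumulating.\<close>
  also have "(1 - 1 / N) * (zs s r i / N) + ?d / N = zs (Suc s) r i / N"
    using assms(1) by (simp add: zs_Suc zd_def N_def[symmetric] add_divide_distrib diff_divide_distrib algebra_simps)
  finally show ?case unfolding N_def .
qed

text \<open>Static rows are not discounted, so their residuals telescope to the violation of the row
  by the final counters.\<close>

lemma linear_rows:
  assumes "t \<le> i" "i < M"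
  shows "zs s r i = real s * Ds i - (\<Sum>j\<in>U. real (cnt s r j) * Ws i j)"
proof (induction s)
  case (Suc s)
  have "(\<Sum>j\<in>Ys c z y. Ws i j) = (\<Sum>j\<in>U. of_bool (j \<in> Ys c z y) * Ws i j)" for c z y
    using Ys_subset[of c z y] finite_U by (intro sum.mono_neutral_cong_left) auto
  then show ?case
    using assms Suc by (simp add: zs_Suc zd_def dv_def Dv_def Wv_def cnt_Suc algebra_simps sum.distrib)
qed simp

end

section \<open>Growth of the residuals\<close>

locale run_bounded = run_ok +
  assumes Ws_bounded: "\<And>i j. t \<le> i \<Longrightarrow> i < M \<Longrightarrow> j \<in> U \<Longrightarrow> \<bar>Ws i j\<bar> \<le> 1"
    and Ds_bounded: "\<And>i. t \<le> i \<Longrightarrow> i < M \<Longrightarrow> \<bar>Ds i\<bar> \<le> 2"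
    and \<beta>_range: "\<And>i. i < t \<Longrightarrow> 0 \<le> \<beta> i \<and> \<beta> i \<le> 1" and e_range: "0 \<le> e" "e \<le> 1"
begin

lemma dv_bounded:
  assumes "i < M"
  shows "\<bar>dv c z r i\<bar> \<le> real n + 2"
proof -
  have avg: "0 \<le> (\<Sum>l<m. x l / real m) \<and> (\<Sum>l<m. x l / real m) \<le> 1"
    if "\<And>l. 0 \<le> x l \<and> x l \<le> (1 :: real)" for x
  proof
    show "0 \<le> (\<Sum>l<m. x l / real m)" using that by (intro sum_nonneg) auto
    have "(\<Sum>l<m. x l / real m) \<le> (\<Sum>l<m. 1 / real m)"
      using that by (intro sum_mono divide_right_mono) auto
    then show "(\<Sum>l<m. x l / real m) \<le> 1" using m_pos by simp
  qed
  have marg: "0 \<le> G i (insert j S) - G i S \<and> G i (insert j S) - G i S \<le> 1" if "i < t" for j S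
    using msub_marginal_nonneg[OF G_msub[OF that], of j S] G_range[OF that, of S]
      G_range[OF that, of "insert j S"] by simp
  have W: "\<bar>Wv c r i j\<bar> \<le> 1" if "j \<in> U" for j
  proof (cases "i < t")
    case True
    then show ?thesis
      using avg[of "\<lambda>l. G i (insert j (smps c r l)) - G i (smps c r l)"] marg[OF True]
      by (simp add: Wv_def)
  next
    case False
    then show ?thesis using Ws_bounded[of i j] that assms by (simp add: Wv_def)
  qed
  have D: "\<bar>Dv c r i\<bar> \<le> 2"
  proof (cases "i < t")
    case True
    have "0 \<le> (\<Sum>l<m. G i (smps c r l) / real m) \<and> (\<Sum>l<m. G i (smps c r l) / real m) \<le> 1"
      by (rule avg) (rule G_range[OF True])
    then show ?thesis
      using \<beta>_range[OF True] e_range True unfolding Dv_def by (simp add: abs_le_iff)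
  next
    case False
    then show ?thesis using Ds_bounded[of i] assms by (simp add: Dv_def)
  qed
  have "\<bar>\<Sum>j\<in>Ys c z r. Wv c r i j\<bar> \<le> (\<Sum>j\<in>Ys c z r. \<bar>Wv c r i j\<bar>)" by (rule sum_abs)
  also have "\<dots> \<le> (\<Sum>j\<in>Ys c z r. 1)" using W Ys_subset[of c z r] by (intro sum_mono) auto
  also have "\<dots> \<le> real n"
    using card_mono[of "{..<n}" "Ys c z r"] Ys_subset[of c z r] U_sub by auto
  finally show ?thesis using D unfolding dv_def by linarith
qed

text \<open>Blackwell's approachability argument for the positive orthant.\<close>

lemma residuals_bounded:
  assumes "\<And>s'. s' < s \<Longrightarrow> \<not> violated s' r"
  shows "(\<Sum>i<M. (max 0 (zs s r i))\<^sup>2) \<le> real s * (real M * (real n + 2)\<^sup>2)"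
  using assms
proof (induction s)
  case (Suc s)
  let ?z = "zs s r" and ?d = "dv (cnt s r) (zs s r) (sblk s r)"
  have le: "(max 0 (zs (Suc s) r i))\<^sup>2 \<le> (max 0 (?z i))\<^sup>2 + 2 * (lam ?z i * ?d i) + (real n + 2)\<^sup>2"
    if "i < M" for i
  proof -
    have "(max 0 (zs (Suc s) r i))\<^sup>2 \<le> (lam ?z i + ?d i)\<^sup>2"
    proof (cases "0 \<le> zs (Suc s) r i")
      case True
      then show ?thesis by (auto simp: zs_Suc lam_def intro!: power_mono)
    qed simp
    also have "\<dots> = (lam ?z i)\<^sup>2 + 2 * (lam ?z i * ?d i) + (?d i)\<^sup>2"
      by (simp add: power2_sum)
    \<comment> \<open>Discounting shrinks positive parts, so it does not disturb the potential
      argument.\<close>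
    also have "(lam ?z i)\<^sup>2 \<le> (max 0 (?z i))\<^sup>2"
    proof (rule power_mono)
      have "1 / 2 ^ b \<le> (1 :: real)" "0 \<le> 1 / (2 ^ b :: real)" by simp_all
      then have "?z i * (1 - 1 / 2 ^ b) \<le> max 0 (?z i)"
        by (cases "0 \<le> ?z i") (auto simp: mult_nonpos_nonneg intro: mult_left_le)
      then show "lam ?z i \<le> max 0 (?z i)" by (auto simp: lam_def zd_def)
    qed (rule lam_nonneg)
    also have "(?d i)\<^sup>2 \<le> (real n + 2)\<^sup>2"
      using dv_bounded[OF that, of "cnt s r" ?z "sblk s r"] by (simp add: abs_le_square_iff[symmetric])
    finally show ?thesis by simp
  qed
  \<comment> \<open>Absence of a violation is exactly the statement that the cross terms sum to at
    most 0; the potential then grows only by the second-order terms.\<close>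
  have "(\<Sum>i<M. lam ?z i * ?d i) \<le> 0"
    using Suc.prems[of s] by (simp add: violated_def viol_def)
  moreover have "(\<Sum>i<M. (max 0 (zs (Suc s) r i))\<^sup>2)
      \<le> (\<Sum>i<M. (max 0 (?z i))\<^sup>2 + 2 * (lam ?z i * ?d i) + (real n + 2)\<^sup>2)"
    using le by (intro sum_mono) auto
  moreover have "(\<Sum>i<M. (max 0 (?z i))\<^sup>2 + 2 * (lam ?z i * ?d i) + (real n + 2)\<^sup>2)
      = (\<Sum>i<M. (max 0 (?z i))\<^sup>2) + 2 * (\<Sum>i<M. lam ?z i * ?d i) + real M * (real n + 2)\<^sup>2"
    by (simp add: sum.distrib sum_distrib_left)
  moreover have "(\<Sum>i<M. (max 0 (?z i))\<^sup>2) \<le> real s * (real M * (real n + 2)\<^sup>2)"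
    using Suc by simp
  ultimately have "(\<Sum>i<M. (max 0 (zs (Suc s) r i))\<^sup>2)
      \<le> real s * (real M * (real n + 2)\<^sup>2) + real M * (real n + 2)\<^sup>2"
    by linarith
  then show ?case by (simp add: algebra_simps)
qed simp

text \<open>A residual is bounded by the root of the potential, so it grows only like the square
  root of the number of steps. Divided by the number of steps it becomes negligible; this determines
  \<open>Nmin\<close>.\<close>

lemma residual_le:
  assumes "\<And>s'. s' < s \<Longrightarrow> \<not> violated s' r" "i < M"
    and "real s * (real M * (real n + 2)\<^sup>2) \<le> h\<^sup>2" "0 \<le> h"
  shows "zs s r i \<le> h"
proof -
  have "(max 0 (zs s r i))\<^sup>2 \<le> (\<Sum>i<M. (max 0 (zs s r i))\<^sup>2)"
    using assms(2) by (intro member_le_sum[of i "{..<M}" "\<lambda>i. (max 0 (zs s r i))\<^sup>2"]) auto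
  also have "\<dots> \<le> real s * (real M * (real n + 2)\<^sup>2)"
    by (rule residuals_bounded) (rule assms(1))
  also note assms(3)
  finally have "max 0 (zs s r i) \<le> h" using assms(4) by (rule power2_le_imp_le)
  then show ?thesis by simp
qed

end

section \<open>Instances and guesses\<close>

lemma thr_deviation:
  assumes c: "\<And>j. c j \<le> 2 ^ b" and g: "msub g" "\<And>S. 0 \<le> g S" "0 \<le> \<alpha>"
    and marg: "\<And>j S. c j \<noteq> 0 \<Longrightarrow> g (insert j S) - g S \<le> \<alpha>"
    and \<mu>: "\<mu> = mean n (\<lambda>j. real (c j) / 2 ^ b) g" and d: "0 < d" "\<And>S. Q S \<Longrightarrow> d \<le> \<bar>g S - \<mu>\<bar>"
  shows "bavg (n * b) (\<lambda>r. of_bool (Q (thr n b c r))) \<le> \<alpha> * \<mu> / d\<^sup>2"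
proof -
  let ?x = "\<lambda>j. real (c j) / 2 ^ b"
  have x: "0 \<le> ?x j \<and> ?x j \<le> 1" for j
    using of_nat_mono[OF c[of j], where 'a = real] by simp
  have "of_bool (Q S) \<le> 1 / d\<^sup>2 * (g S - \<mu>)\<^sup>2" for S
  proof (cases "Q S")
    case True
    then have "d\<^sup>2 \<le> (g S - \<mu>)\<^sup>2" using d by (simp add: abs_le_square_iff[symmetric])
    then show ?thesis using d(1) by (simp add: True)
  qed simp
  then have "bavg (n * b) (\<lambda>r. of_bool (Q (thr n b c r)))
      \<le> bavg (n * b) (\<lambda>r. 1 / d\<^sup>2 * (g (thr n b c r) - \<mu>)\<^sup>2)"
    by (intro bavg_le)
  also have "\<dots> = 1 / d\<^sup>2 * mean n ?x (\<lambda>S. (g S - \<mu>)\<^sup>2)"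
    unfolding bavg_cmult using bavg_thr[of n c b "\<lambda>S. (g S - \<mu>)\<^sup>2"] c by simp
  also have "mean n ?x (\<lambda>S. (g S - \<mu>)\<^sup>2) = mean n ?x (\<lambda>S. (g S)\<^sup>2 + (- (2 * \<mu>) * g S + \<mu>\<^sup>2))"
    by (simp add: power2_diff algebra_simps)
  also have "\<dots> = mean n ?x (\<lambda>S. (g S)\<^sup>2) - \<mu>\<^sup>2"
    by (simp only: mean_add mean_cmult mean_const \<mu>[symmetric]) (simp add: power2_eq_square)
  \<comment> \<open>The self-bounding variance: elements that cannot be drawn
    (\<open>c j = 0\<close>) are exempt from the marginal bound \<open>\<alpha>\<close>.\<close>
  also have "\<dots> \<le> \<alpha> * (\<mu> - g {})"
    unfolding \<mu> by (rule mean_variance) (use x g marg in auto)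
  also have "\<dots> \<le> \<alpha> * \<mu>" using g by (intro mult_left_mono) auto
  finally show ?thesis by (simp add: divide_right_mono mult_left_mono)
qed

text \<open>The mean may be far above the target \<open>L\<close>, and the variance bound
  \<open>\<alpha> * \<mu>\<close> grows with it; but so does the deviation needed to fall below
  \<open>L\<close>, which gives a bound uniform in \<open>\<mu>\<close>.\<close>

lemma thr_lower_tail:
  assumes c: "\<And>j. c j \<le> 2 ^ b" and g: "msub g" "\<And>S. 0 \<le> g S" "0 \<le> \<alpha>"
    and marg: "\<And>j S. c j \<noteq> 0 \<Longrightarrow> g (insert j S) - g S \<le> \<alpha>"
    and L: "L + h \<le> mean n (\<lambda>j. real (c j) / 2 ^ b) g" "L \<le> 1" "0 < h" "h \<le> 1"
  shows "bavg (n * b) (\<lambda>r. of_bool (g (thr n b c r) < L)) \<le> 2 * \<alpha> / h\<^sup>2"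
proof -
  define \<mu> where "\<mu> = mean n (\<lambda>j. real (c j) / 2 ^ b) g"
  define d where "d = \<mu> - L"
  have d: "h \<le> d" using L(1) by (simp add: d_def \<mu>_def)
  have "bavg (n * b) (\<lambda>r. of_bool (g (thr n b c r) < L)) \<le> \<alpha> * \<mu> / d\<^sup>2"
    by (rule thr_deviation[where Q = "\<lambda>S. g S < L"]) (use assms d in \<open>auto simp: \<mu>_def d_def\<close>)
  also have "\<dots> \<le> \<alpha> * (2 / h\<^sup>2)"
  proof -
    have "\<mu> * h\<^sup>2 \<le> (1 + d) * h\<^sup>2" using L(2) by (intro mult_right_mono) (auto simp: d_def)
    also have "\<dots> = h\<^sup>2 + d * (h * h)" by (simp add: power2_eq_square algebra_simps)
    also have "\<dots> \<le> d\<^sup>2 + d * (d * 1)"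
      using d L by (intro add_mono power_mono mult_mono) auto
    finally have "\<mu> * h\<^sup>2 \<le> 2 * d\<^sup>2" by (simp add: power2_eq_square)
    then have "\<mu> / d\<^sup>2 \<le> 2 / h\<^sup>2" using d L(3) by (simp add: field_simps)
    then show ?thesis using g(3) unfolding times_divide_eq_right[symmetric] by (rule mult_left_mono)
  qed
  finally show ?thesis by (simp add: mult.commute)
qed

lemma thr_upper_tail:
  assumes c: "\<And>j. c j \<le> 2 ^ b" and g: "msub g" "\<And>S. 0 \<le> g S" "0 \<le> \<alpha>"
    and marg: "\<And>j S. c j \<noteq> 0 \<Longrightarrow> g (insert j S) - g S \<le> \<alpha>"
    and L: "mean n (\<lambda>j. real (c j) / 2 ^ b) g \<le> 1 - h" "0 < h"
  shows "bavg (n * b) (\<lambda>r. of_bool (1 < g (thr n b c r))) \<le> \<alpha> / h\<^sup>2"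
proof -
  define \<mu> where "\<mu> = mean n (\<lambda>j. real (c j) / 2 ^ b) g"
  have "bavg (n * b) (\<lambda>r. of_bool (1 < g (thr n b c r))) \<le> \<alpha> * \<mu> / h\<^sup>2"
    by (rule thr_deviation[where Q = "\<lambda>S. 1 < g S"]) (use assms in \<open>auto simp: \<mu>_def\<close>)
  also have "\<dots> \<le> \<alpha> * 1 / h\<^sup>2"
    using L g(3) by (intro divide_right_mono mult_left_mono) (auto simp: \<mu>_def)
  finally show ?thesis by simp
qed

definition modular :: "nat \<Rightarrow> (nat \<Rightarrow> real) \<Rightarrow> nat set \<Rightarrow> real" where
  "modular n a S = (\<Sum>j\<in>S \<inter> {..<n}. a j)"

lemma modular_insert:
  "modular n a (insert j S) = modular n a S + (if j < n \<and> j \<notin> S then a j else 0)"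
  by (auto simp: modular_def Int_insert_left insert_absorb)

lemma modular_nonneg: "(\<And>j. j < n \<Longrightarrow> 0 \<le> a j) \<Longrightarrow> 0 \<le> modular n a S"
  unfolding modular_def by (intro sum_nonneg) auto

lemma msub_modular:
  assumes "\<And>j. j < n \<Longrightarrow> 0 \<le> a j" shows "msub (modular n a)"
  unfolding msub_def mono_def
proof (intro conjI allI impI)
  fix S T :: "nat set" and j assume "S \<subseteq> T"
  then show "modular n a S \<le> modular n a T"
    unfolding modular_def by (intro sum_mono2) (use assms in auto)
  show "modular n a (insert j T) - modular n a T \<le> modular n a (insert j S) - modular n a S"
    using \<open>S \<subseteq> T\<close> assms[of j] by (auto simp: modular_insert)
qed

lemma mean_modular: "mean n x (modular n a) = (\<Sum>j<n. x j * a j)"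
proof -
  \<comment> \<open>The constant \<open>d\<close> absorbs the weights of elements whose membership
    has already been decided.\<close>
  have "mean k x (\<lambda>S. d + modular n a S) = d + (\<Sum>j<k. x j * a j)" if "k \<le> n" for k d
    using that
  proof (induction k arbitrary: d)
    case (Suc k)
    have "mean k x (\<lambda>S. d + modular n a (insert k S)) = mean k x (\<lambda>S. (d + a k) + modular n a S)"
      using Suc.prems by (intro mean_cong) (auto simp: modular_insert)
    also have "\<dots> = (d + a k) + (\<Sum>j<k. x j * a j)" using Suc.prems by (intro Suc.IH) simp
    finally show ?case using Suc.IH[of d] Suc.prems by (simp add: algebra_simps)
  qed (simp add: modular_def)
  from this[of n 0] show ?thesis by simp
qed

text \<open>Truncating a monotone submodular function keeps both properties. This bounds the
  functions and the coverage by 1, whatever the input values are.\<close>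

lemma msub_min:
  assumes "msub g" shows "msub (\<lambda>S. min 1 (g S))"
  unfolding msub_def mono_def
proof (intro conjI allI impI)
  fix S T :: "nat set" and j assume st: "S \<subseteq> T"
  have "g S \<le> g T" "g (insert j T) - g T \<le> g (insert j S) - g S" "g S \<le> g (insert j S)"
    "g T \<le> g (insert j T)"
    using msub_mono[OF assms st] msub_marginal[OF assms st]
      msub_mono[OF assms subset_insertI] by auto
  then show "min 1 (g S) \<le> min 1 (g T)"
    "min 1 (g (insert j T)) - min 1 (g T) \<le> min 1 (g (insert j S)) - min 1 (g S)"
    by (auto simp: min_def)
qed

text \<open>Parameters for an accuracy \<open>1 / 2 ^ w\<close>; every elementary loss is \<open>1 / Hc w\<close>.\<close>

definition Hc :: "nat \<Rightarrow> nat" where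
  "Hc w = 2 ^ (w + 4)"
text \<open>With \<open>e2 = h^2 / (8 * (p + 1))\<close>, the Chebyshev bounds
  \<open>e2 / h^2\<close> of the \<open>p\<close> packing constraints sum to at most 1/8.\<close>

definition e2d :: "nat \<Rightarrow> nat \<Rightarrow> nat" where
  "e2d p w = 8 * (p + 1) * (Hc w)\<^sup>2"
text \<open>Serves two purposes: the at most \<open>p / e2\<close> elements of a solution that are
  too large for some packing budget cost each function at most \<open>h\<close>, being worth at most
  \<open>e1\<close> each; and the rounding failures \<open>2 * e1 / h^2\<close> of the functions and
  covering constraints sum to at most 1/8.\<close>

definition e1d :: "nat \<Rightarrow> nat \<Rightarrow> nat \<Rightarrow> nat \<Rightarrow> nat" where
  "e1d p c t w = 8 * (p + t + c + 1) * Hc w * e2d p w"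
text \<open>Every guessed element raises the sum of \<open>t + c\<close> functions with values in
  the unit interval by at least \<open>e1\<close> on average.\<close>

definition guesses :: "nat \<Rightarrow> nat \<Rightarrow> nat \<Rightarrow> nat \<Rightarrow> nat" where
  "guesses p c t w = (t + c) * e1d p c t w"
text \<open>Enough steps for the averaged residuals and for the second-order loss
  \<open>n^2 / N\<close> to be at most \<open>h\<close> each.\<close>

definition Nmin :: "nat \<Rightarrow> nat \<Rightarrow> nat \<Rightarrow> nat \<Rightarrow> nat \<Rightarrow> nat" where
  "Nmin p c t w n = (t + c + p + 1) * (Hc w)\<^sup>2 * (n + 2)\<^sup>2"
definition bitlen :: "nat \<Rightarrow> nat" where
  "bitlen k = (LEAST b. k \<le> 2 ^ b)"

lemma le_2_bitlen: "k \<le> 2 ^ bitlen k"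
  unfolding bitlen_def by (rule LeastI[of _ k]) simp

lemma bitlen_le_iff: "bitlen k \<le> b \<longleftrightarrow> k \<le> 2 ^ b"
proof
  assume "bitlen k \<le> b"
  then have "(2 :: nat) ^ bitlen k \<le> 2 ^ b" by simp
  then show "k \<le> 2 ^ b" using le_2_bitlen[of k] by linarith
qed (simp add: bitlen_def Least_le)

text \<open>\<open>\<kappa>\<close> is the ratio against which the program tests the functions. It
  is rational because program constants are, and stands in for the irrational
  \<open>1 - 1 / exp 1 - \<epsilon>\<close>.\<close>

locale inst =
  fixes p c t n w :: nat and f :: "nat \<Rightarrow> nat set \<Rightarrow> real" and P C :: "real mat" and v :: "real vec"
    and \<kappa> :: rat
  assumes pcmsm: "pcmsm_instance p c t n f P C"
    and v_carrier: "v \<in> carrier_vec t" and v_nonneg: "\<And>i. i < t \<Longrightarrow> 0 \<le> v $ i"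
begin

abbreviation "M \<equiv> t + c + p"
abbreviation "b \<equiv> bitlen (Nmin p c t w n)"
text \<open>Makes the probability of an inaccurate step at most 1/4. One factor \<open>n + 2\<close>
  pays for the estimates per function, two for the accuracy \<open>h / (n + 1)\<close>, and
  \<open>2 ^ b\<close> for the steps.\<close>

definition "m = 4 * (t + 1) * (Hc w)\<^sup>2 * 2 ^ b * (n + 2) ^ 3"
text \<open>The fraction \<open>1 - 2 * h\<close> of \<open>2 ^ b\<close> as an exact natural
  number.\<close>

definition "N0 = (2 ^ b - 2 ^ (b - (w + 3)) :: nat)"
text \<open>There are \<open>(n + 1) ^ guesses\<close>, hence at most
  \<open>2 ^ (guesses * n)\<close>, guesses; the extra 2 leaves a failure probability of 1/4 after
  the union bound.\<close>

definition "reps = guesses p c t w * n + 2"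
definition "Q = N0 * (m * (n * b)) + n * b"
definition "h = (1 / real (Hc w) :: real)"
definition "e1 = (1 / real (e1d p c t w) :: real)"
definition "e2 = (1 / real (e2d p w) :: real)"

text \<open>Functions are scaled to target 1 and covering constraints are treated as further
  functions. For a target 0 the convention \<open>x / 0 = 0\<close> makes both \<open>G i\<close>
  and \<open>\<beta> i\<close> zero, so such a function imposes nothing; the same convention lets
  the program compute \<open>\<beta> i\<close> as a quotient.\<close>

definition G :: "nat \<Rightarrow> nat set \<Rightarrow> real" where
  "G i S = min 1 (if i < t then f i (S \<inter> {..<n}) / v $ i else modular n (\<lambda>j. C $$ (i - t, j)) S)"
definition \<beta> :: "nat \<Rightarrow> real" where
  "\<beta> i = (if i < t then v $ i / v $ i else 1)"
definition load :: "nat \<Rightarrow> nat set \<Rightarrow> real" where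
  "load q = modular n (\<lambda>j. P $$ (q, j))"
definition ok :: "nat set \<Rightarrow> bool" where
  "ok S \<longleftrightarrow> (\<forall>q<p. load q S \<le> 1) \<and> (\<forall>i<t. of_rat \<kappa> * \<beta> i \<le> G i S) \<and>
     (\<forall>q<c. 1 - 1 / 2 ^ w \<le> G (t + q) S)"

lemma Hc_pos: "0 < Hc w" by (simp add: Hc_def)
lemma h_bounds: "0 < h" "h \<le> 1 / 16" "h = 1 / (16 * 2 ^ w)"
proof -
  show 1: "h = 1 / (16 * 2 ^ w)" by (simp add: h_def Hc_def power_add)
  show "0 < h" by (simp add: 1)
  have "(1 :: real) \<le> 2 ^ w" by simp
  then show "h \<le> 1 / 16" unfolding 1 by (intro divide_left_mono) auto
qed
lemma m_pos: "0 < m" by (simp add: m_def Hc_def)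
lemma e12_pos: "0 < e1" "0 < e2" by (simp_all add: e1_def e2_def e1d_def e2d_def Hc_def)
lemma e2_eq: "e2 * (8 * (real p + 1)) = h\<^sup>2"
  using Hc_pos by (simp add: e2_def e2d_def h_def power2_eq_square add.commute)
lemma e1_eq: "e1 * (8 * (real p + real t + real c + 1)) = h * e2"
proof -
  define X where "X = 8 * (real p + real t + real c + 1)"
  have "0 < X" by (simp add: X_def add_nonneg_pos)
  moreover have "real (e1d p c t w) = X * (real (Hc w) * real (e2d p w))"
    by (simp add: e1d_def X_def algebra_simps)
  ultimately have "e1 * X = h * e2" by (simp add: e1_def h_def e2_def)
  then show ?thesis by (simp add: X_def)
qed

lemma P_nonneg: "q < p \<Longrightarrow> j < n \<Longrightarrow> 0 \<le> P $$ (q, j)"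
  and C_nonneg: "q < c \<Longrightarrow> j < n \<Longrightarrow> 0 \<le> C $$ (q, j)"
  and P_carrier: "P \<in> carrier_mat p n" and C_carrier: "C \<in> carrier_mat c n"
  and f_nonneg: "i < t \<Longrightarrow> S \<subseteq> {..<n} \<Longrightarrow> 0 \<le> f i S"
  and f_mono: "i < t \<Longrightarrow> mono_on (Pow {..<n}) (f i)"
  and f_submodular: "i < t \<Longrightarrow> submodular_on n (f i)"
  using pcmsm by (auto simp: pcmsm_instance_def)

text \<open>\<open>msub\<close> speaks about all sets of naturals to avoid side conditions; the
  oracle functions, controlled only on the ground set, are extended by intersecting with it.\<close>

lemma msub_f:
  assumes i: "i < t" shows "msub (\<lambda>S. f i (S \<inter> {..<n}))"
  unfolding msub_def mono_def
proof (intro conjI allI impI)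
  fix S T :: "nat set" and j assume st: "S \<subseteq> T"
  show le: "f i (S \<inter> {..<n}) \<le> f i (T \<inter> {..<n})"
    by (rule mono_onD[OF f_mono[OF i]]) (use st in auto)
  show "f i (insert j T \<inter> {..<n}) - f i (T \<inter> {..<n}) \<le> f i (insert j S \<inter> {..<n}) - f i (S \<inter> {..<n})"
  proof (cases "j < n \<and> j \<notin> T")
    case True
    have "f i ((insert j S \<inter> {..<n}) \<union> (T \<inter> {..<n})) + f i ((insert j S \<inter> {..<n}) \<inter> (T \<inter> {..<n}))
        \<le> f i (insert j S \<inter> {..<n}) + f i (T \<inter> {..<n})"
      using f_submodular[OF i, unfolded submodular_on_def, rule_format,
          of "insert j S \<inter> {..<n}" "T \<inter> {..<n}"] by simp
    moreover have "(insert j S \<inter> {..<n}) \<union> (T \<inter> {..<n}) = insert j T \<inter> {..<n}"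
      "(insert j S \<inter> {..<n}) \<inter> (T \<inter> {..<n}) = S \<inter> {..<n}"
      using st True by auto
    ultimately show ?thesis by simp
  next
    case False
    then have "insert j T \<inter> {..<n} = T \<inter> {..<n}" by auto
    moreover have "f i (S \<inter> {..<n}) \<le> f i (insert j S \<inter> {..<n})"
      by (rule mono_onD[OF f_mono[OF i]]) auto
    ultimately show ?thesis by simp
  qed
qed

lemma msub_G: "i < t + c \<Longrightarrow> msub (G i)"
proof -
  assume i: "i < t + c"
  show "msub (G i)"
  proof (cases "i < t")
    case True
    have "msub (\<lambda>S. (1 / v $ i) * f i (S \<inter> {..<n}) + 0 * f i (S \<inter> {..<n}))"
      using msub_f[OF True] v_nonneg[OF True] by (intro msub_combine) auto
    then show ?thesis using msub_min True by (simp add: G_def[abs_def])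
  next
    case False
    then have "msub (modular n (\<lambda>j. C $$ (i - t, j)))"
      using i C_nonneg by (intro msub_modular) auto
    then show ?thesis using msub_min False by (simp add: G_def[abs_def])
  qed
qed

lemma G_unit: "i < t + c \<Longrightarrow> 0 \<le> G i S \<and> G i S \<le> 1"
  using f_nonneg[of i "S \<inter> {..<n}"] v_nonneg[of i] C_nonneg[of "i - t"]
  by (auto simp: G_def intro!: modular_nonneg)

lemma \<beta>_cases: "\<beta> i = 0 \<or> \<beta> i = 1"
  by (auto simp: \<beta>_def)

lemma load_eq: "q < p \<Longrightarrow> S \<subseteq> {..<n} \<Longrightarrow> (P *\<^sub>v ind_vec n S) $ q = load q S"
  and cover_eq: "q' < c \<Longrightarrow> S \<subseteq> {..<n} \<Longrightarrow> (C *\<^sub>v ind_vec n S) $ q' = modular n (\<lambda>j. C $$ (q', j)) S"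
proof -
  have sum: "(\<Sum>j = 0..<n. a j * indicator S j) = modular n a S" if "S \<subseteq> {..<n}" for a S
  proof -
    have "(\<Sum>j = 0..<n. a j * indicator S j) = (\<Sum>j\<in>S. a j)"
      using that by (intro sum.mono_neutral_cong_right) (auto simp: indicator_def)
    then show ?thesis using that by (simp add: modular_def Int_absorb2)
  qed
  show "q < p \<Longrightarrow> S \<subseteq> {..<n} \<Longrightarrow> (P *\<^sub>v ind_vec n S) $ q = load q S"
    using P_carrier sum[of S "\<lambda>j. P $$ (q, j)"]
    by (auto simp: load_def ind_vec_def scalar_prod_def)
  show "q' < c \<Longrightarrow> S \<subseteq> {..<n} \<Longrightarrow> (C *\<^sub>v ind_vec n S) $ q' = modular n (\<lambda>j. C $$ (q', j)) S"
    using C_carrier sum[of S "\<lambda>j. C $$ (q', j)"]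
    by (auto simp: ind_vec_def scalar_prod_def)
qed

lemma P_le_iff: "S \<subseteq> {..<n} \<Longrightarrow> P *\<^sub>v ind_vec n S \<le> ones_vec p \<longleftrightarrow> (\<forall>q<p. load q S \<le> 1)"
  using load_eq P_carrier by (auto simp: less_eq_vec_def ones_vec_def)

lemma C_ge_iff: "S \<subseteq> {..<n} \<Longrightarrow> C *\<^sub>v ind_vec n S \<ge> a \<cdot>\<^sub>v ones_vec c
    \<longleftrightarrow> (\<forall>q<c. a \<le> modular n (\<lambda>j. C $$ (q, j)) S)"
  using cover_eq C_carrier by (auto simp: less_eq_vec_def ones_vec_def)

lemma ok_correct:
  assumes "ok S" "S \<subseteq> {..<n}" "1 / 2 ^ w \<le> \<epsilon>" "1 - 1 / exp 1 - \<epsilon> \<le> of_rat \<kappa>"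
  shows "S \<subseteq> {..<n} \<and> P *\<^sub>v ind_vec n S \<le> ones_vec p \<and> C *\<^sub>v ind_vec n S \<ge> (1 - \<epsilon>) \<cdot>\<^sub>v ones_vec c
    \<and> (\<forall>i<t. f i S \<ge> (1 - 1 / exp 1 - \<epsilon>) * v $ i)"
proof (intro conjI allI impI)
  show "P *\<^sub>v ind_vec n S \<le> ones_vec p" using assms(1,2) by (simp add: P_le_iff ok_def)
  show "C *\<^sub>v ind_vec n S \<ge> (1 - \<epsilon>) \<cdot>\<^sub>v ones_vec c"
    unfolding C_ge_iff[OF assms(2)]
  proof (intro allI impI)
    fix q assume "q < c"
    then have "1 - 1 / 2 ^ w \<le> G (t + q) S" using assms(1) by (simp add: ok_def)
    then show "1 - \<epsilon> \<le> modular n (\<lambda>j. C $$ (q, j)) S" using assms(3) by (simp add: G_def)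
  qed
  fix i assume i: "i < t"
  show "f i S \<ge> (1 - 1 / exp 1 - \<epsilon>) * v $ i"
  proof (cases "v $ i = 0")
    case True
    then show ?thesis using f_nonneg[OF i assms(2)] by simp
  next
    case False
    then have v: "0 < v $ i" using v_nonneg[OF i] by simp
    have "of_rat \<kappa> * \<beta> i \<le> G i S" using assms(1) i by (simp add: ok_def)
    then have "1 - 1 / exp 1 - \<epsilon> \<le> f i S / v $ i"
      using i False assms(2,4) by (simp add: G_def \<beta>_def Int_absorb2)
    then show ?thesis using v by (simp add: field_simps)
  qed
qed (use assms in simp)

lemma feasible_G:
  assumes "feasible p c n P C S" "\<forall>i<t. f i S \<ge> v $ i"
  shows "S \<subseteq> {..<n}" "\<And>q. q < p \<Longrightarrow> load q S \<le> 1" "\<And>i. i < t + c \<Longrightarrow> \<beta> i \<le> G i S"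
proof -
  show S: "S \<subseteq> {..<n}" using assms(1) by (simp add: feasible_def)
  show "load q S \<le> 1" if "q < p" for q
    using assms(1) that P_le_iff[OF S] by (simp add: feasible_def)
  have "C *\<^sub>v ind_vec n S \<ge> 1 \<cdot>\<^sub>v ones_vec c" using assms(1) by (simp add: feasible_def)
  then have C: "\<forall>q<c. 1 \<le> modular n (\<lambda>j. C $$ (q, j)) S" using C_ge_iff[OF S] by blast
  show "\<beta> i \<le> G i S" if "i < t + c" for i
  proof (cases "i < t")
    case True
    then show ?thesis
      using assms(2) v_nonneg[OF True] S by (cases "v $ i = 0") (auto simp: \<beta>_def G_def Int_absorb2)
  next
    case False
    then have "i - t < c" using that by simp
    then show ?thesis using C False by (simp add: \<beta>_def G_def)
  qed
qed

text \<open>Take a largest \<open>A \<subseteq> S\<close> with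
  \<open>\<Phi> A \<ge> e1 * card A\<close>. If some element of \<open>S - A\<close> raised a
  \<open>G i\<close> by more than \<open>e1\<close>, it could be added. Since \<open>\<Phi>\<close>
  is at most \<open>t + c\<close>, such a set is small.\<close>

lemma exists_guess:
  assumes "S \<subseteq> {..<n}"
  shows "\<exists>A\<subseteq>S. card A \<le> guesses p c t w \<and> (\<forall>j\<in>S - A. \<forall>i<t + c. G i (insert j A) - G i A \<le> e1)"
proof -
  define \<Phi> where "\<Phi> A = (\<Sum>i<t + c. G i A)" for A
  define \<A> where "\<A> = {A. A \<subseteq> S \<and> e1 * real (card A) \<le> \<Phi> A}"
  have fin: "finite S" using assms finite_subset by blast
  have "finite \<A>" unfolding \<A>_def by (rule finite_subset[of _ "Pow S"]) (use fin in auto)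
  moreover have "{} \<in> \<A>" using G_unit by (auto simp: \<A>_def \<Phi>_def intro!: sum_nonneg)
  ultimately have "Max (card ` \<A>) \<in> card ` \<A>" "\<And>B. B \<in> \<A> \<Longrightarrow> card B \<le> Max (card ` \<A>)"
    by (auto intro: Max_in)
  then obtain A where A: "A \<in> \<A>" and max: "\<And>B. B \<in> \<A> \<Longrightarrow> card B \<le> card A" by auto
  have AS: "A \<subseteq> S" "finite A" using A fin finite_subset by (auto simp: \<A>_def)
  have "G i (insert j A) - G i A \<le> e1" if "j \<in> S - A" "i < t + c" for i j
  proof (rule ccontr)
    assume not: "\<not> ?thesis"
    have "e1 \<le> G i (insert j A) - G i A" using not by simp
    also have "\<dots> \<le> (\<Sum>i<t + c. G i (insert j A) - G i A)"
      using that msub_marginal_nonneg[OF msub_G]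
      by (intro member_le_sum[of i "{..<t + c}" "\<lambda>i. G i (insert j A) - G i A"]) auto
    finally have "e1 \<le> \<Phi> (insert j A) - \<Phi> A" by (simp add: \<Phi>_def sum_subtractf)
    then have "insert j A \<in> \<A>" using A that AS by (auto simp: \<A>_def algebra_simps)
    then show False using max[of "insert j A"] that AS by simp
  qed
  moreover have "card A \<le> guesses p c t w"
  proof -
    have "\<Phi> A \<le> (\<Sum>i<t + c. 1)" unfolding \<Phi>_def using G_unit by (intro sum_mono) auto
    then have "e1 * real (card A) \<le> real (t + c)" using A by (simp add: \<A>_def)
    then have "real (card A) \<le> real ((t + c) * e1d p c t w)"
      using e12_pos(1) by (simp add: e1_def field_simps)
    then show ?thesis unfolding guesses_def using of_nat_le_iff by blast
  qed
  ultimately show ?thesis using AS by blast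
qed

end

section \<open>The rows that belong to a guess\<close>

locale guess = inst +
  fixes A :: "nat set"
  assumes A_sub: "A \<subseteq> {..<n}"
begin

definition rho :: "nat \<Rightarrow> real" where
  "rho q = 1 - load q A"
text \<open>An element of large marginal value would have been guessed, so it can be discarded;
  packing sizes are measured against the remaining budget. If that budget is 0, only elements of
  size 0 survive, which makes the quotients in \<open>Ws\<close> harmless.\<close>

definition U :: "nat set" where
  "U = {j. j < n \<and> j \<notin> A \<and> (\<forall>i<t + c. G i (insert j A) - G i A \<le> e1)
     \<and> (\<forall>q<p. P $$ (q, j) \<le> e2 * rho q)}"
text \<open>Covering rows are linearized once, at \<open>A\<close>. Packing rows are negated:
  relative sizes summing to at most 1 become a lower bound of \<open>- 1\<close>.\<close>

definition Ds :: "nat \<Rightarrow> real" where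
  "Ds i = (if i < t + c then \<beta> i - h - G i A else - 1)"
definition Ws :: "nat \<Rightarrow> nat \<Rightarrow> real" where
  "Ws i j = (if i < t + c then G i (insert j A) - G i A
     else - (P $$ (i - (t + c), j) / rho (i - (t + c))))"

sublocale run_ok n t M m b G \<beta> h A U Ds Ws
  by unfold_locales (use m_pos msub_G G_unit in \<open>auto simp: U_def\<close>)

definition valid :: bool where
  "valid \<longleftrightarrow> (\<forall>q<p. 0 \<le> rho q)"
definition certified :: "bool list \<Rightarrow> bool" where
  "certified r \<longleftrightarrow> (\<exists>s<N0. violated s r)"
definition rounded :: "bool list \<Rightarrow> nat set" where
  "rounded r = smp (cnt N0 r) (take (n * b) (drop (N0 * (m * (n * b))) r))"

text \<open>If \<open>A\<close> is the guess belonging to a solution \<open>S\<close>, then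
  \<open>T = S \<inter> U\<close> satisfies every row. The lost part \<open>X\<close> contains only
  elements too large for some budget, at most \<open>1 / e2\<close> per packing constraint, and each
  is worth at most \<open>e1\<close>. The total loss is covered by the slack \<open>h\<close> of the
  rows.\<close>

lemma no_certificate:
  assumes S: "S \<subseteq> {..<n}" "\<And>q. q < p \<Longrightarrow> load q S \<le> 1" "\<And>i. i < t + c \<Longrightarrow> \<beta> i \<le> G i S"
    and AS: "A \<subseteq> S" and small: "\<forall>j\<in>S - A. \<forall>i<t + c. G i (insert j A) - G i A \<le> e1"
  shows "valid" "\<not> certified r"
proof -
  have fin: "finite S" using S(1) finite_subset by blast
  have rho: "modular n (\<lambda>j. P $$ (q, j)) (S - A) \<le> rho q" if "q < p" for q
  proof -
    have "load q S = load q A + modular n (\<lambda>j. P $$ (q, j)) (S - A)"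
      unfolding load_def modular_def using AS
      by (subst sum.union_disjoint[symmetric]) (auto intro!: sum.cong)
    then show ?thesis using S(2)[OF that] by (simp add: rho_def)
  qed
  have rho0: "0 \<le> rho q" if "q < p" for q
    by (rule order_trans[OF modular_nonneg rho[OF that]]) (rule P_nonneg[OF that])
  then show valid by (simp add: valid_def)
  define T where "T = S \<inter> U"
  define X where "X = S - A - U"
  define Xq where "Xq q = {j \<in> S - A. e2 * rho q < P $$ (q, j)}" for q
  have Xq: "real (card (Xq q)) * e2 \<le> 1" if q: "q < p" for q
  proof -
    have "real (card (Xq q)) * (e2 * rho q) = (\<Sum>j\<in>Xq q. e2 * rho q)" by simp
    also have "\<dots> \<le> (\<Sum>j\<in>Xq q. P $$ (q, j))" by (intro sum_mono) (auto simp: Xq_def)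
    also have "\<dots> \<le> modular n (\<lambda>j. P $$ (q, j)) (S - A)"
      unfolding modular_def using S(1) P_nonneg[OF q] by (intro sum_mono2) (auto simp: Xq_def)
    also have "\<dots> \<le> rho q" by (rule rho[OF q])
    finally have le: "real (card (Xq q)) * (e2 * rho q) \<le> rho q" .
    show ?thesis
    proof (cases "rho q = 0")
      \<comment> \<open>A zero budget cannot be cancelled from \<open>le\<close>; but then a single
        element of positive size would already exceed it.\<close>
      case True
      have "Xq q = {}"
      proof (rule ccontr)
        assume "Xq q \<noteq> {}"
        then obtain j where j: "j \<in> S - A" "0 < P $$ (q, j)" using True by (auto simp: Xq_def)
        have "P $$ (q, j) \<le> modular n (\<lambda>j. P $$ (q, j)) (S - A)"
          unfolding modular_def using j S(1) P_nonneg[OF q]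
          by (intro member_le_sum[of j _ "\<lambda>j. P $$ (q, j)"]) auto
        then show False using rho[OF q] True j(2) by linarith
      qed
      then show ?thesis by simp
    next
      case False
      then have "0 < rho q" using rho0[OF q] by simp
      moreover have "(real (card (Xq q)) * e2) * rho q \<le> 1 * rho q" using le by (simp add: mult.assoc)
      ultimately show ?thesis using mult_le_cancel_right_pos by blast
    qed
  qed
  have "X \<subseteq> (\<Union>q<p. Xq q)"
    using S(1) small by (force simp: X_def U_def Xq_def not_le)
  then have "card X \<le> card (\<Union>q<p. Xq q)"
    by (rule card_mono[rotated]) (use fin in \<open>auto simp: Xq_def\<close>)
  also have "\<dots> \<le> (\<Sum>q<p. card (Xq q))" by (rule card_UN_le) simp
  finally have "real (card X) \<le> (\<Sum>q<p. real (card (Xq q)))" by (simp flip: of_nat_sum)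
  then have "real (card X) * e2 \<le> (\<Sum>q<p. real (card (Xq q)) * e2)"
    using e12_pos by (simp add: sum_distrib_right[symmetric])
  also have "\<dots> \<le> (\<Sum>q<p. 1)" using Xq by (intro sum_mono) auto
  finally have cX: "real (card X) * e2 \<le> real p" by simp
  have "real (card X) * e1 * (8 * (real p + real t + real c + 1)) = h * (real (card X) * e2)"
    using e1_eq by (simp add: mult.assoc mult.left_commute)
  also have "\<dots> \<le> h * real p" using cX h_bounds(1) by (intro mult_left_mono) auto
  also have "\<dots> \<le> h * (8 * (real p + real t + real c + 1))" using h_bounds(1) by (intro mult_left_mono) auto
  finally have loss: "real (card X) * e1 \<le> h"
    by (rule mult_right_le_imp_le) simp
  have comp: "\<beta> i - h \<le> G i (A \<union> T)" if i: "i < t + c" for i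
  proof -
    have "\<beta> i \<le> G i S" by (rule S(3)[OF i])
    also have "S = (A \<union> T) \<union> X" using AS by (auto simp: T_def X_def)
    also have "G i ((A \<union> T) \<union> X) \<le> G i (A \<union> T) + (\<Sum>j\<in>X. G i (insert j (A \<union> T)) - G i (A \<union> T))"
      using msub_sum_marginals[OF msub_G[OF i], of X "A \<union> T"] fin by (simp add: X_def)
    also have "(\<Sum>j\<in>X. G i (insert j (A \<union> T)) - G i (A \<union> T)) \<le> (\<Sum>j\<in>X. e1)"
    proof (rule sum_mono)
      fix j assume j: "j \<in> X"
      have "G i (insert j (A \<union> T)) - G i (A \<union> T) \<le> G i (insert j A) - G i A"
        by (rule msub_marginal[OF msub_G[OF i]]) simp
      then show "G i (insert j (A \<union> T)) - G i (A \<union> T) \<le> e1" using small i j by (force simp: X_def)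
    qed
    finally show ?thesis using loss by simp
  qed
  have "\<not> viol c' z' r'" for c' z' r'
  proof (rule no_violation)
    show "T \<subseteq> U" by (simp add: T_def)
    show "\<beta> i - h \<le> G i (A \<union> T)" if "i < t" for i using comp that by simp
    fix i assume i: "t \<le> i" "i < M"
    show "Ds i \<le> (\<Sum>j\<in>T. Ws i j)"
    proof (cases "i < t + c")
      case True
      have "G i (A \<union> T) - G i A \<le> (\<Sum>j\<in>T. G i (insert j A) - G i A)"
        using msub_sum_marginals[OF msub_G[OF True]] fin by (simp add: T_def)
      then show ?thesis using comp[OF True] True by (simp add: Ds_def Ws_def)
    next
      case False
      define q where "q = i - (t + c)"
      have q: "q < p" using i False by (simp add: q_def)
      have "(\<Sum>j\<in>T. P $$ (q, j)) \<le> modular n (\<lambda>j. P $$ (q, j)) (S - A)"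
        unfolding modular_def using S(1) P_nonneg[OF q] by (intro sum_mono2) (auto simp: T_def U_def)
      also note rho[OF q]
      finally have "(\<Sum>j\<in>T. P $$ (q, j)) / rho q \<le> 1"
        using rho0[OF q] by (cases "rho q = 0") auto
      then show ?thesis using False by (simp add: Ds_def Ws_def q_def sum_negf sum_divide_distrib)
    qed
  qed
  then show "\<not> certified r" by (simp add: certified_def violated_def)
qed

end

section \<open>Failure probability of a run\<close>

text \<open>The price of stopping early: the deficit factor is \<open>exp (x - 1)\<close> instead of
  \<open>1 / exp 1\<close> when the fraction \<open>x\<close> of the steps is omitted.\<close>

lemma exp_shift_bound:
  assumes "0 \<le> x" "x \<le> (1 :: real)"
  shows "exp (x - 1) \<le> 1 / exp 1 + x"
proof -
  have "exp x \<le> 1 + x + x\<^sup>2" by (rule exp_bound) (use assms in auto)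
  moreover have "x\<^sup>2 \<le> x" using assms by (simp add: power2_eq_square mult_left_le)
  ultimately have "exp x \<le> 1 + 2 * x" by linarith
  also have "\<dots> \<le> 1 + exp 1 * x"
    using exp_ge_add_one_self[of 1] assms by (intro add_left_mono mult_right_mono) auto
  finally have "exp x / exp 1 \<le> (1 + exp 1 * x) / exp 1" by (intro divide_right_mono) auto
  then show ?thesis by (simp add: exp_diff add_divide_distrib)
qed

context inst
begin

lemma N_lower: "real (t + c + p + 1) * (real n + 2)\<^sup>2 \<le> h\<^sup>2 * 2 ^ b"
proof -
  have "real (Nmin p c t w n) \<le> 2 ^ b"
    using of_nat_mono[OF le_2_bitlen[of "Nmin p c t w n"], where 'a = real] by simp
  moreover have "real (Nmin p c t w n) = real (t + c + p + 1) * (real (Hc w))\<^sup>2 * (real n + 2)\<^sup>2"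
    unfolding Nmin_def by (simp only: of_nat_mult of_nat_power of_nat_add of_nat_numeral)
  ultimately have "real (t + c + p + 1) * (real (Hc w))\<^sup>2 * (real n + 2)\<^sup>2 \<le> 2 ^ b"
    by (simp only:)
  then have "h\<^sup>2 * (real (t + c + p + 1) * (real (Hc w))\<^sup>2 * (real n + 2)\<^sup>2) \<le> h\<^sup>2 * 2 ^ b"
    by (intro mult_left_mono) auto
  moreover have "h\<^sup>2 * (real (t + c + p + 1) * (real (Hc w))\<^sup>2 * (real n + 2)\<^sup>2)
      = (h * real (Hc w))\<^sup>2 * (real (t + c + p + 1) * (real n + 2)\<^sup>2)"
    by (simp only: power_mult_distrib ac_simps)
  moreover have "h * real (Hc w) = 1" using Hc_pos by (simp add: h_def)
  ultimately show ?thesis by (simp only: power_one mult_1)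
qed

text \<open>Ensures that the exponent in \<open>N0\<close> is not truncated, so that
  \<open>N0\<close> is exactly the intended fraction.\<close>

lemma b_ge: "w + 3 \<le> b"
proof -
  have "(2 :: nat) ^ (w + 3) \<le> Hc w * 1" by (simp add: Hc_def power_add)
  also have "\<dots> \<le> Hc w * Hc w" using Hc_pos by (intro mult_le_mono) auto
  also have "\<dots> \<le> Nmin p c t w n" by (simp add: Nmin_def power2_eq_square)
  also have "\<dots> \<le> 2 ^ b" by (rule le_2_bitlen)
  finally show ?thesis by simp
qed

lemma N0_eq: "real N0 = 2 ^ b * (1 - 2 * h)"
proof -
  have "(2 :: nat) ^ (b - (w + 3)) \<le> 2 ^ b" by simp
  then have "real N0 = 2 ^ b - 2 ^ (b - (w + 3))" by (simp add: N0_def of_nat_diff)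
  also have "(2 :: real) ^ (b - (w + 3)) = 2 ^ b / 2 ^ (w + 3)" using b_ge by (simp add: power_diff)
  also have "\<dots> = 2 ^ b * (2 * h)" by (simp add: h_bounds(3) power_add)
  finally show ?thesis by (simp add: algebra_simps)
qed

lemma N0_le: "N0 \<le> 2 ^ b"
  by (simp add: N0_def)

lemma m_h: "real m * h\<^sup>2 = 4 * (real t + 1) * 2 ^ b * (real n + 2) ^ 3"
proof -
  have "real m * h\<^sup>2 = (real (Hc w) * h)\<^sup>2 * (4 * (real t + 1) * 2 ^ b * (real n + 2) ^ 3)"
    unfolding m_def by (simp add: power_mult_distrib add.commute)
  then show ?thesis using Hc_pos by (simp add: h_def)
qed

lemma rounding_error: "real t * (2 * e1 / h\<^sup>2) + real c * (2 * e1 / h\<^sup>2) + real p * (e2 / h\<^sup>2) \<le> 1 / 4"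
proof -
  have h2: "0 < h\<^sup>2" using h_bounds(1,2) by simp
  have "e2 * (8 * real p) \<le> h\<^sup>2" unfolding e2_eq[symmetric] using e12_pos by simp
  then have 1: "real p * (e2 / h\<^sup>2) \<le> 1 / 8" using h2 by (simp add: field_simps)
  have "e1 * (8 * (real t + real c)) \<le> h * e2"
    unfolding e1_eq[symmetric] using e12_pos by simp
  also have "\<dots> \<le> 1 / 16 * e2" using h_bounds(1,2) e12_pos by (intro mult_right_mono) auto
  also have "e2 * 8 \<le> h\<^sup>2" unfolding e2_eq[symmetric] using e12_pos by simp
  then have "1 / 16 * e2 \<le> 1 / 2 * h\<^sup>2" using h2 by linarith
  finally have "(real t + real c) * (2 * e1 / h\<^sup>2) \<le> 1 / 8" using h2 by (simp add: field_simps)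
  then show ?thesis using 1 unfolding distrib_right by linarith
qed

end

context guess
begin

lemma valid_bounded:
  assumes valid shows "run_bounded n t M m G \<beta> h U Ds Ws"
proof unfold_locales
  fix i assume i: "t \<le> i" "i < M"
  show "\<bar>Ws i j\<bar> \<le> 1" if "j \<in> U" for j
  proof (cases "i < t + c")
    case True
    then show ?thesis
      using msub_marginal_nonneg[OF msub_G[OF True], of j A] G_unit[OF True, of A]
        G_unit[OF True, of "insert j A"] by (simp add: Ws_def abs_le_iff)
  next
    case False
    define q where "q = i - (t + c)"
    have q: "q < p" using i False by (simp add: q_def)
    have "P $$ (q, j) \<le> e2 * rho q" "0 \<le> P $$ (q, j)" "0 \<le> rho q"
      using that q P_nonneg[OF q] assms by (auto simp: U_def valid_def)
    moreover have "e2 \<le> 1"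
    proof -
      have "e2 * 1 \<le> e2 * (8 * (real p + 1))" using e12_pos by (intro mult_left_mono) auto
      also have "\<dots> \<le> 1" unfolding e2_eq using h_bounds(1,2) by (intro power_le_one) auto
      finally show ?thesis by simp
    qed
    ultimately have "P $$ (q, j) \<le> rho q" by (metis mult_left_le_one_le order_trans e12_pos(2) less_imp_le)
    then have "\<bar>P $$ (q, j) / rho q\<bar> \<le> 1"
      using \<open>0 \<le> P $$ (q, j)\<close> \<open>0 \<le> rho q\<close> by (cases "rho q = 0") auto
    then show ?thesis using False by (simp add: Ws_def q_def)
  qed
  show "\<bar>Ds i\<bar> \<le> 2"
    using G_unit[of i A] h_bounds(1,2) i by (auto simp: Ds_def \<beta>_def)
next
  show "0 \<le> \<beta> i \<and> \<beta> i \<le> 1" for i using \<beta>_cases[of i] by auto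
  show "0 \<le> h" "h \<le> 1" using h_bounds(1,2) by auto
qed

text \<open>Undoes the sign of the packing rows and vanishes outside \<open>U\<close>. So all static
  rows become nonnegative modular functions, to which the tail bounds apply.\<close>

definition wt :: "nat \<Rightarrow> nat \<Rightarrow> real" where
  "wt i j = (if j \<in> U then \<bar>Ws i j\<bar> else 0)"

text \<open>What the fractional point must satisfy; the margins are such that rounding may still
  lose \<open>h\<close> in every row.\<close>

definition balanced :: "(nat \<Rightarrow> nat) \<Rightarrow> bool" where
  "balanced d \<longleftrightarrow> (\<forall>j. d j \<le> 2 ^ b) \<and> (\<forall>j. j \<notin> U \<longrightarrow> d j = 0) \<and>
     (\<forall>i<t. \<beta> i = 1 \<longrightarrow> of_rat \<kappa> + h \<le> F i d) \<and>
     (\<forall>i. t \<le> i \<longrightarrow> i < t + c \<longrightarrow> Ds i - 3 * h \<le> (\<Sum>j<n. real (d j) / 2 ^ b * wt i j)) \<and>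
     (\<forall>i. t + c \<le> i \<longrightarrow> i < M \<longrightarrow> (\<Sum>j<n. real (d j) / 2 ^ b * wt i j) \<le> 1 - h)"

text \<open>The budget \<open>7 * h\<close> of the function values: \<open>h\<close> for lowering
  the rows, \<open>2 * h\<close> for stopping early, \<open>h\<close> for the residual,
  \<open>2 * h\<close> for sampling and discretization, and \<open>h\<close> left to the rounding.
  Covering rows lose \<open>2 * h\<close> by early stopping and \<open>h\<close> by the residual; in
  the packing rows the residual uses up half of the slack \<open>2 * h\<close>.\<close>

lemma balanced_run:
  assumes valid "\<not> certified r" and \<kappa>: "of_rat \<kappa> \<le> 1 - 1 / exp 1 - 7 * h"
    and good: "\<And>s. s < N0 \<Longrightarrow> good (h / (real n + 1)) (cnt s r) (sblk s r)"
  shows "balanced (cnt N0 r)"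
proof -
  interpret run_bounded n t M m b G \<beta> h A U Ds Ws
    using valid_bounded[OF assms(1)] by (simp add: run_bounded_def)
  define N :: real where "N = 2 ^ b"
  have N: "0 < N" by (simp add: N_def)
  have N0: "real N0 = N * (1 - 2 * h)" using N0_eq by (simp add: N_def)
  have N0N: "real N0 \<le> N" using h_bounds(1,2) N by (simp add: N0 mult_left_le)
  have nv: "\<not> violated s r" if "s < N0" for s using assms(2) that by (auto simp: certified_def)
  have z: "zs N0 r i \<le> h * N" if "i < M" for i
  proof (rule residual_le[OF _ that])
    show "\<not> violated s r" if "s < N0" for s by (rule nv[OF that])
    have "real M * (real n + 2)\<^sup>2 \<le> real (M + 1) * (real n + 2)\<^sup>2" by (intro mult_right_mono) auto
    also have "\<dots> \<le> h\<^sup>2 * N" using N_lower by (simp add: N_def)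
    finally have "real N0 * (real M * (real n + 2)\<^sup>2) \<le> N * (h\<^sup>2 * N)"
      using N0N N by (intro mult_mono[of _ _ "real M * (real n + 2)\<^sup>2"]) auto
    then show "real N0 * (real M * (real n + 2)\<^sup>2) \<le> (h * N)\<^sup>2"
      by (simp add: power2_eq_square mult.assoc mult.left_commute)
    show "0 \<le> h * N" using N h_bounds(1,2) by simp
  qed
  have lin: "real N0 * Ds i - h * N \<le> N * (\<Sum>j<n. real (cnt N0 r j) / N * (if j \<in> U then Ws i j else 0))"
    if "t \<le> i" "i < M" for i
  proof -
    have "(\<Sum>j\<in>U. real (cnt N0 r j) * Ws i j) = (\<Sum>j<n. real (cnt N0 r j) * (if j \<in> U then Ws i j else 0))"
      using U_sub by (intro sum.mono_neutral_cong_left) auto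
    also have "\<dots> = N * (\<Sum>j<n. real (cnt N0 r j) / N * (if j \<in> U then Ws i j else 0))"
      using N by (simp add: sum_distrib_left)
    finally show ?thesis using linear_rows[OF that, of N0 r] z[OF that(2)] by simp
  qed
  show ?thesis unfolding balanced_def N_def[symmetric]
  proof (intro conjI allI impI)
    show "cnt N0 r j \<le> 2 ^ b" for j using cnt_le[of N0 r j] N0_le by linarith
    show "cnt N0 r j = 0" if "j \<notin> U" for j by (rule cnt_outside[OF that])
  next
    fix i assume i: "i < t" "\<beta> i = 1"
    let ?a = "h / (real n + 1)"
    have "\<beta> i - h - F i (cnt N0 r) \<le> (1 - 1 / N) ^ N0 + zs N0 r i / N
        + real N0 * ((real n + 1) * ?a / N + (real n)\<^sup>2 / N\<^sup>2)"
      unfolding N_def by (rule deficit_bound) (use i N0_le h_bounds(1,2) good in auto)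
    moreover have "(1 - 1 / N) ^ N0 \<le> 1 / exp 1 + 2 * h"
    proof -
      have "(1 - 1 / N) ^ N0 \<le> exp (- (1 / N)) ^ N0"
        using exp_ge_add_one_self[of "- (1 / N)"] N by (intro power_mono) (auto simp: N_def)
      also have "\<dots> = exp (- (real N0 / N))" by (simp add: exp_of_nat_mult[symmetric])
      also have "- (real N0 / N) = 2 * h - 1" using N by (simp add: N0)
      also have "exp (2 * h - 1) \<le> 1 / exp 1 + 2 * h" using h_bounds(1,2) by (intro exp_shift_bound) auto
      finally show ?thesis .
    qed
    moreover have "zs N0 r i / N \<le> h" using z[of i] i N by (simp add: field_simps)
    \<comment> \<open>The accuracy \<open>h / (n + 1)\<close> makes the sampling errors sum to at
      most \<open>h\<close> over the run; the other \<open>h\<close> is the second-order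
      loss.\<close>
    moreover have "real N0 * ((real n + 1) * ?a / N + (real n)\<^sup>2 / N\<^sup>2) \<le> 2 * h"
    proof -
      have "real N0 * ((real n + 1) * ?a / N + (real n)\<^sup>2 / N\<^sup>2)
          \<le> N * ((real n + 1) * ?a / N + (real n)\<^sup>2 / N\<^sup>2)"
        using N0N N h_bounds(1,2) by (intro mult_right_mono) auto
      also have "\<dots> = h + (real n)\<^sup>2 / N"
      proof -
        have "(real n + 1) * ?a = h" by (simp add: add_eq_0_iff)
        then show ?thesis using N by (simp add: distrib_left power2_eq_square)
      qed
      also have "(real n)\<^sup>2 \<le> h * N"
      proof -
        have "(real n)\<^sup>2 \<le> 1 * (real n + 2)\<^sup>2" by (simp add: power_mono)
        also have "\<dots> \<le> real (M + 1) * (real n + 2)\<^sup>2" by (intro mult_right_mono) auto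
        also have "\<dots> \<le> h\<^sup>2 * N" using N_lower by (simp add: N_def)
        also have "\<dots> \<le> h * N" using h_bounds(1,2) N by (intro mult_right_mono) (auto simp: power2_eq_square mult_left_le)
        finally show ?thesis .
      qed
      then have "(real n)\<^sup>2 / N \<le> h" using N by (simp add: field_simps)
      finally show ?thesis by simp
    qed
    ultimately show "of_rat \<kappa> + h \<le> F i (cnt N0 r)" using i \<kappa> by linarith
  next
    fix i assume i: "t \<le> i" "i < t + c"
    have wt: "wt i j = (if j \<in> U then Ws i j else 0)" for j
      using msub_marginal_nonneg[OF msub_G[OF i(2)], of j A] i by (auto simp: wt_def Ws_def)
    have "N * (Ds i - 3 * h) \<le> real N0 * Ds i - h * N"
    proof -
      have "Ds i \<le> 1" using i G_unit[OF i(2), of A] h_bounds(1,2) by (auto simp: Ds_def \<beta>_def)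
      then have "h * Ds i \<le> h * 1" using h_bounds(1,2) by (intro mult_left_mono) auto
      then have "N * (h * Ds i) \<le> N * h" using N by simp
      then show ?thesis by (simp add: N0 algebra_simps)
    qed
    also have "\<dots> \<le> N * (\<Sum>j<n. real (cnt N0 r j) / N * wt i j)"
      using lin[of i] i by (simp add: wt)
    finally show "Ds i - 3 * h \<le> (\<Sum>j<n. real (cnt N0 r j) / N * wt i j)" using N by simp
  next
    fix i assume i: "t + c \<le> i" "i < M"
    have q: "i - (t + c) < p" using i by simp
    have wt: "wt i j = - (if j \<in> U then Ws i j else 0)" for j
      using i assms(1) P_nonneg[OF q, of j] q by (auto simp: wt_def Ws_def valid_def U_def)
    have "N * (\<Sum>j<n. real (cnt N0 r j) / N * wt i j)
        = - (N * (\<Sum>j<n. real (cnt N0 r j) / N * (if j \<in> U then Ws i j else 0)))"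
      by (simp add: wt sum_negf)
    also have "\<dots> \<le> h * N + real N0" using lin[of i] i by (simp add: Ds_def)
    also have "\<dots> = N * (1 - h)" by (simp add: N0 algebra_simps)
    finally show "(\<Sum>j<n. real (cnt N0 r j) / N * wt i j) \<le> 1 - h" using N by simp
  qed
qed

text \<open>The rounded set can fail only through a function (\<open>Bf\<close>), a covering row
  (\<open>Bc\<close>) or a packing row (\<open>Bp\<close>). Elements of \<open>U\<close> are small
  in each of these, so the tail bounds and a union bound suffice.\<close>

lemma rounding_failure:
  assumes valid "balanced d" and \<kappa>: "of_rat \<kappa> \<le> (1 :: real)"
  shows "bavg (n * b) (\<lambda>y. of_bool (\<not> ok (smp d y))) \<le> 1 / 4"
proof -
  have d: "\<And>j. d j \<le> 2 ^ b" "\<And>j. j \<notin> U \<Longrightarrow> d j = 0"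
    using assms(2) by (auto simp: balanced_def)
  have wt0: "0 \<le> wt i j" for i j by (simp add: wt_def)
  have thr_U: "thr n b d y \<subseteq> U" for y using d(2) by (force simp: thr_def)
  define Bf where "Bf i y \<longleftrightarrow> G i (A \<union> thr n b d y) < of_rat \<kappa> \<and> \<beta> i = 1" for i y
  define Bc where "Bc q y \<longleftrightarrow> modular n (wt (t + q)) (thr n b d y) < Ds (t + q) - 4 * h" for q y
  define Bp where "Bp q y \<longleftrightarrow> 1 < modular n (wt (t + c + q)) (thr n b d y)" for q y
  have okI: "ok (smp d y)" if nf: "\<And>i. i < t \<Longrightarrow> \<not> Bf i y" and nc: "\<And>q. q < c \<Longrightarrow> \<not> Bc q y"
    and np: "\<And>q. q < p \<Longrightarrow> \<not> Bp q y" for y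
    unfolding ok_def
  proof (intro conjI allI impI)
    fix q assume q: "q < p"
    let ?S = "thr n b d y"
    have "load q (smp d y) = load q A + modular n (\<lambda>j. P $$ (q, j)) ?S"
    proof -
      have "(A \<union> ?S) \<inter> {..<n} = (A \<inter> {..<n}) \<union> (?S \<inter> {..<n})" by blast
      moreover have "(A \<inter> {..<n}) \<inter> (?S \<inter> {..<n}) = {}" using thr_U[of y] by (auto simp: U_def)
      ultimately show ?thesis
        unfolding load_def modular_def smp_def by (simp add: sum.union_disjoint)
    qed
    also have "modular n (\<lambda>j. P $$ (q, j)) ?S \<le> rho q * modular n (wt (t + c + q)) ?S"
      unfolding modular_def sum_distrib_left
    proof (rule sum_mono)
      fix j assume "j \<in> ?S \<inter> {..<n}"
      then have j: "j \<in> U" "j < n" using thr_U by auto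
      have r: "0 \<le> rho q" using assms(1) q by (simp add: valid_def)
      \<comment> \<open>This also settles a zero budget: the size is then 0, and division by zero
        does no harm.\<close>
      have "P $$ (q, j) \<le> e2 * rho q" using j q by (simp add: U_def)
      then show "P $$ (q, j) \<le> rho q * wt (t + c + q) j"
        using r j P_nonneg[OF q j(2)] by (cases "rho q = 0") (auto simp: wt_def Ws_def)
    qed
    also have "\<dots> \<le> rho q * 1"
      using np[OF q] assms(1) q by (intro mult_left_mono) (auto simp: Bp_def valid_def)
    finally show "load q (smp d y) \<le> 1" by (simp add: rho_def)
  next
    fix i assume i: "i < t"
    show "of_rat \<kappa> * \<beta> i \<le> G i (smp d y)"
      using \<beta>_cases[of i] nf[OF i] G_unit[of i "smp d y"] i by (auto simp: Bf_def smp_def)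
  next
    fix q assume q: "q < c"
    let ?S = "thr n b d y"
    define i where "i = t + q"
    have i: "i < t + c" "\<not> i < t" "i - t = q" using q by (auto simp: i_def)
    have "Ds i - 4 * h \<le> modular n (wt i) ?S" using nc[OF q] by (simp add: Bc_def i_def)
    then have L: "1 - 5 * h \<le> G i A + modular n (wt i) ?S" using i by (simp add: Ds_def \<beta>_def)
    have "1 - 5 * h \<le> G i (smp d y)"
    \<comment> \<open>Either the guess alone covers the constraint and monotonicity suffices, or the
      truncation is inactive at \<open>A\<close>, and then truncated marginals are at most the
      entries of the covering matrix.\<close>
    proof (cases "G i A = 1")
      case True
      have "G i A \<le> G i (smp d y)" by (rule msub_mono[OF msub_G[OF i(1)]]) (auto simp: smp_def)
      then show ?thesis using True h_bounds(1,2) by linarith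
    next
      case False
      let ?C = "modular n (\<lambda>j. C $$ (q, j))"
      have A: "G i A = ?C A" using False i by (auto simp: G_def min_def split: if_splits)
      have "modular n (wt i) ?S \<le> ?C ?S"
        unfolding modular_def
      proof (rule sum_mono)
        fix j assume "j \<in> ?S \<inter> {..<n}"
        then have j: "j \<in> U" "j < n" "j \<notin> A" using thr_U by (auto simp: U_def)
        have "G i (insert j A) \<le> ?C (insert j A)" using i by (simp add: G_def)
        then have "Ws i j \<le> C $$ (q, j)" using i j A by (simp add: Ws_def modular_insert)
        moreover have "0 \<le> Ws i j" using msub_marginal_nonneg[OF msub_G[OF i(1)]] i by (simp add: Ws_def)
        ultimately show "wt i j \<le> C $$ (q, j)" using j by (simp add: wt_def)
      qed
      moreover have "?C (smp d y) = ?C A + ?C ?S"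
      proof -
        have "(A \<union> ?S) \<inter> {..<n} = (A \<inter> {..<n}) \<union> (?S \<inter> {..<n})" by blast
        moreover have "(A \<inter> {..<n}) \<inter> (?S \<inter> {..<n}) = {}" using thr_U[of y] by (auto simp: U_def)
        ultimately show ?thesis unfolding modular_def smp_def by (simp add: sum.union_disjoint)
      qed
      ultimately show ?thesis using L A i h_bounds(1,2) by (simp add: G_def)
    qed
    moreover have "1 / 2 ^ w = 16 * h" by (simp add: h_bounds(3))
    ultimately show "1 - 1 / 2 ^ w \<le> G (t + q) (smp d y)"
      using h_bounds(1) unfolding i_def by linarith
  qed
  have fail: "of_bool (\<not> ok (smp d y)) \<le> (\<Sum>i<t. of_bool (Bf i y)) + (\<Sum>q<c. of_bool (Bc q y))
      + (\<Sum>q<p. of_bool (Bp q y) :: real)" for y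
  proof -
    have nn: "0 \<le> (\<Sum>i<k. of_bool (B i) :: real)" for B :: "nat \<Rightarrow> bool" and k by (rule sum_nonneg) simp
    show ?thesis
  proof (cases "ok (smp d y)")
    case False
    have s: "1 \<le> (\<Sum>i<k. of_bool (B i) :: real)" if "B i" "i < k" for B :: "nat \<Rightarrow> bool" and i k
    proof -
      have "(of_bool (B i) :: real) \<le> (\<Sum>i<k. of_bool (B i))"
        by (rule member_le_sum) (use that in auto)
      then show ?thesis using that(1) by (simp only: of_bool_eq)
    qed
    consider (f) i where "i < t" "Bf i y" | (c) q where "q < c" "Bc q y" | (p) q where "q < p" "Bp q y"
      using False okI by blast
    then have "1 \<le> (\<Sum>i<t. of_bool (Bf i y)) + (\<Sum>q<c. of_bool (Bc q y)) + (\<Sum>q<p. of_bool (Bp q y) :: real)"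
    proof cases
      case f
      then show ?thesis using s[of "\<lambda>i. Bf i y" i t] nn[of "\<lambda>i. Bc i y" c] nn[of "\<lambda>i. Bp i y" p] by linarith
    next
      case c
      then show ?thesis using s[of "\<lambda>i. Bc i y" q c] nn[of "\<lambda>i. Bf i y" t] nn[of "\<lambda>i. Bp i y" p] by linarith
    next
      case p
      then show ?thesis using s[of "\<lambda>i. Bp i y" q p] nn[of "\<lambda>i. Bf i y" t] nn[of "\<lambda>i. Bc i y" c] by linarith
    qed
    then show ?thesis using False by (simp only: of_bool_eq not_False_eq_True)
  next
    case True
    have "of_bool (\<not> ok (smp d y)) = (0 :: real)" using True by simp
    then show ?thesis
      using nn[of "\<lambda>i. Bf i y" t] nn[of "\<lambda>i. Bc i y" c] nn[of "\<lambda>i. Bp i y" p] by linarith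
  qed
  qed
  have dU: "d j \<noteq> 0 \<Longrightarrow> j \<in> U" for j by (rule ccontr) (simp add: d(2))
  have Bf: "bavg (n * b) (\<lambda>y. of_bool (Bf i y)) \<le> 2 * e1 / h\<^sup>2" if i: "i < t" for i
  proof (cases "\<beta> i = 1")
    case True
    have "bavg (n * b) (\<lambda>y. of_bool (G i (A \<union> thr n b d y) < of_rat \<kappa>)) \<le> 2 * e1 / h\<^sup>2"
    proof (rule thr_lower_tail[where g = "\<lambda>S. G i (A \<union> S)"])
      show "G i (A \<union> insert j S) - G i (A \<union> S) \<le> e1" if "d j \<noteq> 0" for j S
      proof -
        have "G i (insert j (A \<union> S)) - G i (A \<union> S) \<le> G i (insert j A) - G i A"
          by (rule msub_marginal) (use msub_G i in auto)
        also have "\<dots> \<le> e1" using dU[OF that] i by (simp add: U_def)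
        finally show ?thesis by simp
      qed
      show "of_rat \<kappa> + h \<le> mean n (\<lambda>j. real (d j) / 2 ^ b) (\<lambda>S. G i (A \<union> S))"
        using assms(2) i True by (simp add: balanced_def F_def)
    qed (use d msub_G G_unit i \<kappa> e12_pos h_bounds(1,2) in \<open>auto intro!: msub_Un\<close>)
    then show ?thesis using True by (simp add: Bf_def)
  next
    case False
    then show ?thesis using e12_pos by (simp add: Bf_def)
  qed
  have Bc: "bavg (n * b) (\<lambda>y. of_bool (Bc q y)) \<le> 2 * e1 / h\<^sup>2" if q: "q < c" for q
    unfolding Bc_def
  proof (rule thr_lower_tail)
    have tq: "t + q < t + c" using q by simp
    show "modular n (wt (t + q)) (insert j S) - modular n (wt (t + q)) S \<le> e1" if "d j \<noteq> 0" for j S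
      using dU[OF that] e12_pos q msub_marginal_nonneg[OF msub_G[OF tq], of j A]
      by (auto simp: modular_insert wt_def Ws_def U_def)
    show "Ds (t + q) - 4 * h + h \<le> mean n (\<lambda>j. real (d j) / 2 ^ b) (modular n (wt (t + q)))"
      using assms(2) q by (simp add: balanced_def mean_modular)
    show "Ds (t + q) - 4 * h \<le> 1"
      using tq G_unit[OF tq, of A] h_bounds(1,2) by (simp add: Ds_def \<beta>_def)
  qed (use d wt0 e12_pos h_bounds(1,2) in \<open>auto intro!: msub_modular modular_nonneg\<close>)
  have Bp: "bavg (n * b) (\<lambda>y. of_bool (Bp q y)) \<le> e2 / h\<^sup>2" if q: "q < p" for q
    unfolding Bp_def
  proof (rule thr_upper_tail)
    show "modular n (wt (t + c + q)) (insert j S) - modular n (wt (t + c + q)) S \<le> e2" if "d j \<noteq> 0" for j S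
    proof -
      have j: "j \<in> U" by (rule dU[OF that])
      then have "P $$ (q, j) \<le> e2 * rho q" "0 \<le> P $$ (q, j)" "0 \<le> rho q"
        using q P_nonneg[OF q] assms(1) by (auto simp: U_def valid_def)
      then have "wt (t + c + q) j \<le> e2"
        using j e12_pos by (cases "rho q = 0") (auto simp: wt_def Ws_def divide_le_eq)
      then show ?thesis using e12_pos by (auto simp: modular_insert)
    qed
    show "mean n (\<lambda>j. real (d j) / 2 ^ b) (modular n (wt (t + c + q))) \<le> 1 - h"
      using assms(2) q by (simp add: balanced_def mean_modular)
  qed (use d wt0 e12_pos h_bounds(1,2) in \<open>auto intro!: msub_modular modular_nonneg\<close>)
  have "bavg (n * b) (\<lambda>y. of_bool (\<not> ok (smp d y)))
      \<le> bavg (n * b) (\<lambda>y. (\<Sum>i<t. of_bool (Bf i y)) + (\<Sum>q<c. of_bool (Bc q y)) + (\<Sum>q<p. of_bool (Bp q y)))"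
    by (intro bavg_le fail)
  also have "\<dots> = (\<Sum>i<t. bavg (n * b) (\<lambda>y. of_bool (Bf i y))) + (\<Sum>q<c. bavg (n * b) (\<lambda>y. of_bool (Bc q y)))
      + (\<Sum>q<p. bavg (n * b) (\<lambda>y. of_bool (Bp q y)))"
    by (simp only: bavg_add bavg_sum)
  also have "\<dots> \<le> (\<Sum>i<t. 2 * e1 / h\<^sup>2) + (\<Sum>q<c. 2 * e1 / h\<^sup>2) + (\<Sum>q<p. e2 / h\<^sup>2)"
    using Bf Bc Bp by (intro add_mono sum_mono) auto
  also have "\<dots> \<le> 1 / 4" using rounding_error by simp
  finally show ?thesis .
qed

text \<open>A run fails with probability 1/4 through inaccurate samples and with probability 1/4
  through rounding. The rounding bits are fresh, because the final counters depend only on the bits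
  of the steps.\<close>

lemma run_failure:
  assumes valid and \<kappa>: "of_rat \<kappa> \<le> 1 - 1 / exp 1 - 7 * h"
  shows "bavg Q (\<lambda>r. of_bool (\<not> certified r \<and> \<not> ok (rounded r))) \<le> 1 / 2"
proof -
  let ?a = "h / (real n + 1)" and ?k = "N0 * (m * (n * b))"
  define B1 where "B1 r \<longleftrightarrow> (\<exists>s<N0. \<not> good ?a (cnt s r) (sblk s r))" for r
  define B2 where "B2 x y \<longleftrightarrow> balanced (cnt N0 x) \<and> \<not> ok (smp (cnt N0 x) y)" for x y
  have \<kappa>1: "of_rat \<kappa> \<le> (1 :: real)" 
  proof -
    have "0 \<le> 1 / exp (1 :: real)" by simp
    then show ?thesis using \<kappa> h_bounds(1) by linarith
  qed
  have take: "cnt N0 (take ?k r) = cnt N0 r" for r by (simp add: cnt_def st_take)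
  have "of_bool (\<not> certified r \<and> \<not> ok (rounded r))
      \<le> of_bool (B1 r) + (of_bool (B2 (take ?k r) (take (n * b) (drop ?k r))) :: real)" for r
    using balanced_run[OF assms(1) _ \<kappa>, of r] by (auto simp: B1_def B2_def take rounded_def)
  then have "bavg Q (\<lambda>r. of_bool (\<not> certified r \<and> \<not> ok (rounded r)))
      \<le> bavg Q (\<lambda>r. of_bool (B1 r)) + bavg Q (\<lambda>r. of_bool (B2 (take ?k r) (take (n * b) (drop ?k r))))"
    unfolding bavg_add[symmetric] by (intro bavg_le)
  also have "bavg Q (\<lambda>r. of_bool (B1 r)) \<le> real N0 * (real t * (real n + 1) / (real m * ?a\<^sup>2))"
    unfolding B1_def by (rule prob_run_not_good) (use N0_le h_bounds(1,2) in \<open>auto simp: Q_def\<close>)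
  also have "\<dots> \<le> 1 / 4"
  proof -
    have "real N0 * (real t * (real n + 1) / (real m * ?a\<^sup>2))
        = real N0 * real t * (real n + 1) ^ 3 / (real m * h\<^sup>2)"
      by (simp add: power_divide power2_eq_square power3_eq_cube)
    also have "\<dots> \<le> 2 ^ b * (real t + 1) * (real n + 2) ^ 3 / (real m * h\<^sup>2)"
      using of_nat_mono[OF N0_le, where 'a = real]
      by (intro divide_right_mono mult_mono power_mono) auto
    also have "\<dots> = 1 / 4" unfolding m_h
    proof -
      have "(0 :: real) < 2 ^ b * (real t + 1) * (real n + 2) ^ 3" by (simp add: add_nonneg_pos)
      then show "2 ^ b * (real t + 1) * (real n + 2) ^ 3 / (4 * (real t + 1) * 2 ^ b * (real n + 2) ^ 3) = 1 / 4"
        by (simp add: divide_simps)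
    qed
    finally show ?thesis .
  qed
  also have "bavg Q (\<lambda>r. of_bool (B2 (take ?k r) (take (n * b) (drop ?k r)))) \<le> 1 / 4"
  proof (rule bavg_adaptive[where h = "\<lambda>x y. of_bool (B2 x y)"])
    show "bavg (n * b) (\<lambda>y. of_bool (B2 x y)) \<le> 1 / 4" for x
      using rounding_failure[OF assms(1) _ \<kappa>1, of "cnt N0 x"]
      by (cases "balanced (cnt N0 x)") (auto simp: B2_def)
  qed (simp add: Q_def)
  finally show ?thesis by simp
qed

end

section \<open>Programs with bounded loops\<close>

text \<open>A structured sublanguage whose loops have bounds fixed on entry, so that programs denote total
  state transformers.\<close>

datatype prog =
    NOP
  | IS string "iexp list" iexp
  | RS string "iexp list" rexp
  | SQ prog prog (infixr \<open>;;;\<close> 60)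
  | IF bexp prog prog
  | FOR string string prog

definition seti :: "string \<Rightarrow> nat list \<Rightarrow> nat \<Rightarrow> state \<Rightarrow> state" where
  "seti a js k s = s\<lparr>imem := (imem s)(a := (imem s a)(js := k))\<rparr>"

definition setr :: "string \<Rightarrow> nat list \<Rightarrow> real \<Rightarrow> state \<Rightarrow> state" where
  "setr a js y s = s\<lparr>rmem := (rmem s)(a := (rmem s a)(js := y))\<rparr>"

lemma imem_seti: "imem (seti a js k s) a' = (if a' = a then (imem s a)(js := k) else imem s a')"
  and rmem_seti [simp]: "rmem (seti a js k s) = rmem s"
  and imem_setr [simp]: "imem (setr a js y s) = imem s"
  and rmem_setr: "rmem (setr a js y s) a' = (if a' = a then (rmem s a)(js := y) else rmem s a')"
  by (simp_all add: seti_def setr_def)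

text \<open>Loop bounds are real cells because bounds such as the number of samples are products,
  and programs multiply reals only. The ceiling matches the guard of the compiled loop, and the
  counter is left at the bound, as by that loop.\<close>

primrec exec :: "nat \<Rightarrow> (nat \<Rightarrow> nat set \<Rightarrow> real) \<Rightarrow> prog \<Rightarrow> state \<Rightarrow> state" where
  "exec n f NOP s = s"
| "exec n f (IS a es e) s = seti a (map (ival s) es) (ival s e) s"
| "exec n f (RS a es e) s = setr a (map (ival s) es) (rval n f s e) s"
| "exec n f (p1 ;;; p2) s = exec n f p2 (exec n f p1 s)"
| "exec n f (IF b p1 p2) s = (if bval n f s b then exec n f p1 s else exec n f p2 s)"
| "exec n f (FOR x a p) s = (let k = nat \<lceil>rmem s a []\<rceil> in
     seti x [] k (fold (\<lambda>i s. exec n f p (seti x [] i s)) [0..<k] s))"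

primrec compile :: "prog \<Rightarrow> com" where
  "compile NOP = Skip"
| "compile (IS a es e) = ISet a es e"
| "compile (RS a es e) = RSet a es e"
| "compile (p1 ;;; p2) = Seq (compile p1) (compile p2)"
| "compile (IF b p1 p2) = Cond b (compile p1) (compile p2)"
| "compile (FOR x a p) = Seq (ISet x [] (Nat 0))
     (While (RLess (OfNat (IGet x [])) (RGet a []))
        (Seq (compile p) (ISet x [] (IAdd (IGet x []) (Nat 1)))))"

text \<open>Syntactic over-approximations of the written arrays. All frame arguments below consist
  in computing such sets by simplification.\<close>

primrec iw :: "prog \<Rightarrow> string set" where
  "iw NOP = {}"
| "iw (IS a es e) = {a}"
| "iw (RS a es e) = {}"
| "iw (p1 ;;; p2) = iw p1 \<union> iw p2"
| "iw (IF b p1 p2) = iw p1 \<union> iw p2"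
| "iw (FOR x a p) = insert x (iw p)"

primrec rw :: "prog \<Rightarrow> string set" where
  "rw NOP = {}"
| "rw (IS a es e) = {}"
| "rw (RS a es e) = {a}"
| "rw (p1 ;;; p2) = rw p1 \<union> rw p2"
| "rw (IF b p1 p2) = rw p1 \<union> rw p2"
| "rw (FOR x a p) = rw p"

primrec bounds :: "prog \<Rightarrow> string set" where
  "bounds NOP = {}"
| "bounds (IS a es e) = {}"
| "bounds (RS a es e) = {}"
| "bounds (p1 ;;; p2) = bounds p1 \<union> bounds p2"
| "bounds (IF b p1 p2) = bounds p1 \<union> bounds p2"
| "bounds (FOR x a p) = insert a (bounds p)"

primrec wf_prog :: "prog \<Rightarrow> bool" where
  "wf_prog NOP \<longleftrightarrow> True"
| "wf_prog (IS a es e) \<longleftrightarrow> True"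
| "wf_prog (RS a es e) \<longleftrightarrow> True"
| "wf_prog (p1 ;;; p2) \<longleftrightarrow> wf_prog p1 \<and> wf_prog p2"
| "wf_prog (IF b p1 p2) \<longleftrightarrow> wf_prog p1 \<and> wf_prog p2"
| "wf_prog (FOR x a p) \<longleftrightarrow> wf_prog p \<and> x \<notin> iw p"

text \<open>Here \<open>\<beta>\<close> bounds all loop bounds at once. The nesting depth is fixed
  with the program, so this is polynomial in \<open>\<beta>\<close>.\<close>

primrec cost :: "nat \<Rightarrow> prog \<Rightarrow> nat" where
  "cost \<beta> NOP = 1"
| "cost \<beta> (IS a es e) = 1"
| "cost \<beta> (RS a es e) = 1"
| "cost \<beta> (p1 ;;; p2) = cost \<beta> p1 + cost \<beta> p2"
| "cost \<beta> (IF b p1 p2) = cost \<beta> p1 + cost \<beta> p2 + 1"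
| "cost \<beta> (FOR x a p) = \<beta> * (cost \<beta> p + 2) + 2"

definition same :: "string set \<Rightarrow> string set \<Rightarrow> state \<Rightarrow> state \<Rightarrow> bool" where
  "same X Y s s' \<longleftrightarrow> (\<forall>a. a \<notin> X \<longrightarrow> imem s' a = imem s a) \<and> (\<forall>a. a \<notin> Y \<longrightarrow> rmem s' a = rmem s a)"

lemma same_refl: "same X Y s s"
  by (simp add: same_def)

lemma same_trans: "same X Y s s' \<Longrightarrow> same X Y s' s'' \<Longrightarrow> same X Y s s''"
  by (simp add: same_def)

lemma same_mono: "same X Y s s' \<Longrightarrow> X \<subseteq> X' \<Longrightarrow> Y \<subseteq> Y' \<Longrightarrow> same X' Y' s s'"
  unfolding same_def by blast

lemma same_seti: "a \<in> X \<Longrightarrow> same X Y s (seti a js k s)"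
  by (auto simp: same_def imem_seti)

lemma same_imem: "same X Y s s' \<Longrightarrow> a \<notin> X \<Longrightarrow> imem s' a = imem s a"
  and same_rmem: "same X Y s s' \<Longrightarrow> a \<notin> Y \<Longrightarrow> rmem s' a = rmem s a"
  by (simp_all add: same_def)

lemma exec_same: "same (iw p) (rw p) s (exec n f p s)"
proof (induction p arbitrary: s)
  case (SQ p1 p2)
  have "same (iw p1 \<union> iw p2) (rw p1 \<union> rw p2) s (exec n f p1 s)"
    by (rule same_mono[OF SQ.IH(1)]) auto
  moreover have "same (iw p1 \<union> iw p2) (rw p1 \<union> rw p2) (exec n f p1 s) (exec n f p2 (exec n f p1 s))"
    by (rule same_mono[OF SQ.IH(2)]) auto
  ultimately show ?case by (auto intro: same_trans)
next
  case (IF b p1 p2)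
  show ?case
    using same_mono[OF IF.IH(1)[of s], of "iw p1 \<union> iw p2" "rw p1 \<union> rw p2"]
      same_mono[OF IF.IH(2)[of s], of "iw p1 \<union> iw p2" "rw p1 \<union> rw p2"] by simp
next
  case (FOR x a p)
  have "same (insert x (iw p)) (rw p) s (fold (\<lambda>i s. exec n f p (seti x [] i s)) is s)" for "is"
  proof (induction "is" arbitrary: s)
    case (Cons i is')
    have "same (insert x (iw p)) (rw p) s (seti x [] i s)" by (rule same_seti) simp
    moreover have "same (insert x (iw p)) (rw p) (seti x [] i s) (exec n f p (seti x [] i s))"
      by (rule same_mono[OF FOR.IH]) auto
    ultimately show ?case using Cons by (auto intro: same_trans)
  qed (simp add: same_refl)
  then show ?case by (auto simp: Let_def intro: same_trans same_seti)
qed (auto simp: same_def imem_seti rmem_setr)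

lemma exec_imem: "a \<notin> iw p \<Longrightarrow> imem (exec n f p s) a = imem s a"
  and exec_rmem: "a \<notin> rw p \<Longrightarrow> rmem (exec n f p s) a = rmem s a"
  using exec_same[of p s n f] by (auto simp: same_def)

text \<open>Invariant rule in which the frame information comes for free in each step. Stability is
  needed because the loop itself sets the counter between iterations and at the end.\<close>

lemma exec_FOR:
  assumes "rmem s a [] = real k" "x \<notin> iw p" "I 0 s"
    and step: "\<And>i s'. i < k \<Longrightarrow> same (insert x (iw p)) (rw p) s s' \<Longrightarrow> imem s' x [] = i \<Longrightarrow> I i s' \<Longrightarrow>
      I (Suc i) (exec n f p s')"
    and stable: "\<And>i s' k'. I i s' \<Longrightarrow> I i (seti x [] k' s')"
  shows "I k (exec n f (FOR x a p) s)"
proof -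
  have "same (insert x (iw p)) (rw p) s (fold (\<lambda>i s. exec n f p (seti x [] i s)) [0..<i] s)
      \<and> I i (fold (\<lambda>i s. exec n f p (seti x [] i s)) [0..<i] s)" if "i \<le> k" for i
    using that
  proof (induction i)
    case 0
    then show ?case by (simp add: assms(3) same_refl)
  next
    case (Suc i)
    define s1 where "s1 = fold (\<lambda>i s. exec n f p (seti x [] i s)) [0..<i] s"
    have IH: "same (insert x (iw p)) (rw p) s s1" "I i s1" using Suc by (simp_all add: s1_def)
    have sm: "same (insert x (iw p)) (rw p) s (seti x [] i s1)"
      using IH(1) by (auto intro: same_trans same_seti)
    moreover have "same (insert x (iw p)) (rw p) (seti x [] i s1) (exec n f p (seti x [] i s1))"
      by (rule same_mono[OF exec_same]) auto
    ultimately have "same (insert x (iw p)) (rw p) s (exec n f p (seti x [] i s1))" by (rule same_trans)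
    moreover have "I (Suc i) (exec n f p (seti x [] i s1))"
      using Suc.prems IH sm by (intro step stable) (auto simp: imem_seti)
    ultimately show ?case by (simp add: s1_def)
  qed
  then show ?thesis using assms(1) stable by (simp add: Let_def)
qed

text \<open>As no loop bound is ever written by the program, the bound \<open>\<beta>\<close>
  assumed on entry stays valid at every inner loop.\<close>

lemma comp_exec:
  assumes "wf_prog p" "bounds p \<inter> rw p = {}" "\<And>a. a \<in> bounds p \<Longrightarrow> rmem s a [] \<le> real \<beta>"
  shows "\<exists>k\<le>cost \<beta> p. big_step n f (compile p) s k (exec n f p s)"
  using assms
proof (induction p arbitrary: s)
  case NOP
  then show ?case using big_step.Skip by fastforce
next
  case (IS a es e)
  then show ?case using big_step.ISet[of n f a es e s] by (auto simp: seti_def)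
next
  case (RS a es e)
  then show ?case using big_step.RSet[of n f a es e s] by (auto simp: setr_def)
next
  case (SQ p1 p2)
  obtain k1 where k1: "k1 \<le> cost \<beta> p1" "big_step n f (compile p1) s k1 (exec n f p1 s)"
    using SQ.IH(1)[of s] SQ.prems by auto
  have "\<exists>k\<le>cost \<beta> p2. big_step n f (compile p2) (exec n f p1 s) k (exec n f p2 (exec n f p1 s))"
  proof (rule SQ.IH(2))
    fix a assume "a \<in> bounds p2"
    then show "rmem (exec n f p1 s) a [] \<le> real \<beta>"
      using SQ.prems by (subst exec_rmem) auto
  qed (use SQ.prems in auto)
  then obtain k2 where "k2 \<le> cost \<beta> p2" "big_step n f (compile p2) (exec n f p1 s) k2 (exec n f p2 (exec n f p1 s))"
    by blast
  then show ?case using k1 big_step.Seq by (intro exI[of _ "k1 + k2"]) auto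
next
  case (IF b p1 p2)
  show ?case
  proof (cases "bval n f s b")
    case True
    obtain k where "k \<le> cost \<beta> p1" "big_step n f (compile p1) s k (exec n f p1 s)"
      using IF.IH(1)[of s] IF.prems by auto
    then show ?thesis using True big_step.CondTrue by (intro exI[of _ "k + 1"]) auto
  next
    case False
    obtain k where "k \<le> cost \<beta> p2" "big_step n f (compile p2) s k (exec n f p2 s)"
      using IF.IH(2)[of s] IF.prems by auto
    then show ?thesis using False big_step.CondFalse by (intro exI[of _ "k + 1"]) auto
  qed
next
  case (FOR x a p)
  define k where "k = nat \<lceil>rmem s a []\<rceil>"
  \<comment> \<open>The ceiling counts the naturals below a real; a negative bound gives no
    iteration.\<close>
  have less: "real i < rmem s a [] \<longleftrightarrow> i < k" for i unfolding k_def by linarith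
  have k\<beta>: "k \<le> \<beta>" using FOR.prems(3)[of a] unfolding k_def by simp
  let ?body = "Seq (compile p) (ISet x [] (IAdd (IGet x []) (Nat 1)))"
  let ?W = "While (RLess (OfNat (IGet x [])) (RGet a [])) ?body"
  let ?F = "\<lambda>i s. exec n f p (seti x [] i s)"
  have loop: "\<exists>l\<le>(k - i) * (cost \<beta> p + 2) + 1. big_step n f ?W (seti x [] i s') l
      (seti x [] k (fold ?F [i..<k] s'))"
    if "i \<le> k" "same (insert x (iw p)) (rw p) s s'" for i s'
    using that
  proof (induction "k - i" arbitrary: i s')
    case 0
    then have "\<not> bval n f (seti x [] i s') (RLess (OfNat (IGet x [])) (RGet a []))"
      using FOR.prems(2) less[of i] by (auto simp: imem_seti same_def)
    from big_step.WhileFalse[OF this, of ?body] show ?case using 0 by auto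
  next
    case (Suc d)
    then have i: "i < k" by simp
    let ?s = "seti x [] i s'"
    have ra: "rmem s' y = rmem s y" if "y \<in> bounds (FOR x a p)" for y
      using FOR.prems(2) that Suc.prems(2) by (auto simp: same_def)
    then have guard: "bval n f ?s (RLess (OfNat (IGet x [])) (RGet a []))"
      using less[of i] i by (auto simp: imem_seti)
    have "\<exists>l\<le>cost \<beta> p. big_step n f (compile p) ?s l (?F i s')"
      by (rule FOR.IH) (use FOR.prems ra in auto)
    then obtain l1 where l1: "l1 \<le> cost \<beta> p" "big_step n f (compile p) ?s l1 (?F i s')" by blast
    have xi: "imem (?F i s') x [] = i" using FOR.prems(1) by (subst exec_imem) (auto simp: imem_seti)
    have "big_step n f (ISet x [] (IAdd (IGet x []) (Nat 1))) (?F i s') 1 (seti x [] (Suc i) (?F i s'))"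
      using big_step.ISet[of n f x "[]" "IAdd (IGet x []) (Nat 1)" "?F i s'"] xi by (simp add: seti_def)
    then have body: "big_step n f ?body ?s (l1 + 1) (seti x [] (Suc i) (?F i s'))"
      using l1(2) big_step.Seq by blast
    have "same (insert x (iw p)) (rw p) s' ?s" by (rule same_seti) simp
    moreover have "same (insert x (iw p)) (rw p) ?s (?F i s')"
      by (rule same_mono[OF exec_same]) auto
    ultimately have "same (insert x (iw p)) (rw p) s (?F i s')"
      using Suc.prems(2) by (blast intro: same_trans)
    then have "\<exists>l\<le>(k - Suc i) * (cost \<beta> p + 2) + 1. big_step n f ?W (seti x [] (Suc i) (?F i s')) l
      (seti x [] k (fold ?F [Suc i..<k] (?F i s')))"
      using Suc i by (intro Suc.hyps(1)) auto
    then obtain l2 where l2: "l2 \<le> (k - Suc i) * (cost \<beta> p + 2) + 1"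
      "big_step n f ?W (seti x [] (Suc i) (?F i s')) l2 (seti x [] k (fold ?F [Suc i..<k] (?F i s')))"
      by blast
    have "big_step n f ?W ?s ((l1 + 1) + l2 + 1) (seti x [] k (fold ?F [i..<k] s'))"
      using big_step.WhileTrue[OF guard body l2(2)] i by (simp add: upt_conv_Cons)
    moreover have "(l1 + 1) + l2 + 1 \<le> (k - i) * (cost \<beta> p + 2) + 1"
    proof -
      have "k - i = Suc (k - Suc i)" using i by simp
      then have "(k - i) * (cost \<beta> p + 2) = (cost \<beta> p + 2) + (k - Suc i) * (cost \<beta> p + 2)" by simp
      then show ?thesis using l1(1) l2(1) by linarith
    qed
    ultimately show ?case by blast
  qed
  obtain l where l: "l \<le> k * (cost \<beta> p + 2) + 1"
    "big_step n f ?W (seti x [] 0 s) l (seti x [] k (fold ?F [0..<k] s))"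
    using loop[of 0 s] same_refl[of _ _ s] by auto
  have "big_step n f (ISet x [] (Nat 0)) s 1 (seti x [] 0 s)"
    using big_step.ISet[of n f x "[]" "Nat 0" s] by (simp add: seti_def)
  from big_step.Seq[OF this l(2)]
  have "big_step n f (compile (FOR x a p)) s (1 + l) (exec n f (FOR x a p) s)"
    by (simp add: k_def Let_def)
  moreover have "k * (cost \<beta> p + 2) \<le> \<beta> * (cost \<beta> p + 2)" using k\<beta> by (rule mult_le_mono1)
  then have "1 + l \<le> cost \<beta> (FOR x a p)" using l(1) by simp
  ultimately show ?case by blast
qed

declare exec.simps(6) [simp del]

section \<open>The program and its correctness\<close>

text \<open>Memory layout: characteristic functions \<open>A\<close> of the guess, \<open>U\<close> of the usable elements, \<open>S\<close> of the
  current sample and \<open>Y\<close> of the chosen set; counters \<open>k\<close>, rows \<open>W\<close> and \<open>D\<close>, residuals \<open>z\<close>; \<open>q\<close> is the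
  position in the random bits. The flags say that the current guess is refuted (\<open>X\<close>), that a solution
  has been found (\<open>F\<close>), and that some guess was not refuted (\<open>Z\<close>). Loop bounds are real scalars.\<close>

abbreviation V :: "string \<Rightarrow> iexp" where
  "V x \<equiv> IGet x []"

section \<open>Subprograms for evaluation, sampling and marginals\<close>

definition p_sum :: "string \<Rightarrow> iexp list \<Rightarrow> string \<Rightarrow> string \<Rightarrow> rexp \<Rightarrow> prog" where
  "p_sum a ix x bnd e = RS a ix (Rat 0) ;;; FOR x bnd (RS a ix (RAdd (RGet a ix) e))"

text \<open>For the set stored in \<open>S\<close>, leaves the values \<open>G i\<close> in the
  array \<open>g\<close> and the packing loads in \<open>h\<close>; the last loop is the truncation
  at 1.\<close>

definition p_eval :: "nat \<Rightarrow> prog" where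
  "p_eval t =
    FOR ''i'' ''t'' (RS ''g'' [V ''i''] (RDiv (OracleVal (V ''i'') ''S'' []) (RGet ''v'' [V ''i'']))) ;;;
    FOR ''i'' ''c'' (p_sum ''g'' [IAdd (Nat t) (V ''i'')] ''j'' ''n''
      (RMul (OfNat (IGet ''S'' [V ''j''])) (RGet ''C'' [V ''i'', V ''j'']))) ;;;
    FOR ''i'' ''p'' (p_sum ''h'' [V ''i''] ''j'' ''n''
      (RMul (OfNat (IGet ''S'' [V ''j''])) (RGet ''P'' [V ''i'', V ''j'']))) ;;;
    FOR ''i'' ''tc'' (IF (RLess (Rat 1) (RGet ''g'' [V ''i''])) (RS ''g'' [V ''i''] (Rat 1)) NOP)"

definition p_sample :: prog where
  "p_sample = FOR ''j'' ''n'' (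
     IS ''u'' [] (Nat 0) ;;;
     FOR ''b'' ''b'' (
       IS ''u'' [] (IAdd (IAdd (V ''u'') (V ''u'')) (IGet ''bits'' [V ''q''])) ;;;
       IS ''q'' [] (IAdd (V ''q'') (Nat 1))) ;;;
     IF (ILess (V ''u'') (IGet ''k'' [V ''j''])) (IS ''S'' [V ''j''] (Nat 1))
       (IS ''S'' [V ''j''] (IGet ''A'' [V ''j''])))"

text \<open>Each element is inserted into \<open>S\<close> for one evaluation and then restored from
  \<open>o\<close>, so elements already present correctly get marginal 0.\<close>

definition p_marg :: "nat \<Rightarrow> prog" where
  "p_marg t =
    p_eval t ;;;
    FOR ''i'' ''tc'' (RS ''a'' [V ''i''] (RGet ''g'' [V ''i''])) ;;;
    FOR ''m'' ''n'' (
      IS ''o'' [] (IGet ''S'' [V ''m'']) ;;;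
      IS ''S'' [V ''m''] (Nat 1) ;;;
      p_eval t ;;;
      FOR ''i'' ''tc'' (RS ''d'' [V ''i'', V ''m''] (RSub (RGet ''g'' [V ''i'']) (RGet ''a'' [V ''i'']))) ;;;
      IS ''S'' [V ''m''] (V ''o''))"

lemma p_sum_sets [simp]:
  "iw (p_sum a ix x bnd e) = {x}" "rw (p_sum a ix x bnd e) = {a}"
  "bounds (p_sum a ix x bnd e) = {bnd}" "wf_prog (p_sum a ix x bnd e)"
  by (simp_all add: p_sum_def)

lemma p_eval_sets [simp]:
  "iw (p_eval t) = {''i'', ''j''}" "rw (p_eval t) = {''g'', ''h''}"
  "bounds (p_eval t) = {''t'', ''c'', ''p'', ''n'', ''tc''}" "wf_prog (p_eval t)"
  by (auto simp: p_eval_def)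

lemma p_sample_sets [simp]:
  "iw p_sample = {''j'', ''u'', ''b'', ''q'', ''S''}" "rw p_sample = {}"
  "bounds p_sample = {''n'', ''b''}" "wf_prog p_sample"
  by (auto simp: p_sample_def)

lemma p_marg_sets [simp]:
  "iw (p_marg t) = {''i'', ''j'', ''m'', ''o'', ''S''}" "rw (p_marg t) = {''g'', ''h'', ''a'', ''d''}"
  "bounds (p_marg t) = {''t'', ''c'', ''p'', ''n'', ''tc''}" "wf_prog (p_marg t)"
  by (auto simp: p_marg_def)

lemma ival_cong: "imem s = imem s' \<Longrightarrow> ival s e = ival s' e"
  by (induction e) (auto cong: map_cong)

lemma ival_setr [simp]: "ival (setr a js y s) e = ival s e"
  by (rule ival_cong) simp

lemma map_ival_setr [simp]: "map (ival (setr a js y s)) es = map (ival s) es"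
  by simp

lemma set_simps:
  "setr a js y (setr a js y' s) = setr a js y s"
  "seti x ks k (seti x ks k' s) = seti x ks k s"
  "seti x ks k (setr a js y s) = setr a js y (seti x ks k s)"
  by (simp_all add: seti_def setr_def)

lemma exec_sum:
  assumes "rmem s bnd [] = real k" "bnd \<noteq> a"
    and e: "\<And>js y s. rval n f (setr a js y s) e = rval n f s e"
    and ix: "\<And>k s. map (ival (seti x [] k s)) ix = map (ival s) ix"
  shows "exec n f (p_sum a ix x bnd e) s
    = setr a (map (ival s) ix) (\<Sum>j<k. rval n f (seti x [] j s) e) (seti x [] k s)"
proof -
  let ?js = "map (ival s) ix"
  let ?S = "\<lambda>i l. setr a ?js (\<Sum>j<i. rval n f (seti x [] j s) e) (seti x [] l s)"
  let ?p = "RS a ix (RAdd (RGet a ix) e)"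
  \<comment> \<open>After \<open>i\<close> iterations the counter holds \<open>i - 1\<close>, and it
    has not been written at all for \<open>i = 0\<close>; only the end of the loop sets it to the
    bound.\<close>
  have "fold (\<lambda>i s. exec n f ?p (seti x [] i s)) [0..<i] (setr a ?js 0 s)
      = (if i = 0 then setr a ?js 0 s else ?S i (i - 1))" for i
  proof (induction i)
    case (Suc i)
    have "exec n f ?p (seti x [] i (if i = 0 then setr a ?js 0 s else ?S i (i - 1))) = ?S (Suc i) i"
      using e[of ?js] by (simp add: set_simps ix rmem_setr)
    then show ?case using Suc by simp
  qed simp
  then show ?thesis
    using assms(1,2) by (auto simp: p_sum_def exec.simps(6) Let_def rmem_setr set_simps)
qed

text \<open>Real arrays that are fixed once the parameters have been computed. Subprograms that
  avoid writing them preserve \<open>stat\<close>.\<close>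

definition static_reals :: "string set" where
  "static_reals = {''n'', ''nn'', ''t'', ''c'', ''p'', ''tc'', ''M'', ''b'', ''m'', ''T'', ''K'', ''N'',
     ''v'', ''P'', ''C''}"

context inst
begin

definition stat :: "bool list \<Rightarrow> state \<Rightarrow> bool" where
  "stat bs s \<longleftrightarrow> (\<forall>k. imem s ''bits'' [k] = of_bool (k < length bs \<and> bs ! k)) \<and>
     rmem s ''n'' [] = real n \<and> rmem s ''nn'' [] = real (n + 1) \<and> rmem s ''t'' [] = real t \<and>
     rmem s ''c'' [] = real c \<and> rmem s ''p'' [] = real p \<and> rmem s ''tc'' [] = real (t + c) \<and>
     rmem s ''M'' [] = real M \<and> rmem s ''b'' [] = real b \<and> rmem s ''m'' [] = real m \<and>
     rmem s ''T'' [] = real N0 \<and> rmem s ''K'' [] = real reps \<and> rmem s ''N'' [] = 2 ^ b \<and>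
     (\<forall>i<t. rmem s ''v'' [i] = v $ i) \<and> (\<forall>q<p. \<forall>j<n. rmem s ''P'' [q, j] = P $$ (q, j)) \<and>
     (\<forall>q<c. \<forall>j<n. rmem s ''C'' [q, j] = C $$ (q, j))"

lemma stat_same:
  "stat bs s \<Longrightarrow> same X Y s s' \<Longrightarrow> ''bits'' \<notin> X \<Longrightarrow> Y \<inter> static_reals = {} \<Longrightarrow> stat bs s'"
proof -
  assume a: "stat bs s" "same X Y s s'" "''bits'' \<notin> X" "Y \<inter> static_reals = {}"
  have "rmem s' x = rmem s x" if "x \<in> static_reals" for x
    using a(2,4) that by (intro same_rmem) auto
  moreover have "imem s' ''bits'' = imem s ''bits''" using a(2,3) by (rule same_imem)
  ultimately show ?thesis using a(1) unfolding stat_def static_reals_def by simp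
qed

lemma stat_exec:
  "stat bs s \<Longrightarrow> ''bits'' \<notin> iw p' \<Longrightarrow> rw p' \<inter> static_reals = {} \<Longrightarrow> stat bs (exec n f p' s)"
  using stat_same exec_same by blast

lemma stat_simps:
  assumes "stat bs s"
  shows "rmem s ''n'' [] = real n" "rmem s ''nn'' [] = real (n + 1)" "rmem s ''t'' [] = real t"
    "rmem s ''c'' [] = real c" "rmem s ''p'' [] = real p" "rmem s ''tc'' [] = real (t + c)"
    "rmem s ''M'' [] = real M" "rmem s ''b'' [] = real b" "rmem s ''m'' [] = real m"
    "rmem s ''T'' [] = real N0" "rmem s ''K'' [] = real reps" "rmem s ''N'' [] = 2 ^ b"
    "i < t \<Longrightarrow> rmem s ''v'' [i] = v $ i" "q < p \<Longrightarrow> j < n \<Longrightarrow> rmem s ''P'' [q, j] = P $$ (q, j)"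
    "q < c \<Longrightarrow> j < n \<Longrightarrow> rmem s ''C'' [q, j] = C $$ (q, j)"
    "imem s ''bits'' [k] = of_bool (k < length bs \<and> bs ! k)"
  using assms unfolding stat_def by blast+

definition brep :: "state \<Rightarrow> string \<Rightarrow> nat set \<Rightarrow> bool" where
  "brep s a S \<longleftrightarrow> (\<forall>j<n. imem s a [j] = of_bool (j \<in> S))"

lemma brep_cong: "imem s' a = imem s a \<Longrightarrow> brep s' a S \<longleftrightarrow> brep s a S"
  by (simp add: brep_def)

lemma brep_sum:
  assumes "brep s a S"
  shows "(\<Sum>j<n. real (imem s a [j]) * x j) = modular n x S"
proof -
  have "(\<Sum>j<n. real (imem s a [j]) * x j) = (\<Sum>j<n. if j \<in> S then x j else 0)"
    using assms by (intro sum.cong) (auto simp: brep_def)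
  also have "\<dots> = modular n x S"
    unfolding modular_def by (subst sum.inter_restrict[symmetric]) (auto simp: Int_commute)
  finally show ?thesis .
qed

lemma exec_eval:
  assumes st: "stat bs s" and S: "brep s ''S'' S"
  defines "s' \<equiv> exec n f (p_eval t) s"
  shows "\<And>i. i < t + c \<Longrightarrow> rmem s' ''g'' [i] = G i S" "\<And>q. q < p \<Longrightarrow> rmem s' ''h'' [q] = load q S"
proof -
  define F1 where "F1 = FOR ''i'' ''t'' (RS ''g'' [V ''i''] (RDiv (OracleVal (V ''i'') ''S'' []) (RGet ''v'' [V ''i''])))"
  define B2 where "B2 = p_sum ''g'' [IAdd (Nat t) (V ''i'')] ''j'' ''n''
      (RMul (OfNat (IGet ''S'' [V ''j''])) (RGet ''C'' [V ''i'', V ''j'']))"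
  define B3 where "B3 = p_sum ''h'' [V ''i''] ''j'' ''n''
      (RMul (OfNat (IGet ''S'' [V ''j''])) (RGet ''P'' [V ''i'', V ''j'']))"
  define B4 where "B4 = IF (RLess (Rat 1) (RGet ''g'' [V ''i''])) (RS ''g'' [V ''i''] (Rat 1)) NOP"
  define s1 where "s1 = exec n f F1 s"
  define s2 where "s2 = exec n f (FOR ''i'' ''c'' B2) s1"
  define s3 where "s3 = exec n f (FOR ''i'' ''p'' B3) s2"
  have s': "s' = exec n f (FOR ''i'' ''tc'' B4) s3"
    by (simp only: s'_def p_eval_def exec.simps(4) F1_def B2_def B3_def B4_def s1_def s2_def s3_def)
  have st1: "stat bs s1" unfolding s1_def by (rule stat_exec[OF st]) (auto simp: F1_def static_reals_def)
  have st2: "stat bs s2" unfolding s2_def by (rule stat_exec[OF st1]) (auto simp: B2_def static_reals_def)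
  have st3: "stat bs s3" unfolding s3_def by (rule stat_exec[OF st2]) (auto simp: B3_def static_reals_def)
  have S1: "imem s1 ''S'' = imem s ''S''" unfolding s1_def by (rule exec_imem) (simp add: F1_def)
  have S2: "imem s2 ''S'' = imem s ''S''" unfolding s2_def S1[symmetric] by (rule exec_imem) (simp add: B2_def)
  define x where "x i = (if i < t then f i (S \<inter> {..<n}) / v $ i
    else modular n (\<lambda>j. C $$ (i - t, j)) S)" for i
  have 1: "\<forall>i<t. rmem s1 ''g'' [i] = x i"
    unfolding s1_def F1_def
  proof (rule exec_FOR[where I = "\<lambda>i s'. \<forall>l<i. rmem s' ''g'' [l] = x l"])
    fix i s' assume i: "i < t" "imem s' ''i'' [] = i" "\<forall>l<i. rmem s' ''g'' [l] = x l"
      and sm: "same (insert ''i'' (iw (RS ''g'' [V ''i''] (RDiv (OracleVal (V ''i'') ''S'' []) (RGet ''v'' [V ''i''])))))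
         (rw (RS ''g'' [V ''i''] (RDiv (OracleVal (V ''i'') ''S'' []) (RGet ''v'' [V ''i''])))) s s'"
    have st': "stat bs s'" by (rule stat_same[OF st sm]) (auto simp: static_reals_def)
    have "imem s' ''S'' = imem s ''S''" by (rule same_imem[OF sm]) simp
    then have "{j. j < n \<and> 0 < imem s' ''S'' [j]} = S \<inter> {..<n}"
      using S by (auto simp: brep_def)
    then show "\<forall>l<Suc i. rmem (exec n f (RS ''g'' [V ''i'']
        (RDiv (OracleVal (V ''i'') ''S'' []) (RGet ''v'' [V ''i'']))) s') ''g'' [l] = x l"
      using i by (simp add: rmem_setr stat_simps[OF st'] less_Suc_eq x_def)
  qed (use stat_simps[OF st] in auto)
  have 2: "\<forall>i<t. rmem s2 ''g'' [i] = x i" "\<forall>i<c. rmem s2 ''g'' [t + i] = x (t + i)"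
  proof -
    have "(\<forall>i<t. rmem s2 ''g'' [i] = x i) \<and> (\<forall>i<c. rmem s2 ''g'' [t + i] = x (t + i))"
      unfolding s2_def
    proof (rule exec_FOR[where I = "\<lambda>i s'. (\<forall>i<t. rmem s' ''g'' [i] = x i) \<and> (\<forall>l<i. rmem s' ''g'' [t + l] = x (t + l))"])
      fix i s' assume i: "i < c" "imem s' ''i'' [] = i"
        and I: "(\<forall>i<t. rmem s' ''g'' [i] = x i) \<and> (\<forall>l<i. rmem s' ''g'' [t + l] = x (t + l))"
        and sm: "same (insert ''i'' (iw B2)) (rw B2) s1 s'"
      have st': "stat bs s'" by (rule stat_same[OF st1 sm]) (auto simp: B2_def static_reals_def)
      have S': "imem s' ''S'' = imem s ''S''" unfolding S1[symmetric] by (rule same_imem[OF sm]) (simp add: B2_def)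
      have "exec n f B2 s' = setr ''g'' [t + i] (\<Sum>j<n. real (imem s ''S'' [j]) * C $$ (i, j)) (seti ''j'' [] n s')"
        unfolding B2_def
        by (subst exec_sum) (use i S' in \<open>auto simp: stat_simps[OF st'] imem_seti rmem_setr\<close>)
      also have "(\<Sum>j<n. real (imem s ''S'' [j]) * C $$ (i, j)) = x (t + i)"
        by (simp add: brep_sum[OF S] x_def)
      finally show "(\<forall>i<t. rmem (exec n f B2 s') ''g'' [i] = x i)
          \<and> (\<forall>l<Suc i. rmem (exec n f B2 s') ''g'' [t + l] = x (t + l))"
        using I by (auto simp: rmem_setr less_Suc_eq)
    qed (use stat_simps[OF st1] 1 in \<open>auto simp: B2_def\<close>)
    then show "\<forall>i<t. rmem s2 ''g'' [i] = x i" "\<forall>i<c. rmem s2 ''g'' [t + i] = x (t + i)" by auto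
  qed
  have 3: "\<forall>q<p. rmem s3 ''h'' [q] = load q S"
    unfolding s3_def
  proof (rule exec_FOR[where I = "\<lambda>i s'. \<forall>l<i. rmem s' ''h'' [l] = load l S"])
    fix i s' assume i: "i < p" "imem s' ''i'' [] = i" and I: "\<forall>l<i. rmem s' ''h'' [l] = load l S"
      and sm: "same (insert ''i'' (iw B3)) (rw B3) s2 s'"
    have st': "stat bs s'" by (rule stat_same[OF st2 sm]) (auto simp: B3_def static_reals_def)
    have S': "imem s' ''S'' = imem s ''S''" unfolding S2[symmetric] by (rule same_imem[OF sm]) (simp add: B3_def)
    have "exec n f B3 s' = setr ''h'' [i] (\<Sum>j<n. real (imem s ''S'' [j]) * P $$ (i, j)) (seti ''j'' [] n s')"
      unfolding B3_def
      by (subst exec_sum) (use i S' in \<open>auto simp: stat_simps[OF st'] imem_seti rmem_setr\<close>)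
    also have "(\<Sum>j<n. real (imem s ''S'' [j]) * P $$ (i, j)) = load i S"
      by (simp add: brep_sum[OF S] load_def)
    finally show "\<forall>l<Suc i. rmem (exec n f B3 s') ''h'' [l] = load l S"
      using I by (auto simp: rmem_setr less_Suc_eq)
  qed (use stat_simps[OF st2] in \<open>auto simp: B3_def\<close>)
  have g3: "rmem s3 ''g'' = rmem s2 ''g''" unfolding s3_def by (rule exec_rmem) (simp add: B3_def)
  have x: "rmem s3 ''g'' [i] = x i" if "i < t + c" for i
  proof (cases "i < t")
    case False
    then have "i - t < c" "i = t + (i - t)" using that by auto
    then show ?thesis using 2(2) g3 by metis
  qed (use 2(1) g3 in simp)
  have h4: "rmem s' ''h'' = rmem s3 ''h''" unfolding s' by (rule exec_rmem) (simp add: B4_def)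
  show "rmem s' ''h'' [q] = load q S" if "q < p" for q using 3 that h4 by simp
  have "\<forall>i<t + c. rmem s' ''g'' [i] = (if i < t + c then min 1 (x i) else x i)"
    unfolding s'
  proof (rule exec_FOR[where I = "\<lambda>i s'. \<forall>l<t + c. rmem s' ''g'' [l] = (if l < i then min 1 (x l) else x l)"])
    fix i and s' :: state assume i: "i < t + c" "imem s' ''i'' [] = i"
      and I: "\<forall>l<t + c. rmem s' ''g'' [l] = (if l < i then min 1 (x l) else x l)"
    then show "\<forall>l<t + c. rmem (exec n f B4 s') ''g'' [l] = (if l < Suc i then min 1 (x l) else x l)"
      by (auto simp: B4_def rmem_setr less_Suc_eq)
  qed (use stat_simps[OF st3] x in \<open>auto simp: B4_def\<close>)
  then show "rmem s' ''g'' [i] = G i S" if "i < t + c" for i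
    using that by (simp add: G_def x_def)
qed

end

text \<open>The expression may read the old value of the cell being written, so updates in place are
  included; injectivity of the index guarantees that no earlier iteration has changed that
  cell.\<close>

lemma exec_map:
  assumes bnd: "rmem s bnd [] = real k"
    and ev: "\<And>s' i. i < k \<Longrightarrow> same {x} {a} s s' \<Longrightarrow> imem s' x [] = i \<Longrightarrow> rmem s' a (ix i) = rmem s a (ix i) \<Longrightarrow>
      rval n f s' e = val i"
    and es: "\<And>s' i. i < k \<Longrightarrow> same {x} {a} s s' \<Longrightarrow> imem s' x [] = i \<Longrightarrow> map (ival s') es = ix i"
    and inj: "inj_on ix {..<k}"
  shows "\<And>j. j < k \<Longrightarrow> rmem (exec n f (FOR x bnd (RS a es e)) s) a (ix j) = val j"
    and "\<And>js. js \<notin> ix ` {..<k} \<Longrightarrow> rmem (exec n f (FOR x bnd (RS a es e)) s) a js = rmem s a js"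
proof -
  define I where "I i s' \<longleftrightarrow> (\<forall>j<i. rmem s' a (ix j) = val j) \<and> (\<forall>js. js \<notin> ix ` {..<i} \<longrightarrow> rmem s' a js = rmem s a js)"
    for i and s' :: state
  have "I k (exec n f (FOR x bnd (RS a es e)) s)"
  proof (rule exec_FOR)
    fix i s' assume i: "i < k" "imem s' x [] = i" "I i s'"
      and sm: "same (insert x (iw (RS a es e))) (rw (RS a es e)) s s'"
    then have sm: "same {x} {a} s s'" by simp
    have ne: "ix j \<noteq> ix i" if "j < i" for j using inj_onD[OF inj, of j i] that i(1) by auto
    have "rmem s' a (ix i) = rmem s a (ix i)" using i(3) ne unfolding I_def by (metis imageE lessThan_iff)
    then have "rval n f s' e = val i" by (rule ev[OF i(1) sm i(2)])
    then have ex: "exec n f (RS a es e) s' = setr a (ix i) (val i) s'"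
      by (simp only: exec.simps es[OF i(1) sm i(2)])
    show "I (Suc i) (exec n f (RS a es e) s')"
      unfolding ex I_def
    proof (intro conjI allI impI)
      fix j assume "j < Suc i"
      then show "rmem (setr a (ix i) (val i) s') a (ix j) = val j"
        using i(3) ne[of j] by (auto simp: I_def rmem_setr less_Suc_eq)
    next
      fix js assume "js \<notin> ix ` {..<Suc i}"
      then show "rmem (setr a (ix i) (val i) s') a js = rmem s a js"
        using i(3) by (auto simp: I_def rmem_setr lessThan_Suc)
    qed
  qed (use bnd in \<open>auto simp: I_def\<close>)
  then show "\<And>j. j < k \<Longrightarrow> rmem (exec n f (FOR x bnd (RS a es e)) s) a (ix j) = val j"
    "\<And>js. js \<notin> ix ` {..<k} \<Longrightarrow> rmem (exec n f (FOR x bnd (RS a es e)) s) a js = rmem s a js"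
    unfolding I_def by blast+
qed

lemma exec_map2:
  assumes bnd: "rmem s bnd [] = real k" "rmem s bnd' [] = real k'" "bnd' \<noteq> a" and xy: "x \<noteq> y"
    and ev: "\<And>s' i j. i < k \<Longrightarrow> j < k' \<Longrightarrow> same {x, y} {a} s s' \<Longrightarrow> imem s' x [] = i \<Longrightarrow> imem s' y [] = j \<Longrightarrow>
      rmem s' a (ix i j) = rmem s a (ix i j) \<Longrightarrow> rval n f s' e = val i j"
    and es: "\<And>s' i j. i < k \<Longrightarrow> j < k' \<Longrightarrow> same {x, y} {a} s s' \<Longrightarrow> imem s' x [] = i \<Longrightarrow> imem s' y [] = j \<Longrightarrow>
      map (ival s') es = ix i j"
    and inj: "\<And>i j i' j'. ix i j = ix i' j' \<Longrightarrow> i = i' \<and> j = j'"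
  shows "\<And>i j. i < k \<Longrightarrow> j < k' \<Longrightarrow> rmem (exec n f (FOR x bnd (FOR y bnd' (RS a es e))) s) a (ix i j) = val i j"
    and "\<And>js. (\<And>i j. i < k \<Longrightarrow> j < k' \<Longrightarrow> js \<noteq> ix i j) \<Longrightarrow>
      rmem (exec n f (FOR x bnd (FOR y bnd' (RS a es e))) s) a js = rmem s a js"
proof -
  let ?F = "FOR y bnd' (RS a es e)"
  define I where "I i s' \<longleftrightarrow> (\<forall>i'<i. \<forall>j<k'. rmem s' a (ix i' j) = val i' j)
      \<and> (\<forall>js. (\<forall>i'<i. \<forall>j<k'. js \<noteq> ix i' j) \<longrightarrow> rmem s' a js = rmem s a js)" for i and s' :: state
  have "I k (exec n f (FOR x bnd ?F) s)"
  proof (rule exec_FOR)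
    fix i s' assume i: "i < k" "imem s' x [] = i" "I i s'"
      and sm: "same (insert x (iw ?F)) (rw ?F) s s'"
    then have sm: "same {x, y} {a} s s'" by simp
    have old: "rmem s' a (ix i j) = rmem s a (ix i j)" for j
      using i(3) inj[of i j] unfolding I_def by (metis less_irrefl)
    have sm': "same {x, y} {a} s s''" "imem s'' x [] = i" if "same {y} {a} s' s''" for s''
      using sm that i(2) xy by (auto simp: same_def)
    have b': "rmem s' bnd' [] = real k'" using sm bnd(2,3) by (simp add: same_def)
    have 1: "rmem (exec n f ?F s') a (ix i j) = val i j" if "j < k'" for j
    proof (rule exec_map(1)[OF b', where ix = "ix i"])
      fix s'' j assume "j < k'" "same {y} {a} s' s''" "imem s'' y [] = j" "rmem s'' a (ix i j) = rmem s' a (ix i j)"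
      then show "rval n f s'' e = val i j" using ev[OF i(1) _ sm'(1)] sm' old by simp
    next
      fix s'' j assume "j < k'" "same {y} {a} s' s''" "imem s'' y [] = j"
      then show "map (ival s'') es = ix i j" using es[OF i(1) _ sm'(1)] sm' by simp
    qed (use that inj in \<open>auto simp: inj_on_def\<close>)
    have 2: "rmem (exec n f ?F s') a js = rmem s' a js" if "\<And>j. j < k' \<Longrightarrow> js \<noteq> ix i j" for js
    proof (rule exec_map(2)[OF b', where ix = "ix i"])
      fix s'' j assume "j < k'" "same {y} {a} s' s''" "imem s'' y [] = j" "rmem s'' a (ix i j) = rmem s' a (ix i j)"
      then show "rval n f s'' e = val i j" using ev[OF i(1) _ sm'(1)] sm' old by simp
    next
      fix s'' j assume "j < k'" "same {y} {a} s' s''" "imem s'' y [] = j"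
      then show "map (ival s'') es = ix i j" using es[OF i(1) _ sm'(1)] sm' by simp
    qed (use that inj in \<open>auto simp: inj_on_def\<close>)
    show "I (Suc i) (exec n f ?F s')"
      unfolding I_def
    proof (intro conjI allI impI)
      fix i' j assume "i' < Suc i" "j < k'"
      then show "rmem (exec n f ?F s') a (ix i' j) = val i' j"
        using 1[of j] 2[of "ix i' j"] i(3) inj[of i' j] by (cases "i' = i") (auto simp: I_def)
    next
      fix js assume "\<forall>i'<Suc i. \<forall>j<k'. js \<noteq> ix i' j"
      then show "rmem (exec n f ?F s') a js = rmem s a js"
        using 2[of js] i(3) by (auto simp: I_def)
    qed
  qed (use bnd xy in \<open>auto simp: I_def\<close>)
  then show "\<And>i j. i < k \<Longrightarrow> j < k' \<Longrightarrow> rmem (exec n f (FOR x bnd ?F) s) a (ix i j) = val i j"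
    "\<And>js. (\<And>i j. i < k \<Longrightarrow> j < k' \<Longrightarrow> js \<noteq> ix i j) \<Longrightarrow> rmem (exec n f (FOR x bnd ?F) s) a js = rmem s a js"
    unfolding I_def by blast+
qed

lemma exec_imap:
  assumes bnd: "rmem s bnd [] = real k" and xa: "x \<noteq> a"
    and ev: "\<And>s' i. i < k \<Longrightarrow> same {x, a} {} s s' \<Longrightarrow> imem s' x [] = i \<Longrightarrow> imem s' a [i] = imem s a [i] \<Longrightarrow>
      ival s' e = val i"
  shows "\<And>j. j < k \<Longrightarrow> imem (exec n f (FOR x bnd (IS a [V x] e)) s) a [j] = val j"
proof -
  define I where "I i s' \<longleftrightarrow> (\<forall>j<i. imem s' a [j] = val j) \<and> (\<forall>j\<ge>i. imem s' a [j] = imem s a [j])"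
    for i and s' :: state
  have "I k (exec n f (FOR x bnd (IS a [V x] e)) s)"
  proof (rule exec_FOR)
    fix i s' assume i: "i < k" "imem s' x [] = i" "I i s'"
      and sm: "same (insert x (iw (IS a [V x] e))) (rw (IS a [V x] e)) s s'"
    then have sm: "same {x, a} {} s s'" by simp
    have "ival s' e = val i" by (rule ev[OF i(1) sm i(2)]) (use i(3) in \<open>simp add: I_def\<close>)
    then show "I (Suc i) (exec n f (IS a [V x] e) s')"
      using i by (auto simp: I_def imem_seti less_Suc_eq)
  qed (use bnd xa in \<open>auto simp: I_def imem_seti\<close>)
  then show "\<And>j. j < k \<Longrightarrow> imem (exec n f (FOR x bnd (IS a [V x] e)) s) a [j] = val j"
    unfolding I_def by blast
qed

text \<open>Translates between the blocks of the analysis and the running position in the bits kept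
  by the program.\<close>

lemma blk_take_drop:
  assumes "l < m" shows "blk k l (take (m * k) (drop q bs)) = take k (drop (q + l * k) bs)"
proof -
  have "l * k + k \<le> m * k" using assms by (metis Suc_leI add.commute mult_Suc mult_le_mono1)
  then show ?thesis by (simp add: blk_def drop_take add.commute[of q] min_def)
qed

context inst
begin

lemma exec_sample:
  assumes st: "stat bs s" and A: "brep s ''A'' A" and d: "\<And>j. j < n \<Longrightarrow> imem s ''k'' [j] = d j"
    and q: "imem s ''q'' [] = q0" "q0 + n * b \<le> length bs"
  defines "s' \<equiv> exec n f p_sample s"
  shows "brep s' ''S'' (A \<union> thr n b d (take (n * b) (drop q0 bs)))" "imem s' ''q'' [] = q0 + n * b"
proof -
  define B where "B = IS ''u'' [] (IAdd (IAdd (V ''u'') (V ''u'')) (IGet ''bits'' [V ''q''])) ;;;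
       IS ''q'' [] (IAdd (V ''q'') (Nat 1))"
  define Bj where "Bj = IS ''u'' [] (Nat 0) ;;; FOR ''b'' ''b'' B ;;;
     IF (ILess (V ''u'') (IGet ''k'' [V ''j''])) (IS ''S'' [V ''j''] (Nat 1))
       (IS ''S'' [V ''j''] (IGet ''A'' [V ''j'']))"
  let ?R = "A \<union> thr n b d (take (n * b) (drop q0 bs))"
  define I where "I i s' \<longleftrightarrow> imem s' ''q'' [] = q0 + i * b \<and> (\<forall>j<i. imem s' ''S'' [j] = of_bool (j \<in> ?R))" for i and s' :: state
  have "I n s'"
    unfolding s'_def p_sample_def B_def[symmetric] Bj_def[symmetric]
  proof (rule exec_FOR)
    show "I 0 s" using q by (simp add: I_def)
  next
    fix j s1 assume j: "j < n" "imem s1 ''j'' [] = j" "I j s1"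
      and sm: "same (insert ''j'' (iw Bj)) (rw Bj) s s1"
    have st1: "stat bs s1" by (rule stat_same[OF st sm]) (auto simp: B_def Bj_def static_reals_def)
    define s2 where "s2 = seti ''u'' [] 0 s1"
    have st2: "stat bs s2" using st1 by (rule stat_same) (auto simp: s2_def intro: same_seti)
    define s3 where "s3 = exec n f (FOR ''b'' ''b'' B) s2"
    have qb: "q0 + j * b + b \<le> length bs"
    proof -
      have "j * b + b \<le> n * b" using j(1) by (metis Suc_leI add.commute mult_Suc mult_le_mono1)
      then show ?thesis using q(2) by simp
    qed
    have s3: "imem s3 ''q'' [] = q0 + j * b + b \<and> imem s3 ''u'' [] = num (take b (drop (q0 + j * b) bs))"
      unfolding s3_def
    proof (rule exec_FOR[where I = "\<lambda>i s'. imem s' ''q'' [] = q0 + j * b + i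
          \<and> imem s' ''u'' [] = num (take i (drop (q0 + j * b) bs))"])
      show "imem s2 ''q'' [] = q0 + j * b + 0 \<and> imem s2 ''u'' [] = num (take 0 (drop (q0 + j * b) bs))"
        using j(3) by (simp add: s2_def I_def imem_seti)
    next
      fix i s4 assume i: "i < b" "imem s4 ''q'' [] = q0 + j * b + i
          \<and> imem s4 ''u'' [] = num (take i (drop (q0 + j * b) bs))"
        and sm4: "same (insert ''b'' (iw B)) (rw B) s2 s4"
      have st4: "stat bs s4" by (rule stat_same[OF st2 sm4]) (auto simp: B_def static_reals_def)
      have "take (Suc i) (drop (q0 + j * b) bs) = take i (drop (q0 + j * b) bs) @ [bs ! (q0 + j * b + i)]"
        using i(1) qb by (subst take_Suc_conv_app_nth) (auto simp: nth_drop)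
      then show "imem (exec n f B s4) ''q'' [] = q0 + j * b + Suc i
          \<and> imem (exec n f B s4) ''u'' [] = num (take (Suc i) (drop (q0 + j * b) bs))"
        using i qb by (simp add: B_def imem_seti stat_simps[OF st4])
    qed (auto simp: imem_seti stat_simps[OF st2] B_def)
    have fr: "imem s3 a = imem s1 a" if "a \<notin> {''u'', ''q'', ''b''}" for a
      unfolding s3_def using that by (subst exec_imem) (auto simp: B_def s2_def imem_seti)
    have k: "imem s3 ''k'' [j] = d j" "imem s3 ''A'' [j] = of_bool (j \<in> A)"
      using fr[of "''k''"] fr[of "''A''"] same_imem[OF sm, of "''k''"] same_imem[OF sm, of "''A''"] d[OF j(1)] A j(1)
      by (auto simp: Bj_def B_def brep_def)
    have S3: "imem s3 ''S'' = imem s1 ''S''" "imem s3 ''j'' [] = j" using fr j(2) by auto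
    have R: "j \<in> ?R \<longleftrightarrow> num (take b (drop (q0 + j * b) bs)) < d j \<or> j \<in> A"
      using j(1) blk_take_drop[of j n b q0 bs] by (auto simp: thr_def)
    have "exec n f Bj s1 = seti ''S'' [j] (of_bool (j \<in> ?R)) s3"
      unfolding R using s3 k S3 by (simp add: Bj_def s2_def[symmetric] s3_def[symmetric])
    then show "I (Suc j) (exec n f Bj s1)"
      using j(3) s3 S3 by (auto simp: I_def imem_seti less_Suc_eq)
  qed (auto simp: stat_simps[OF st] Bj_def B_def I_def imem_seti)
  then show "brep s' ''S'' ?R" "imem s' ''q'' [] = q0 + n * b" by (auto simp: I_def brep_def)
qed

lemma exec_marg:
  assumes st: "stat bs s" and S: "brep s ''S'' S"
  defines "s' \<equiv> exec n f (p_marg t) s"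
  shows "\<And>i. i < t + c \<Longrightarrow> rmem s' ''a'' [i] = G i S"
    "\<And>i j. i < t + c \<Longrightarrow> j < n \<Longrightarrow> rmem s' ''d'' [i, j] = G i (insert j S) - G i S"
proof -
  define F where "F = FOR ''i'' ''tc'' (RS ''d'' [V ''i'', V ''m''] (RSub (RGet ''g'' [V ''i'']) (RGet ''a'' [V ''i''])))"
  define B where "B = IS ''o'' [] (IGet ''S'' [V ''m'']) ;;; IS ''S'' [V ''m''] (Nat 1) ;;; p_eval t ;;; F ;;;
      IS ''S'' [V ''m''] (V ''o'')"
  define s1 where "s1 = exec n f (p_eval t) s"
  define s2 where "s2 = exec n f (FOR ''i'' ''tc'' (RS ''a'' [V ''i''] (RGet ''g'' [V ''i'']))) s1"
  have s': "s' = exec n f (FOR ''m'' ''n'' B) s2"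
    by (simp only: s'_def p_marg_def exec.simps(4) B_def F_def s1_def s2_def)
  have st1: "stat bs s1" unfolding s1_def by (rule stat_exec[OF st]) (auto simp: static_reals_def)
  have st2: "stat bs s2" unfolding s2_def by (rule stat_exec[OF st1]) (auto simp: static_reals_def)
  have a2: "rmem s2 ''a'' [i] = G i S" if "i < t + c" for i
    unfolding s2_def
    by (rule exec_map(1)[where ix = "\<lambda>i. [i]" and val = "\<lambda>i. G i S" and k = "t + c"])
      (use that exec_eval(1)[OF st S] in \<open>auto simp: stat_simps[OF st1] same_def s1_def[symmetric] inj_on_def\<close>)
  have S2: "brep s2 ''S'' S"
    using S by (rule brep_cong[THEN iffD2, rotated]) (simp add: s2_def s1_def exec_imem)
  define I where "I k s' \<longleftrightarrow> brep s' ''S'' S \<and> (\<forall>i<t + c. \<forall>j<k. rmem s' ''d'' [i, j] = G i (insert j S) - G i S)" for k and s' :: state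
  have "I n s'" unfolding s'
  proof (rule exec_FOR)
    show "I 0 s2" using S2 by (simp add: I_def)
  next
    fix j s3 assume j: "j < n" "imem s3 ''m'' [] = j" and I: "I j s3"
      and sm: "same (insert ''m'' (iw B)) (rw B) s2 s3"
    have st3: "stat bs s3" by (rule stat_same[OF st2 sm]) (auto simp: B_def F_def static_reals_def)
    have a3: "rmem s3 ''a'' = rmem s2 ''a''" by (rule same_rmem[OF sm]) (simp add: B_def F_def)
    have S3: "brep s3 ''S'' S" using I by (simp add: I_def)
    define s4 where "s4 = seti ''S'' [j] 1 (seti ''o'' [] (of_bool (j \<in> S)) s3)"
    have st4: "stat bs s4" using st3
      by (rule stat_same[where X = "{''S'', ''o''}" and Y = "{}"]) (auto simp: s4_def same_def imem_seti)
    have S4: "brep s4 ''S'' (insert j S)" using S3 by (auto simp: brep_def s4_def imem_seti)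
    define s5 where "s5 = exec n f (p_eval t) s4"
    have st5: "stat bs s5" unfolding s5_def by (rule stat_exec[OF st4]) (auto simp: static_reals_def)
    define s6 where "s6 = exec n f F s5"
    have s7: "exec n f B s3 = seti ''S'' [j] (of_bool (j \<in> S)) s6"
    proof -
      have o: "exec n f (IS ''o'' [] (IGet ''S'' [V ''m''])) s3 = seti ''o'' [] (of_bool (j \<in> S)) s3"
        using j S3 by (simp add: brep_def)
      have one: "exec n f (IS ''S'' [V ''m''] (Nat 1)) (seti ''o'' [] y s3) = seti ''S'' [j] 1 (seti ''o'' [] y s3)" for y
        using j by (simp add: imem_seti)
      have "exec n f B s3 = exec n f (IS ''S'' [V ''m''] (V ''o'')) s6"
        by (simp only: B_def exec.simps(4) o one s4_def[symmetric] s5_def[symmetric] s6_def[symmetric])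
      moreover have "imem s6 ''m'' [] = j" "imem s6 ''o'' [] = of_bool (j \<in> S)"
        using j(2) by (simp_all add: s6_def s5_def exec_imem F_def s4_def imem_seti)
      ultimately show ?thesis by simp
    qed
    have m5: "imem s5 ''m'' [] = j" using j(2) by (simp add: s5_def exec_imem s4_def imem_seti)
    have a5: "rmem s5 ''a'' = rmem s2 ''a''" using a3 by (simp add: s5_def exec_rmem s4_def)
    have d6: "rmem s6 ''d'' [i, j] = G i (insert j S) - G i S" if "i < t + c" for i
      unfolding s6_def F_def
      by (rule exec_map(1)[where ix = "\<lambda>i. [i, j]" and val = "\<lambda>i. G i (insert j S) - G i S" and k = "t + c"])
        (use that exec_eval(1)[OF st4 S4] a2 m5 a5 in
          \<open>auto simp: stat_simps[OF st5] same_def s5_def[symmetric] inj_on_def\<close>)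
    have d6': "rmem s6 ''d'' [i, j'] = rmem s3 ''d'' [i, j']" if "j' \<noteq> j" for i j'
    proof -
      have "rmem s6 ''d'' [i, j'] = rmem s5 ''d'' [i, j']"
        unfolding s6_def F_def
        by (rule exec_map(2)[where ix = "\<lambda>i. [i, j]" and k = "t + c"
              and val = "\<lambda>i. rmem s5 ''g'' [i] - rmem s5 ''a'' [i]"])
          (use that m5 in \<open>auto simp: stat_simps[OF st5] same_def inj_on_def\<close>)
      then show ?thesis by (simp add: s5_def exec_rmem s4_def)
    qed
    have "imem s6 ''S'' = imem s4 ''S''" by (simp add: s6_def s5_def exec_imem F_def)
    then have "brep (exec n f B s3) ''S'' S" using S3 by (auto simp: s7 brep_def imem_seti s4_def)
    moreover have "rmem (exec n f B s3) ''d'' [i, l] = G i (insert l S) - G i S" if "i < t + c" "l < Suc j" for i l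
      using that d6[of i] d6'[of l i] I by (cases "l = j") (auto simp: s7 I_def)
    ultimately show "I (Suc j) (exec n f B s3)" by (simp add: I_def)
  qed (auto simp: stat_simps[OF st2] B_def F_def I_def brep_def imem_seti)
  moreover have "rmem s' ''a'' = rmem s2 ''a''" unfolding s' by (rule exec_rmem) (simp add: B_def F_def)
  ultimately show "\<And>i. i < t + c \<Longrightarrow> rmem s' ''a'' [i] = G i S"
    "\<And>i j. i < t + c \<Longrightarrow> j < n \<Longrightarrow> rmem s' ''d'' [i, j] = G i (insert j S) - G i S"
    using a2 by (auto simp: I_def)
qed

end

text \<open>The averages are accumulated sample by sample, and only rows below \<open>t\<close> are
  touched: the static rows stay as \<open>p_init\<close> has left them.\<close>

definition p_rows :: "nat \<Rightarrow> nat \<Rightarrow> prog" where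
  "p_rows w t =
    FOR ''i'' ''t'' (RS ''D'' [V ''i''] (RSub (RDiv (RGet ''v'' [V ''i'']) (RGet ''v'' [V ''i'']))
      (Rat (1 / of_nat (Hc w))))) ;;;
    FOR ''i'' ''t'' (FOR ''j'' ''n'' (RS ''W'' [V ''i'', V ''j''] (Rat 0))) ;;;
    FOR ''l'' ''m'' (
      p_sample ;;;
      p_marg t ;;;
      FOR ''i'' ''t'' (RS ''D'' [V ''i''] (RSub (RGet ''D'' [V ''i'']) (RDiv (RGet ''a'' [V ''i'']) (RGet ''m'' [])))) ;;;
      FOR ''i'' ''t'' (FOR ''j'' ''n'' (RS ''W'' [V ''i'', V ''j'']
        (RAdd (RGet ''W'' [V ''i'', V ''j'']) (RDiv (RGet ''d'' [V ''i'', V ''j'']) (RGet ''m'' []))))))"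

text \<open>One transition of \<open>st\<close>. The discount comes first, since weights and new
  residuals both use the discounted values. \<open>X\<close> is only ever raised, so it remembers a
  violation in any step of any run for the current guess.\<close>

definition p_pick :: prog where
  "p_pick =
    FOR ''i'' ''t'' (RS ''z'' [V ''i''] (RMul (RGet ''z'' [V ''i'']) (RSub (Rat 1) (RDiv (Rat 1) (RGet ''N'' []))))) ;;;
    FOR ''i'' ''M'' (IF (RLess (RGet ''z'' [V ''i'']) (Rat 0)) (RS ''l'' [V ''i''] (Rat 0))
      (RS ''l'' [V ''i''] (RGet ''z'' [V ''i'']))) ;;;
    FOR ''j'' ''n'' (p_sum ''x'' [] ''i'' ''M'' (RMul (RGet ''l'' [V ''i'']) (RGet ''W'' [V ''i'', V ''j''])) ;;;
      IF (RLess (Rat 0) (RGet ''x'' [])) (IS ''Y'' [V ''j''] (IGet ''U'' [V ''j''])) (IS ''Y'' [V ''j''] (Nat 0))) ;;;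
    FOR ''i'' ''M'' (p_sum ''x'' [] ''j'' ''n'' (RMul (OfNat (IGet ''Y'' [V ''j''])) (RGet ''W'' [V ''i'', V ''j''])) ;;;
      RS ''e'' [V ''i''] (RSub (RGet ''D'' [V ''i'']) (RGet ''x'' []))) ;;;
    FOR ''i'' ''M'' (RS ''z'' [V ''i''] (RAdd (RGet ''z'' [V ''i'']) (RGet ''e'' [V ''i'']))) ;;;
    p_sum ''y'' [] ''i'' ''M'' (RMul (RGet ''l'' [V ''i'']) (RGet ''e'' [V ''i''])) ;;;
    IF (RLess (Rat 0) (RGet ''y'' [])) (IS ''X'' [] (Nat 1)) NOP ;;;
    FOR ''j'' ''n'' (IS ''k'' [V ''j''] (IAdd (IGet ''k'' [V ''j'']) (IGet ''Y'' [V ''j''])))"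

lemma p_rows_sets [simp]:
  "iw (p_rows w t) = {''i'', ''j'', ''l'', ''u'', ''b'', ''q'', ''S'', ''m'', ''o''}"
  "rw (p_rows w t) = {''D'', ''W'', ''g'', ''h'', ''a'', ''d''}"
  "bounds (p_rows w t) = {''t'', ''c'', ''p'', ''n'', ''tc'', ''m'', ''b''}" "wf_prog (p_rows w t)"
  by (auto simp: p_rows_def)

lemma p_pick_sets [simp]:
  "iw p_pick = {''i'', ''j'', ''Y'', ''X'', ''k''}" "rw p_pick = {''z'', ''l'', ''x'', ''e'', ''y''}"
  "bounds p_pick = {''t'', ''M'', ''n''}" "wf_prog p_pick"
  by (auto simp: p_pick_def)

context guess
begin

lemma exec_rows:
  assumes st: "stat bs s" and A: "brep s ''A'' A" and d: "\<And>j. j < n \<Longrightarrow> imem s ''k'' [j] = d j"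
    and q: "imem s ''q'' [] = q0" "q0 + m * (n * b) \<le> length bs"
    and Dst: "\<And>i. t \<le> i \<Longrightarrow> i < M \<Longrightarrow> rmem s ''D'' [i] = Ds i"
    and Wst: "\<And>i j. t \<le> i \<Longrightarrow> i < M \<Longrightarrow> j < n \<Longrightarrow> rmem s ''W'' [i, j] = Ws i j"
  defines "s' \<equiv> exec n f (p_rows w t) s" and "y \<equiv> take (m * (n * b)) (drop q0 bs)"
  shows "imem s' ''q'' [] = q0 + m * (n * b)"
    "\<And>i. i < M \<Longrightarrow> rmem s' ''D'' [i] = Dv d y i"
    "\<And>i j. i < M \<Longrightarrow> j < n \<Longrightarrow> rmem s' ''W'' [i, j] = Wv d y i j"
proof -
  define F1 where "F1 = FOR ''i'' ''t'' (RS ''D'' [V ''i''] (RSub (RDiv (RGet ''v'' [V ''i'']) (RGet ''v'' [V ''i'']))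
      (Rat (1 / of_nat (Hc w)))))"
  define F2 where "F2 = FOR ''i'' ''t'' (FOR ''j'' ''n'' (RS ''W'' [V ''i'', V ''j''] (Rat 0)))"
  define F3 where "F3 = FOR ''i'' ''t'' (RS ''D'' [V ''i''] (RSub (RGet ''D'' [V ''i'']) (RDiv (RGet ''a'' [V ''i'']) (RGet ''m'' []))))"
  define F4 where "F4 = FOR ''i'' ''t'' (FOR ''j'' ''n'' (RS ''W'' [V ''i'', V ''j'']
        (RAdd (RGet ''W'' [V ''i'', V ''j'']) (RDiv (RGet ''d'' [V ''i'', V ''j'']) (RGet ''m'' [])))))"
  define B where "B = p_sample ;;; p_marg t ;;; F3 ;;; F4"
  define s1 where "s1 = exec n f F1 s"
  define s2 where "s2 = exec n f F2 s1"
  have s': "s' = exec n f (FOR ''l'' ''m'' B) s2"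
    by (simp only: s'_def p_rows_def exec.simps(4) F1_def F2_def F3_def F4_def B_def s1_def s2_def)
  have st1: "stat bs s1" unfolding s1_def by (rule stat_exec[OF st]) (auto simp: F1_def static_reals_def)
  have st2: "stat bs s2" unfolding s2_def by (rule stat_exec[OF st1]) (auto simp: F2_def static_reals_def)
  have D1: "rmem s1 ''D'' [i] = \<beta> i - h" if "i < t" for i
    unfolding s1_def F1_def
    by (rule exec_map(1)[where ix = "\<lambda>i. [i]" and val = "\<lambda>i. \<beta> i - h" and k = t])
      (use that in \<open>auto simp: stat_simps[OF st] same_def inj_on_def \<beta>_def h_def of_rat_divide\<close>)
  have D1': "rmem s1 ''D'' [i] = rmem s ''D'' [i]" if "t \<le> i" for i
    unfolding s1_def F1_def
    by (rule exec_map(2)[where ix = "\<lambda>i. [i]" and val = "\<lambda>i. \<beta> i - h" and k = t])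
      (use that in \<open>auto simp: stat_simps[OF st] same_def inj_on_def \<beta>_def h_def of_rat_divide\<close>)
  have D2: "rmem s2 ''D'' = rmem s1 ''D''" unfolding s2_def by (rule exec_rmem) (simp add: F2_def)
  have W2: "rmem s2 ''W'' [i, j] = 0" if "i < t" "j < n" for i j
    unfolding s2_def F2_def
    by (rule exec_map2(1)[where ix = "\<lambda>i j. [i, j]" and val = "\<lambda>i j. 0" and k = t and k' = n])
      (use that in \<open>auto simp: stat_simps[OF st1] same_def\<close>)
  have W1: "rmem s1 ''W'' = rmem s ''W''" unfolding s1_def by (rule exec_rmem) (simp add: F1_def)
  have W2': "rmem s2 ''W'' [i, j] = rmem s ''W'' [i, j]" if "t \<le> i" for i j
    unfolding s2_def F2_def W1[symmetric]
    by (rule exec_map2(2)[where ix = "\<lambda>i j. [i, j]" and val = "\<lambda>i j. 0" and k = t and k' = n])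
      (use that in \<open>auto simp: stat_simps[OF st1] same_def\<close>)
  have im2: "imem s2 a = imem s a" if "a \<notin> {''i'', ''j''}" for a
    using that unfolding s2_def s1_def by (simp add: exec_imem F1_def F2_def)
  let ?R = "smps d y"
  define I where "I l s' \<longleftrightarrow> imem s' ''q'' [] = q0 + l * (n * b) \<and>
    (\<forall>i<t. rmem s' ''D'' [i] = \<beta> i - h - (\<Sum>l'<l. G i (?R l') / real m)) \<and>
    (\<forall>i<t. \<forall>j<n. rmem s' ''W'' [i, j] = (\<Sum>l'<l. (G i (insert j (?R l')) - G i (?R l')) / real m)) \<and>
    (\<forall>i\<ge>t. rmem s' ''D'' [i] = rmem s ''D'' [i]) \<and> (\<forall>i\<ge>t. \<forall>j. rmem s' ''W'' [i, j] = rmem s ''W'' [i, j])"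
    for l and s' :: state
  have "I m s'" unfolding s'
  proof (rule exec_FOR)
    show "I 0 s2" using im2[of "''q''"] q D1 D1' D2 W2 W2' by (simp add: I_def)
  next
    fix l s3 assume l: "l < m" "I l s3" and sm: "same (insert ''l'' (iw B)) (rw B) s2 s3"
    have st3: "stat bs s3" by (rule stat_same[OF st2 sm]) (auto simp: B_def F3_def F4_def static_reals_def)
    have A3: "brep s3 ''A'' A" using A
      by (rule brep_cong[THEN iffD2, rotated])
        (use im2[of "''A''"] same_imem[OF sm, of "''A''"] in \<open>simp add: B_def F3_def F4_def\<close>)
    have d3: "imem s3 ''k'' [j] = d j" if "j < n" for j
      using im2[of "''k''"] same_imem[OF sm, of "''k''"] d[OF that] by (simp add: B_def F3_def F4_def)
    define s4 where "s4 = exec n f p_sample s3"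
    define s5 where "s5 = exec n f (p_marg t) s4"
    define s6 where "s6 = exec n f F3 s5"
    define s7 where "s7 = exec n f F4 s6"
    have ql: "q0 + l * (n * b) + n * b \<le> length bs"
    proof -
      have "l * (n * b) + n * b \<le> m * (n * b)" using l(1) by (metis Suc_leI add.commute mult_Suc mult_le_mono1)
      then show ?thesis using q(2) by simp
    qed
    have R: "?R l = A \<union> thr n b d (take (n * b) (drop (q0 + l * (n * b)) bs))"
      using l(1) by (simp add: smps_def smp_def y_def blk_take_drop)
    have "imem s3 ''q'' [] = q0 + l * (n * b)" using l(2) by (simp add: I_def)
    note smpl = exec_sample[OF st3 A3 d3 this ql, folded s4_def R]
    have st4: "stat bs s4" unfolding s4_def by (rule stat_exec[OF st3]) (auto simp: static_reals_def)
    have st5: "stat bs s5" unfolding s5_def by (rule stat_exec[OF st4]) (auto simp: static_reals_def)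
    have st6: "stat bs s6" unfolding s6_def by (rule stat_exec[OF st5]) (auto simp: F3_def static_reals_def)
    note marg = exec_marg[OF st4 smpl(1), folded s5_def]
    have DW5: "rmem s5 ''D'' = rmem s3 ''D''" "rmem s5 ''W'' = rmem s3 ''W''"
      by (simp_all add: s5_def s4_def exec_rmem)
    have D6: "rmem s6 ''D'' [i] = rmem s3 ''D'' [i] - G i (?R l) / real m" if "i < t" for i
      unfolding s6_def F3_def
      by (rule exec_map(1)[where ix = "\<lambda>i. [i]" and val = "\<lambda>i. rmem s3 ''D'' [i] - G i (?R l) / real m" and k = t])
        (use that in \<open>auto simp: stat_simps[OF st5] same_def inj_on_def DW5 marg\<close>)
    have D6': "rmem s6 ''D'' [i] = rmem s3 ''D'' [i]" if "t \<le> i" for i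
      unfolding s6_def F3_def DW5[symmetric]
      by (rule exec_map(2)[where ix = "\<lambda>i. [i]" and val = "\<lambda>i. rmem s3 ''D'' [i] - G i (?R l) / real m" and k = t])
        (use that in \<open>auto simp: stat_simps[OF st5] same_def inj_on_def DW5 marg\<close>)
    have fr6: "rmem s6 ''W'' = rmem s3 ''W''" "rmem s6 ''d'' = rmem s5 ''d''" "rmem s7 ''D'' = rmem s6 ''D''"
      using DW5 by (simp_all add: s6_def s7_def exec_rmem F3_def F4_def)
    have W7: "rmem s7 ''W'' [i, j] = rmem s3 ''W'' [i, j] + (G i (insert j (?R l)) - G i (?R l)) / real m"
      if "i < t" "j < n" for i j
      unfolding s7_def F4_def
      by (rule exec_map2(1)[where ix = "\<lambda>i j. [i, j]" and k = t and k' = n and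
            val = "\<lambda>i j. rmem s3 ''W'' [i, j] + (G i (insert j (?R l)) - G i (?R l)) / real m"])
        (use that in \<open>auto simp: stat_simps[OF st6] same_def fr6 marg\<close>)
    have W7': "rmem s7 ''W'' [i, j] = rmem s3 ''W'' [i, j]" if "t \<le> i" for i j
      unfolding s7_def F4_def fr6(1)[symmetric]
      by (rule exec_map2(2)[where ix = "\<lambda>i j. [i, j]" and k = t and k' = n and
            val = "\<lambda>i j. rmem s3 ''W'' [i, j] + (G i (insert j (?R l)) - G i (?R l)) / real m"])
        (use that in \<open>auto simp: stat_simps[OF st6] same_def fr6 marg\<close>)
    have q7: "imem s7 ''q'' [] = q0 + Suc l * (n * b)"
      using smpl(2) by (simp add: s7_def s6_def s5_def exec_imem F3_def F4_def)
    have "exec n f B s3 = s7" by (simp add: B_def s4_def s5_def s6_def s7_def)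
    then show "I (Suc l) (exec n f B s3)"
      using l(2) q7 D6 D6' W7 W7' fr6(3) by (simp add: I_def)
  qed (auto simp: stat_simps[OF st2] B_def F3_def F4_def I_def imem_seti)
  then show "imem s' ''q'' [] = q0 + m * (n * b)"
    "\<And>i. i < M \<Longrightarrow> rmem s' ''D'' [i] = Dv d y i"
    "\<And>i j. i < M \<Longrightarrow> j < n \<Longrightarrow> rmem s' ''W'' [i, j] = Wv d y i j"
    using Dst Wst by (auto simp: I_def Dv_def Wv_def not_less)
qed

lemma exec_pick:
  assumes st: "stat bs s" and U: "brep s ''U'' U" and d: "\<And>j. j < n \<Longrightarrow> imem s ''k'' [j] = d j"
    and z: "\<And>i. i < M \<Longrightarrow> rmem s ''z'' [i] = z i"
    and D: "\<And>i. i < M \<Longrightarrow> rmem s ''D'' [i] = Dv d y i"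
    and W: "\<And>i j. i < M \<Longrightarrow> j < n \<Longrightarrow> rmem s ''W'' [i, j] = Wv d y i j"
  defines "s' \<equiv> exec n f p_pick s"
  shows "\<And>j. j < n \<Longrightarrow> imem s' ''k'' [j] = d j + of_bool (j \<in> Ys d z y)"
    "\<And>i. i < M \<Longrightarrow> rmem s' ''z'' [i] = zd z i + dv d z y i"
    "imem s' ''X'' [] = (if viol d z y then 1 else imem s ''X'' [])"
proof -
  define F1 where "F1 = FOR ''i'' ''t'' (RS ''z'' [V ''i''] (RMul (RGet ''z'' [V ''i'']) (RSub (Rat 1) (RDiv (Rat 1) (RGet ''N'' [])))))"
  define B2 where "B2 = IF (RLess (RGet ''z'' [V ''i'']) (Rat 0)) (RS ''l'' [V ''i''] (Rat 0))
      (RS ''l'' [V ''i''] (RGet ''z'' [V ''i'']))"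
  define B3 where "B3 = p_sum ''x'' [] ''i'' ''M'' (RMul (RGet ''l'' [V ''i'']) (RGet ''W'' [V ''i'', V ''j''])) ;;;
      IF (RLess (Rat 0) (RGet ''x'' [])) (IS ''Y'' [V ''j''] (IGet ''U'' [V ''j''])) (IS ''Y'' [V ''j''] (Nat 0))"
  define B4 where "B4 = p_sum ''x'' [] ''j'' ''n'' (RMul (OfNat (IGet ''Y'' [V ''j''])) (RGet ''W'' [V ''i'', V ''j''])) ;;;
      RS ''e'' [V ''i''] (RSub (RGet ''D'' [V ''i'']) (RGet ''x'' []))"
  define F5 where "F5 = FOR ''i'' ''M'' (RS ''z'' [V ''i''] (RAdd (RGet ''z'' [V ''i'']) (RGet ''e'' [V ''i''])))"
  define F6 where "F6 = p_sum ''y'' [] ''i'' ''M'' (RMul (RGet ''l'' [V ''i'']) (RGet ''e'' [V ''i'']))"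
  define F7 where "F7 = IF (RLess (Rat 0) (RGet ''y'' [])) (IS ''X'' [] (Nat 1)) NOP"
  define F8 where "F8 = FOR ''j'' ''n'' (IS ''k'' [V ''j''] (IAdd (IGet ''k'' [V ''j'']) (IGet ''Y'' [V ''j''])))"
  define s1 where "s1 = exec n f F1 s"
  define s2 where "s2 = exec n f (FOR ''i'' ''M'' B2) s1"
  define s3 where "s3 = exec n f (FOR ''j'' ''n'' B3) s2"
  define s4 where "s4 = exec n f (FOR ''i'' ''M'' B4) s3"
  define s5 where "s5 = exec n f F5 s4"
  define s6 where "s6 = exec n f F6 s5"
  define s7 where "s7 = exec n f F7 s6"
  have s': "s' = exec n f F8 s7"
    by (simp only: s'_def p_pick_def exec.simps(4) F1_def B2_def B3_def B4_def F5_def F6_def F7_def F8_def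
        s1_def s2_def s3_def s4_def s5_def s6_def s7_def)
  have st1: "stat bs s1" unfolding s1_def by (rule stat_exec[OF st]) (auto simp: F1_def static_reals_def)
  have st2: "stat bs s2" unfolding s2_def by (rule stat_exec[OF st1]) (auto simp: B2_def static_reals_def)
  have st3: "stat bs s3" unfolding s3_def by (rule stat_exec[OF st2]) (auto simp: B3_def static_reals_def)
  have st4: "stat bs s4" unfolding s4_def by (rule stat_exec[OF st3]) (auto simp: B4_def static_reals_def)
  have st5: "stat bs s5" unfolding s5_def by (rule stat_exec[OF st4]) (auto simp: F5_def static_reals_def)
  have st6: "stat bs s6" unfolding s6_def by (rule stat_exec[OF st5]) (auto simp: F6_def static_reals_def)
  have st7: "stat bs s7" unfolding s7_def by (rule stat_exec[OF st6]) (auto simp: F7_def static_reals_def)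
  have z1: "rmem s1 ''z'' [i] = zd z i" if "i < M" for i
  proof (cases "i < t")
    case True
    show ?thesis unfolding s1_def F1_def
      by (rule exec_map(1)[where ix = "\<lambda>i. [i]" and val = "zd z" and k = t])
        (use True z in \<open>auto simp: stat_simps[OF st] same_def inj_on_def zd_def\<close>)
  next
    case False
    have "rmem s1 ''z'' [i] = rmem s ''z'' [i]" unfolding s1_def F1_def
      by (rule exec_map(2)[where ix = "\<lambda>i. [i]" and val = "zd z" and k = t])
        (use False z in \<open>auto simp: stat_simps[OF st] same_def inj_on_def zd_def\<close>)
    then show ?thesis using False z[OF that] by (simp add: zd_def)
  qed
  have l2: "\<forall>i<M. rmem s2 ''l'' [i] = lam z i"
    unfolding s2_def
  proof (rule exec_FOR[where I = "\<lambda>i s'. \<forall>l<i. rmem s' ''l'' [l] = lam z l"])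
    fix i s3 assume i: "i < M" "imem s3 ''i'' [] = i" "\<forall>l<i. rmem s3 ''l'' [l] = lam z l"
      and sm: "same (insert ''i'' (iw B2)) (rw B2) s1 s3"
    have "rmem s3 ''z'' [i] = zd z i" using same_rmem[OF sm, of "''z''"] z1[OF i(1)] by (simp add: B2_def)
    then show "\<forall>l<Suc i. rmem (exec n f B2 s3) ''l'' [l] = lam z l"
      using i by (auto simp: B2_def rmem_setr less_Suc_eq lam_def)
  qed (auto simp: stat_simps[OF st1] B2_def)
  have W2: "rmem s2 ''W'' = rmem s ''W''" by (simp add: s2_def s1_def exec_rmem F1_def B2_def)
  have U2: "imem s2 ''U'' = imem s ''U''" by (simp add: s2_def s1_def exec_imem F1_def B2_def)
  have Y3: "brep s3 ''Y'' (Ys d z y)"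
    unfolding s3_def brep_def
  proof (rule exec_FOR[where I = "\<lambda>k s'. \<forall>j<k. imem s' ''Y'' [j] = of_bool (j \<in> Ys d z y)"])
    fix j s4 assume j: "j < n" "imem s4 ''j'' [] = j" "\<forall>j'<j. imem s4 ''Y'' [j'] = of_bool (j' \<in> Ys d z y)"
      and sm: "same (insert ''j'' (iw B3)) (rw B3) s2 s4"
    have st4: "stat bs s4" by (rule stat_same[OF st2 sm]) (auto simp: B3_def static_reals_def)
    have fr: "rmem s4 ''l'' = rmem s2 ''l''" "rmem s4 ''W'' = rmem s ''W''" "imem s4 ''U'' = imem s ''U''"
      using same_rmem[OF sm, of "''l''"] same_rmem[OF sm, of "''W''"] same_imem[OF sm, of "''U''"] W2 U2
      by (simp_all add: B3_def)
    let ?x = "\<Sum>i<M. lam z i * Wv d y i j"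
    define s5 where "s5 = setr ''x'' [] ?x (seti ''i'' [] M s4)"
    have "exec n f (p_sum ''x'' [] ''i'' ''M'' (RMul (RGet ''l'' [V ''i'']) (RGet ''W'' [V ''i'', V ''j'']))) s4 = s5"
      using l2 W[OF _ j(1)] j(2) fr
      by (subst exec_sum[where k = M]) (auto simp: stat_simps[OF st4] rmem_setr imem_seti s5_def)
    then have B3: "exec n f B3 s4 = exec n f (IF (RLess (Rat 0) (RGet ''x'' [])) (IS ''Y'' [V ''j''] (IGet ''U'' [V ''j'']))
        (IS ''Y'' [V ''j''] (Nat 0))) s5"
      by (simp only: B3_def exec.simps(4))
    have x5: "rmem s5 ''x'' [] = ?x" "imem s5 ''j'' [] = j" "imem s5 ''U'' [j] = of_bool (j \<in> U)"
      "imem s5 ''Y'' = imem s4 ''Y''"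
      using j U fr(3) by (auto simp: s5_def rmem_setr imem_seti brep_def)
    have "exec n f B3 s4 = seti ''Y'' [j] (of_bool (j \<in> Ys d z y)) s5"
      unfolding B3 by (auto simp: x5 Ys_def)
    then show "\<forall>j'<Suc j. imem (exec n f B3 s4) ''Y'' [j'] = of_bool (j' \<in> Ys d z y)"
      using j(3) x5(4) by (auto simp: imem_seti less_Suc_eq)
  qed (auto simp: stat_simps[OF st2] B3_def imem_seti)
  have fr3: "rmem s3 ''W'' = rmem s ''W''" "rmem s3 ''D'' = rmem s ''D''" "rmem s3 ''l'' = rmem s2 ''l''"
    "rmem s3 ''z'' = rmem s1 ''z''"
    using W2 by (simp_all add: s3_def s2_def s1_def exec_rmem F1_def B2_def B3_def)
  have YS: "Ys d z y \<inter> {..<n} = Ys d z y" using Ys_subset U_sub by blast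
  have e4: "\<forall>i<M. rmem s4 ''e'' [i] = dv d z y i"
    unfolding s4_def
  proof (rule exec_FOR[where I = "\<lambda>k s'. \<forall>i<k. rmem s' ''e'' [i] = dv d z y i"])
    fix i s5 assume i: "i < M" "imem s5 ''i'' [] = i" "\<forall>l<i. rmem s5 ''e'' [l] = dv d z y l"
      and sm: "same (insert ''i'' (iw B4)) (rw B4) s3 s5"
    have st5: "stat bs s5" by (rule stat_same[OF st3 sm]) (auto simp: B4_def static_reals_def)
    have fr: "rmem s5 ''W'' = rmem s ''W''" "rmem s5 ''D'' = rmem s ''D''" "imem s5 ''Y'' = imem s3 ''Y''"
      using same_rmem[OF sm, of "''W''"] same_rmem[OF sm, of "''D''"] same_imem[OF sm, of "''Y''"] fr3
      by (simp_all add: B4_def)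
    have Y5: "brep s5 ''Y'' (Ys d z y)" using Y3 fr(3) by (simp add: brep_def)
    let ?x = "\<Sum>j\<in>Ys d z y. Wv d y i j"
    define s6 where "s6 = setr ''x'' [] ?x (seti ''j'' [] n s5)"
    have "exec n f (p_sum ''x'' [] ''j'' ''n'' (RMul (OfNat (IGet ''Y'' [V ''j''])) (RGet ''W'' [V ''i'', V ''j'']))) s5
        = setr ''x'' [] (\<Sum>j<n. real (imem s5 ''Y'' [j]) * Wv d y i j) (seti ''j'' [] n s5)"
      using W[OF i(1)] i(2) fr(1)
      by (subst exec_sum[where k = n]) (auto simp: stat_simps[OF st5] rmem_setr imem_seti)
    also have "(\<Sum>j<n. real (imem s5 ''Y'' [j]) * Wv d y i j) = ?x"
      by (subst brep_sum[OF Y5]) (simp add: modular_def YS)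
    finally have B4: "exec n f B4 s5 = exec n f (RS ''e'' [V ''i''] (RSub (RGet ''D'' [V ''i'']) (RGet ''x'' []))) s6"
      by (simp only: B4_def exec.simps(4) s6_def)
    then have "exec n f B4 s5 = setr ''e'' [i] (dv d z y i) s6"
      using i fr(2) D[OF i(1)] by (simp add: s6_def rmem_setr imem_seti dv_def)
    then show "\<forall>l<Suc i. rmem (exec n f B4 s5) ''e'' [l] = dv d z y l"
      using i(3) by (auto simp: rmem_setr less_Suc_eq s6_def)
  qed (auto simp: stat_simps[OF st3] B4_def)
  have fr4: "rmem s4 ''l'' = rmem s2 ''l''" "rmem s4 ''z'' = rmem s1 ''z''"
    using fr3 by (simp_all add: s4_def exec_rmem B4_def)
  have z5: "rmem s5 ''z'' [i] = zd z i + dv d z y i" if "i < M" for i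
    unfolding s5_def F5_def
    by (rule exec_map(1)[where ix = "\<lambda>i. [i]" and val = "\<lambda>i. zd z i + dv d z y i" and k = M])
      (use that z1 e4 fr4 in \<open>auto simp: stat_simps[OF st4] same_def inj_on_def\<close>)
  have fr5: "rmem s5 ''l'' = rmem s2 ''l''" "rmem s5 ''e'' = rmem s4 ''e''"
    using fr4 by (simp_all add: s5_def exec_rmem F5_def)
  have s6: "s6 = setr ''y'' [] (\<Sum>i<M. lam z i * dv d z y i) (seti ''i'' [] M s5)"
    unfolding s6_def F6_def using l2 e4 fr5
    by (subst exec_sum[where k = M]) (auto simp: stat_simps[OF st5] rmem_setr imem_seti)
  have X7: "imem s7 ''X'' [] = (if viol d z y then 1 else imem s ''X'' [])"
  proof -
    have "imem s6 ''X'' = imem s ''X''"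
      by (simp add: s6_def s5_def s4_def s3_def s2_def s1_def exec_imem F1_def B2_def B3_def B4_def F5_def F6_def)
    moreover have "rmem s6 ''y'' [] = (\<Sum>i<M. lam z i * dv d z y i)" by (simp add: s6 rmem_setr)
    ultimately show ?thesis by (simp add: s7_def F7_def imem_seti viol_def)
  qed
  have im7: "imem s7 a = imem s6 a" if "a \<noteq> ''X''" for a
    unfolding s7_def by (rule exec_imem) (use that in \<open>simp add: F7_def\<close>)
  have k7: "imem s7 ''k'' = imem s ''k''" "imem s7 ''Y'' = imem s3 ''Y''"
    by (simp_all add: im7) (simp_all add: s6_def s5_def s4_def s3_def s2_def s1_def exec_imem
        F1_def B2_def B3_def B4_def F5_def F6_def)
  show "imem s' ''k'' [j] = d j + of_bool (j \<in> Ys d z y)" if "j < n" for j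
    unfolding s' F8_def
    by (rule exec_imap[where k = n and val = "\<lambda>j. d j + of_bool (j \<in> Ys d z y)"])
      (use that d k7 Y3 in \<open>auto simp: stat_simps[OF st7] same_def brep_def\<close>)
  have "rmem s7 ''z'' = rmem s6 ''z''" unfolding s7_def by (rule exec_rmem) (simp add: F7_def)
  then have "rmem s' ''z'' = rmem s5 ''z''" by (simp add: s' s6_def exec_rmem F6_def F8_def)
  then show "rmem s' ''z'' [i] = zd z i + dv d z y i" if "i < M" for i using z5[OF that] by simp
  have "imem s' ''X'' = imem s7 ''X''" by (simp add: s' exec_imem F8_def)
  then show "imem s' ''X'' [] = (if viol d z y then 1 else imem s ''X'' [])" using X7 by simp
qed

end

text \<open>Rounding is one more call of \<open>p_sample\<close> with the final counters. The result
  is then tested against \<open>ok\<close> explicitly, so an announced solution is always correct;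
  \<open>out\<close> is overwritten only after a successful test.\<close>

definition p_run :: "nat \<Rightarrow> nat \<Rightarrow> rat \<Rightarrow> prog" where
  "p_run w t \<kappa> =
    FOR ''j'' ''n'' (IS ''k'' [V ''j''] (Nat 0)) ;;;
    FOR ''i'' ''M'' (RS ''z'' [V ''i''] (Rat 0)) ;;;
    FOR ''s'' ''T'' (p_rows w t ;;; p_pick) ;;;
    p_sample ;;;
    p_eval t ;;;
    IS ''O'' [] (Nat 1) ;;;
    FOR ''i'' ''p'' (IF (RLess (Rat 1) (RGet ''h'' [V ''i''])) (IS ''O'' [] (Nat 0)) NOP) ;;;
    FOR ''i'' ''t'' (IF (RLess (RGet ''g'' [V ''i'']) (RMul (Rat \<kappa>) (RDiv (RGet ''v'' [V ''i'']) (RGet ''v'' [V ''i'']))))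
      (IS ''O'' [] (Nat 0)) NOP) ;;;
    FOR ''i'' ''c'' (IF (RLess (RGet ''g'' [IAdd (Nat t) (V ''i'')]) (Rat (1 - 1 / 2 ^ w)))
      (IS ''O'' [] (Nat 0)) NOP) ;;;
    IF (ILess (Nat 0) (V ''O''))
      (IS ''F'' [] (Nat 1) ;;; FOR ''j'' ''n'' (IS ''out'' [V ''j''] (IGet ''S'' [V ''j''])))
      NOP"

text \<open>The loops up to \<open>tc\<close> also fill the rows below \<open>t\<close>, which
  \<open>p_rows\<close> overwrites. A negative remaining budget refutes the guess at once through
  \<open>X\<close>.\<close>

definition p_init :: "nat \<Rightarrow> nat \<Rightarrow> nat \<Rightarrow> nat \<Rightarrow> prog" where
  "p_init p c t w =
    FOR ''j'' ''n'' (IS ''S'' [V ''j''] (IGet ''A'' [V ''j''])) ;;;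
    p_eval t ;;;
    FOR ''i'' ''p'' (RS ''r'' [V ''i''] (RSub (Rat 1) (RGet ''h'' [V ''i'']))) ;;;
    p_marg t ;;;
    FOR ''j'' ''n'' (
      IS ''U'' [V ''j''] (ISub (Nat 1) (IGet ''A'' [V ''j''])) ;;;
      FOR ''i'' ''tc'' (IF (RLess (Rat (1 / of_nat (e1d p c t w))) (RGet ''d'' [V ''i'', V ''j'']))
        (IS ''U'' [V ''j''] (Nat 0)) NOP) ;;;
      FOR ''i'' ''p'' (IF (RLess (RMul (Rat (1 / of_nat (e2d p w))) (RGet ''r'' [V ''i''])) (RGet ''P'' [V ''i'', V ''j'']))
        (IS ''U'' [V ''j''] (Nat 0)) NOP)) ;;;
    FOR ''i'' ''tc'' (RS ''D'' [V ''i''] (RSub (Rat (1 - 1 / of_nat (Hc w))) (RGet ''a'' [V ''i'']))) ;;;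
    FOR ''i'' ''tc'' (FOR ''j'' ''n'' (RS ''W'' [V ''i'', V ''j''] (RGet ''d'' [V ''i'', V ''j'']))) ;;;
    FOR ''i'' ''p'' (RS ''D'' [IAdd (Nat (t + c)) (V ''i'')] (Rat (- 1))) ;;;
    FOR ''i'' ''p'' (FOR ''j'' ''n'' (RS ''W'' [IAdd (Nat (t + c)) (V ''i''), V ''j'']
      (RSub (Rat 0) (RDiv (RGet ''P'' [V ''i'', V ''j'']) (RGet ''r'' [V ''i'']))))) ;;;
    IS ''X'' [] (Nat 0) ;;;
    FOR ''i'' ''p'' (IF (RLess (RGet ''r'' [V ''i'']) (Rat 0)) (IS ''X'' [] (Nat 1)) NOP)"

lemma p_run_sets [simp]:
  "iw (p_run w t \<kappa>) = {''i'', ''j'', ''l'', ''u'', ''b'', ''q'', ''S'', ''m'', ''o'', ''Y'', ''X'', ''k'', ''s'', ''O'', ''F'', ''out''}"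
  "rw (p_run w t \<kappa>) = {''D'', ''W'', ''g'', ''h'', ''a'', ''d'', ''z'', ''l'', ''x'', ''e'', ''y''}"
  "bounds (p_run w t \<kappa>) = {''t'', ''c'', ''p'', ''n'', ''tc'', ''m'', ''b'', ''M'', ''T''}" "wf_prog (p_run w t \<kappa>)"
  by (auto simp: p_run_def)

lemma p_init_sets [simp]:
  "iw (p_init p c t w) = {''i'', ''j'', ''m'', ''o'', ''S'', ''U'', ''X''}"
  "rw (p_init p c t w) = {''g'', ''h'', ''a'', ''d'', ''r'', ''D'', ''W''}"
  "bounds (p_init p c t w) = {''t'', ''c'', ''p'', ''n'', ''tc''}" "wf_prog (p_init p c t w)"
  by (auto simp: p_init_def)

lemma exec_flag:
  assumes bnd: "rmem s bnd [] = real k" and x: "x \<noteq> fl"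
    and ev: "\<And>s' i. i < k \<Longrightarrow> same {x, fl} {} s s' \<Longrightarrow> imem s' x [] = i \<Longrightarrow> bval n f s' b \<longleftrightarrow> Q i"
    and es: "\<And>s' i. i < k \<Longrightarrow> same {x, fl} {} s s' \<Longrightarrow> imem s' x [] = i \<Longrightarrow> map (ival s') es = js"
  shows "imem (exec n f (FOR x bnd (IF b (IS fl es (Nat r)) NOP)) s) fl js
      = (if \<exists>i<k. Q i then r else imem s fl js)"
    and "js' \<noteq> js \<Longrightarrow> imem (exec n f (FOR x bnd (IF b (IS fl es (Nat r)) NOP)) s) fl js' = imem s fl js'"
proof -
  let ?B = "IF b (IS fl es (Nat r)) NOP"
  define I where "I i s' \<longleftrightarrow> imem s' fl js = (if \<exists>i'<i. Q i' then r else imem s fl js)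
      \<and> (\<forall>js'. js' \<noteq> js \<longrightarrow> imem s' fl js' = imem s fl js')" for i and s' :: state
  have "I k (exec n f (FOR x bnd ?B) s)"
  proof (rule exec_FOR)
    fix i s' assume i: "i < k" "imem s' x [] = i" "I i s'" and sm: "same (insert x (iw ?B)) (rw ?B) s s'"
    then have sm: "same {x, fl} {} s s'" by simp
    have "exec n f ?B s' = (if Q i then seti fl js r s' else s')"
      using ev[OF i(1) sm i(2)] es[OF i(1) sm i(2)] by simp
    then show "I (Suc i) (exec n f ?B s')" using i(3) by (auto simp: I_def imem_seti less_Suc_eq)
  qed (use bnd x in \<open>auto simp: I_def imem_seti\<close>)
  then show "imem (exec n f (FOR x bnd ?B) s) fl js = (if \<exists>i<k. Q i then r else imem s fl js)"
    "js' \<noteq> js \<Longrightarrow> imem (exec n f (FOR x bnd ?B) s) fl js' = imem s fl js'"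
    unfolding I_def by blast+
qed

lemma ex_less_iff: "(\<exists>i<k. x i < (y i :: real)) \<longleftrightarrow> \<not> (\<forall>i<k. y i \<le> x i)" for k :: nat
  by (meson not_le)

context guess
begin

definition ready :: "state \<Rightarrow> bool" where
  "ready s \<longleftrightarrow> brep s ''A'' A \<and> brep s ''U'' U \<and> (\<forall>i. t \<le> i \<longrightarrow> i < M \<longrightarrow> rmem s ''D'' [i] = Ds i) \<and>
     (\<forall>i j. t \<le> i \<longrightarrow> i < M \<longrightarrow> j < n \<longrightarrow> rmem s ''W'' [i, j] = Ws i j)"

lemma rounded_sub: "rounded r \<subseteq> {..<n}"
  using A_sub by (auto simp: rounded_def smp_def thr_def)

lemma exec_steps:
  assumes st: "stat bs s" and rd: "ready s" and k0: "\<And>j. j < n \<Longrightarrow> imem s ''k'' [j] = 0"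
    and z0: "\<And>i. i < M \<Longrightarrow> rmem s ''z'' [i] = 0"
    and q: "imem s ''q'' [] = q0" "q0 + Q \<le> length bs"
  defines "s' \<equiv> exec n f (FOR ''s'' ''T'' (p_rows w t ;;; p_pick)) s" and "y \<equiv> take Q (drop q0 bs)"
  shows "imem s' ''q'' [] = q0 + N0 * (m * (n * b))" "\<And>j. j < n \<Longrightarrow> imem s' ''k'' [j] = cnt N0 y j"
    "imem s' ''X'' [] = (if certified y then 1 else imem s ''X'' [])" "ready s'"
proof -
  let ?B = "p_rows w t ;;; p_pick" and ?q = "m * (n * b)"
  define I where "I k s' \<longleftrightarrow> imem s' ''q'' [] = q0 + k * ?q \<and> (\<forall>j<n. imem s' ''k'' [j] = cnt k y j) \<and>
    (\<forall>i<M. rmem s' ''z'' [i] = zs k y i) \<and>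
    imem s' ''X'' [] = (if \<exists>s<k. violated s y then 1 else imem s ''X'' []) \<and> ready s'" for k and s' :: state
  have "I N0 s'" unfolding s'_def
  proof (rule exec_FOR)
    fix k s1 assume k: "k < N0" "I k s1" and sm: "same (insert ''s'' (iw ?B)) (rw ?B) s s1"
    have st1: "stat bs s1" by (rule stat_same[OF st sm]) (auto simp: static_reals_def)
    have rd1: "brep s1 ''A'' A" "brep s1 ''U'' U" "\<And>i. t \<le> i \<Longrightarrow> i < M \<Longrightarrow> rmem s1 ''D'' [i] = Ds i"
      "\<And>i j. t \<le> i \<Longrightarrow> i < M \<Longrightarrow> j < n \<Longrightarrow> rmem s1 ''W'' [i, j] = Ws i j"
      using k(2) by (auto simp: I_def ready_def)
    have I1: "imem s1 ''q'' [] = q0 + k * ?q" "\<And>j. j < n \<Longrightarrow> imem s1 ''k'' [j] = cnt k y j"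
      "\<And>i. i < M \<Longrightarrow> rmem s1 ''z'' [i] = zs k y i"
      "imem s1 ''X'' [] = (if \<exists>s<k. violated s y then 1 else imem s ''X'' [])"
      using k(2) by (auto simp: I_def)
    have le: "k * ?q + ?q \<le> N0 * ?q" using k(1) by (metis Suc_leI add.commute mult_Suc mult_le_mono1)
    then have ql: "q0 + k * ?q + ?q \<le> length bs" using q(2) by (simp add: Q_def)
    have y: "take ?q (drop (q0 + k * ?q) bs) = sblk k y"
      using le by (simp add: y_def blk_def drop_take Q_def add.commute[of q0] min_def)
    define s2 where "s2 = exec n f (p_rows w t) s1"
    define s3 where "s3 = exec n f p_pick s2"
    have st2: "stat bs s2" unfolding s2_def by (rule stat_exec[OF st1]) (auto simp: static_reals_def)
    note rows = exec_rows[OF st1 rd1(1) I1(2) I1(1) ql rd1(3) rd1(4), folded s2_def, unfolded y]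
    have fr: "imem s2 ''k'' = imem s1 ''k''" "rmem s2 ''z'' = rmem s1 ''z''" "imem s2 ''X'' = imem s1 ''X''"
      "imem s2 ''A'' = imem s1 ''A''" "imem s2 ''U'' = imem s1 ''U''"
      by (simp_all add: s2_def exec_imem exec_rmem)
    have U2: "brep s2 ''U'' U" using rd1(2) fr by (simp add: brep_def)
    have k2: "imem s2 ''k'' [j] = cnt k y j" if "j < n" for j using I1(2)[OF that] fr by simp
    have z2: "rmem s2 ''z'' [i] = zs k y i" if "i < M" for i using I1(3)[OF that] fr by simp
    note pick = exec_pick[OF st2 U2 k2 z2 rows(2) rows(3), folded s3_def]
    have ex: "exec n f ?B s1 = s3" by (simp add: s2_def s3_def)
    have "imem s3 ''q'' [] = q0 + Suc k * ?q" using rows(1) by (simp add: s3_def exec_imem)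
    moreover have "\<forall>j<n. imem s3 ''k'' [j] = cnt (Suc k) y j" using pick(1) by (simp add: cnt_Suc)
    moreover have "\<forall>i<M. rmem s3 ''z'' [i] = zs (Suc k) y i" using pick(2) by (simp add: zs_Suc)
    moreover have "imem s3 ''X'' [] = (if \<exists>s<Suc k. violated s y then 1 else imem s ''X'' [])"
      using pick(3) I1(4) fr(3) by (auto simp: violated_def less_Suc_eq)
    moreover have "ready s3"
    proof -
      have "imem s3 ''A'' = imem s1 ''A''" "imem s3 ''U'' = imem s1 ''U''"
        "rmem s3 ''D'' = rmem s2 ''D''" "rmem s3 ''W'' = rmem s2 ''W''"
        using fr by (simp_all add: s3_def exec_imem exec_rmem)
      then show ?thesis using rd1 rows(2,3) by (auto simp: ready_def brep_def Dv_def Wv_def)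
    qed
    ultimately show "I (Suc k) (exec n f ?B s1)" unfolding ex I_def by blast
  qed (use st q k0 z0 rd in \<open>auto simp: stat_simps[OF st] I_def imem_seti ready_def brep_def\<close>)
  then show "imem s' ''q'' [] = q0 + N0 * (m * (n * b))" "\<And>j. j < n \<Longrightarrow> imem s' ''k'' [j] = cnt N0 y j"
    "imem s' ''X'' [] = (if certified y then 1 else imem s ''X'' [])" "ready s'"
    by (auto simp: I_def certified_def)
qed

lemma exec_run:
  assumes st: "stat bs s" and rd: "ready s"
    and q: "imem s ''q'' [] = q0" "q0 + Q \<le> length bs"
  defines "s' \<equiv> exec n f (p_run w t \<kappa>) s" and "y \<equiv> take Q (drop q0 bs)"
  shows "imem s' ''q'' [] = q0 + Q" "imem s' ''X'' [] = (if certified y then 1 else imem s ''X'' [])" "ready s'"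
    "ok (rounded y) \<Longrightarrow> imem s' ''F'' [] = 1 \<and> brep s' ''out'' (rounded y)"
    "\<not> ok (rounded y) \<Longrightarrow> imem s' ''F'' = imem s ''F'' \<and> imem s' ''out'' = imem s ''out''"
proof -
  define F1 where "F1 = FOR ''j'' ''n'' (IS ''k'' [V ''j''] (Nat 0))"
  define F2 where "F2 = FOR ''i'' ''M'' (RS ''z'' [V ''i''] (Rat 0))"
  define F3 where "F3 = FOR ''s'' ''T'' (p_rows w t ;;; p_pick)"
  define F7 where "F7 = FOR ''i'' ''p'' (IF (RLess (Rat 1) (RGet ''h'' [V ''i''])) (IS ''O'' [] (Nat 0)) NOP)"
  define F8 where "F8 = FOR ''i'' ''t'' (IF (RLess (RGet ''g'' [V ''i'']) (RMul (Rat \<kappa>) (RDiv (RGet ''v'' [V ''i'']) (RGet ''v'' [V ''i'']))))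
      (IS ''O'' [] (Nat 0)) NOP)"
  define F9 where "F9 = FOR ''i'' ''c'' (IF (RLess (RGet ''g'' [IAdd (Nat t) (V ''i'')]) (Rat (1 - 1 / 2 ^ w)))
      (IS ''O'' [] (Nat 0)) NOP)"
  define FC where "FC = FOR ''j'' ''n'' (IS ''out'' [V ''j''] (IGet ''S'' [V ''j'']))"
  define s1 where "s1 = exec n f F1 s"
  define s2 where "s2 = exec n f F2 s1"
  define s3 where "s3 = exec n f F3 s2"
  define s4 where "s4 = exec n f p_sample s3"
  define s5 where "s5 = exec n f (p_eval t) s4"
  define s6 where "s6 = exec n f (IS ''O'' [] (Nat 1)) s5"
  define s7 where "s7 = exec n f F7 s6"
  define s8 where "s8 = exec n f F8 s7"
  define s9 where "s9 = exec n f F9 s8"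
  have s': "s' = exec n f (IF (ILess (Nat 0) (V ''O'')) (IS ''F'' [] (Nat 1) ;;; FC) NOP) s9"
    by (simp only: s'_def p_run_def exec.simps(4) F1_def F2_def F3_def F7_def F8_def F9_def FC_def
        s1_def s2_def s3_def s4_def s5_def s6_def s7_def s8_def s9_def)
  have st1: "stat bs s1" unfolding s1_def by (rule stat_exec[OF st]) (auto simp: F1_def static_reals_def)
  have st2: "stat bs s2" unfolding s2_def by (rule stat_exec[OF st1]) (auto simp: F2_def static_reals_def)
  have st3: "stat bs s3" unfolding s3_def by (rule stat_exec[OF st2]) (auto simp: F3_def static_reals_def)
  have st4: "stat bs s4" unfolding s4_def by (rule stat_exec[OF st3]) (auto simp: static_reals_def)
  have st5: "stat bs s5" unfolding s5_def by (rule stat_exec[OF st4]) (auto simp: static_reals_def)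
  have st6: "stat bs s6" unfolding s6_def by (rule stat_exec[OF st5]) (auto simp: static_reals_def)
  have st7: "stat bs s7" unfolding s7_def by (rule stat_exec[OF st6]) (auto simp: F7_def static_reals_def)
  have st8: "stat bs s8" unfolding s8_def by (rule stat_exec[OF st7]) (auto simp: F8_def static_reals_def)
  have st9: "stat bs s9" unfolding s9_def by (rule stat_exec[OF st8]) (auto simp: F9_def static_reals_def)
  have k1: "imem s1 ''k'' [j] = 0" if "j < n" for j
    unfolding s1_def F1_def by (rule exec_imap[where k = n and val = "\<lambda>_. 0"])
      (use that in \<open>auto simp: stat_simps[OF st]\<close>)
  have z2: "rmem s2 ''z'' [i] = 0" if "i < M" for i
    unfolding s2_def F2_def by (rule exec_map(1)[where k = M and ix = "\<lambda>i. [i]" and val = "\<lambda>_. 0"])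
      (use that in \<open>auto simp: stat_simps[OF st1] inj_on_def\<close>)
  have i2: "imem s2 a = imem s a" if "a \<notin> {''i'', ''j'', ''k''}" for a
    using that by (simp add: s2_def s1_def exec_imem F1_def F2_def)
  have k2: "imem s2 ''k'' [j] = 0" if "j < n" for j
    using k1[OF that] by (simp add: s2_def exec_imem F2_def)
  have r2: "rmem s2 a = rmem s a" if "a \<noteq> ''z''" for a
    using that by (simp add: s2_def s1_def exec_rmem F1_def F2_def)
  have rd2: "ready s2" using rd i2 r2 by (simp add: ready_def brep_def)
  have q2: "imem s2 ''q'' [] = q0" using q(1) i2 by simp
  note steps = exec_steps[OF st2 rd2 k2 z2 q2 q(2), folded F3_def s3_def y_def]
  have A3: "brep s3 ''A'' A" using steps(4) by (simp add: ready_def)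
  have ql: "q0 + N0 * (m * (n * b)) + n * b \<le> length bs" using q(2) by (simp add: Q_def)
  have R: "A \<union> thr n b (cnt N0 y) (take (n * b) (drop (q0 + N0 * (m * (n * b))) bs)) = rounded y"
    by (simp add: rounded_def smp_def y_def Q_def drop_take add.commute[of q0])
  note smpl = exec_sample[OF st3 A3 steps(2) steps(1) ql, folded s4_def, unfolded R]
  note ev = exec_eval[OF st4 smpl(1), folded s5_def]
  have S5: "imem s5 ''S'' = imem s4 ''S''" by (simp add: s5_def exec_imem)
  have g6: "rmem s6 = rmem s5" by (simp add: s6_def)
  have g7: "rmem s7 a = rmem s5 a" for a unfolding s7_def g6[symmetric] by (rule exec_rmem) (simp add: F7_def)
  have g8: "rmem s8 a = rmem s5 a" for a unfolding s8_def g7[of a, symmetric] by (rule exec_rmem) (simp add: F8_def)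
  have i9: "imem s9 a = imem s5 a" if "a \<noteq> ''O''" "a \<noteq> ''i''" for a
  proof -
    have "imem s9 a = imem s8 a" unfolding s9_def by (rule exec_imem) (use that in \<open>simp add: F9_def\<close>)
    also have "\<dots> = imem s7 a" unfolding s8_def by (rule exec_imem) (use that in \<open>simp add: F8_def\<close>)
    also have "\<dots> = imem s6 a" unfolding s7_def by (rule exec_imem) (use that in \<open>simp add: F7_def\<close>)
    also have "\<dots> = imem s5 a" using that by (simp add: s6_def imem_seti)
    finally show ?thesis .
  qed
  have O6: "imem s6 ''O'' [] = 1" by (simp add: s6_def imem_seti)
  have O7: "imem s7 ''O'' [] = (if \<exists>i<p. 1 < load i (rounded y) then 0 else imem s6 ''O'' [])"
    unfolding s7_def F7_def
    by (rule exec_flag(1)) (auto simp: stat_simps[OF st5] same_def g6 ev)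
  have O8: "imem s8 ''O'' [] = (if \<exists>i<t. G i (rounded y) < of_rat \<kappa> * \<beta> i then 0 else imem s7 ''O'' [])"
    unfolding s8_def F8_def
    by (rule exec_flag(1)) (auto simp: stat_simps[OF st5] same_def g7 ev \<beta>_def)
  have O9: "imem s9 ''O'' [] = (if \<exists>i<c. G (t + i) (rounded y) < 1 - 1 / 2 ^ w then 0 else imem s8 ''O'' [])"
    unfolding s9_def F9_def
    by (rule exec_flag(1))
      (auto simp: stat_simps[OF st5] same_def g8 ev of_rat_diff of_rat_divide of_rat_power)
  have O: "0 < imem s9 ''O'' [] \<longleftrightarrow> ok (rounded y)"
    unfolding O9 O8 O7 O6 ok_def ex_less_iff by simp
  have fr: "imem s' a = imem s9 a" if "a \<notin> {''F'', ''out'', ''j''}" for a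
    unfolding s' by (rule exec_imem) (use that in \<open>simp add: FC_def\<close>)
  have r': "rmem s' a = rmem s3 a" if "a \<notin> {''g'', ''h''}" for a
  proof -
    have "rmem s' a = rmem s9 a" unfolding s' by (rule exec_rmem) (simp add: FC_def)
    also have "\<dots> = rmem s8 a" unfolding s9_def by (rule exec_rmem) (simp add: F9_def)
    also have "\<dots> = rmem s3 a" using that by (simp add: g8 s5_def s4_def exec_rmem)
    finally show ?thesis .
  qed
  show "imem s' ''q'' [] = q0 + Q"
    using fr[of "''q''"] i9[of "''q''"] smpl(2) by (simp add: s5_def exec_imem Q_def)
  show "imem s' ''X'' [] = (if certified y then 1 else imem s ''X'' [])"
    using fr[of "''X''"] i9[of "''X''"] steps(3) i2[of "''X''"] by (simp add: s5_def s4_def exec_imem)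
  show "ready s'"
    using steps(4) fr[of "''A''"] i9[of "''A''"] fr[of "''U''"] i9[of "''U''"] r'
    by (simp add: s5_def s4_def exec_imem ready_def brep_def)
  have i5: "imem s5 ''F'' = imem s ''F''" "imem s5 ''out'' = imem s ''out''"
    using i2[of "''F''"] i2[of "''out''"] by (simp_all add: s5_def s4_def s3_def exec_imem F3_def)
  show "imem s' ''F'' = imem s ''F'' \<and> imem s' ''out'' = imem s ''out''" if "\<not> ok (rounded y)"
    using that O i5 i9[of "''F''"] i9[of "''out''"] by (simp add: s')
  show "imem s' ''F'' [] = 1 \<and> brep s' ''out'' (rounded y)" if "ok (rounded y)"
  proof -
    define sF where "sF = seti ''F'' [] 1 s9"
    have stF: "stat bs sF" using st9 by (rule stat_same) (auto simp: sF_def intro: same_seti)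
    have s'F: "s' = exec n f FC sF" using that O by (simp add: s' sF_def)
    have "imem s' ''F'' [] = 1" by (simp add: s'F exec_imem FC_def sF_def imem_seti)
    moreover have "imem s' ''out'' [j] = of_bool (j \<in> rounded y)" if "j < n" for j
      unfolding s'F FC_def
      by (rule exec_imap[where k = n and val = "\<lambda>j. of_bool (j \<in> rounded y)"])
        (use that smpl(1) i9[of "''S''"] S5 in \<open>auto simp: stat_simps[OF st9] same_def sF_def imem_seti brep_def\<close>)
    ultimately show ?thesis by (simp add: brep_def)
  qed
qed

lemma exec_init:
  assumes st: "stat bs s" and A: "brep s ''A'' A"
  defines "s' \<equiv> exec n f (p_init p c t w) s"
  shows "ready s'" "imem s' ''X'' [] = (if valid then 0 else 1)"
proof -
  define F1 where "F1 = FOR ''j'' ''n'' (IS ''S'' [V ''j''] (IGet ''A'' [V ''j'']))"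
  define F3 where "F3 = FOR ''i'' ''p'' (RS ''r'' [V ''i''] (RSub (Rat 1) (RGet ''h'' [V ''i''])))"
  define F5a where "F5a = IS ''U'' [V ''j''] (ISub (Nat 1) (IGet ''A'' [V ''j'']))"
  define F5b where "F5b = FOR ''i'' ''tc'' (IF (RLess (Rat (1 / of_nat (e1d p c t w))) (RGet ''d'' [V ''i'', V ''j'']))
        (IS ''U'' [V ''j''] (Nat 0)) NOP)"
  define F5c where "F5c = FOR ''i'' ''p'' (IF (RLess (RMul (Rat (1 / of_nat (e2d p w))) (RGet ''r'' [V ''i''])) (RGet ''P'' [V ''i'', V ''j'']))
        (IS ''U'' [V ''j''] (Nat 0)) NOP)"
  define F5 where "F5 = FOR ''j'' ''n'' (F5a ;;; F5b ;;; F5c)"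
  define F6 where "F6 = FOR ''i'' ''tc'' (RS ''D'' [V ''i''] (RSub (Rat (1 - 1 / of_nat (Hc w))) (RGet ''a'' [V ''i''])))"
  define F7 where "F7 = FOR ''i'' ''tc'' (FOR ''j'' ''n'' (RS ''W'' [V ''i'', V ''j''] (RGet ''d'' [V ''i'', V ''j''])))"
  define F8 where "F8 = FOR ''i'' ''p'' (RS ''D'' [IAdd (Nat (t + c)) (V ''i'')] (Rat (- 1)))"
  define F9 where "F9 = FOR ''i'' ''p'' (FOR ''j'' ''n'' (RS ''W'' [IAdd (Nat (t + c)) (V ''i''), V ''j'']
      (RSub (Rat 0) (RDiv (RGet ''P'' [V ''i'', V ''j'']) (RGet ''r'' [V ''i''])))))"
  define F11 where "F11 = FOR ''i'' ''p'' (IF (RLess (RGet ''r'' [V ''i'']) (Rat 0)) (IS ''X'' [] (Nat 1)) NOP)"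
  define s1 where "s1 = exec n f F1 s"
  define s2 where "s2 = exec n f (p_eval t) s1"
  define s3 where "s3 = exec n f F3 s2"
  define s4 where "s4 = exec n f (p_marg t) s3"
  define s5 where "s5 = exec n f F5 s4"
  define s6 where "s6 = exec n f F6 s5"
  define s7 where "s7 = exec n f F7 s6"
  define s8 where "s8 = exec n f F8 s7"
  define s9 where "s9 = exec n f F9 s8"
  define s10 where "s10 = exec n f (IS ''X'' [] (Nat 0)) s9"
  have s': "s' = exec n f F11 s10"
    by (simp only: s'_def p_init_def exec.simps(4) F1_def F3_def F5_def F5a_def F5b_def F5c_def F6_def F7_def
        F8_def F9_def F11_def s1_def s2_def s3_def s4_def s5_def s6_def s7_def s8_def s9_def s10_def)
  note Fs = F1_def F3_def F5_def F5a_def F5b_def F5c_def F6_def F7_def F8_def F9_def F11_def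
  have st1: "stat bs s1" unfolding s1_def by (rule stat_exec[OF st]) (auto simp: Fs static_reals_def)
  have st2: "stat bs s2" unfolding s2_def by (rule stat_exec[OF st1]) (auto simp: Fs static_reals_def)
  have st3: "stat bs s3" unfolding s3_def by (rule stat_exec[OF st2]) (auto simp: Fs static_reals_def)
  have st4: "stat bs s4" unfolding s4_def by (rule stat_exec[OF st3]) (auto simp: Fs static_reals_def)
  have st5: "stat bs s5" unfolding s5_def by (rule stat_exec[OF st4]) (auto simp: Fs static_reals_def)
  have st6: "stat bs s6" unfolding s6_def by (rule stat_exec[OF st5]) (auto simp: Fs static_reals_def)
  have st7: "stat bs s7" unfolding s7_def by (rule stat_exec[OF st6]) (auto simp: Fs static_reals_def)
  have st8: "stat bs s8" unfolding s8_def by (rule stat_exec[OF st7]) (auto simp: Fs static_reals_def)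
  have st9: "stat bs s9" unfolding s9_def by (rule stat_exec[OF st8]) (auto simp: Fs static_reals_def)
  have st10: "stat bs s10" unfolding s10_def by (rule stat_exec[OF st9]) (auto simp: Fs static_reals_def)
  have S1: "brep s1 ''S'' A"
    unfolding brep_def s1_def F1_def
    by (intro allI impI exec_imap[where k = n and val = "\<lambda>j. of_bool (j \<in> A)"])
      (use A in \<open>auto simp: stat_simps[OF st] same_def brep_def\<close>)
  note ev = exec_eval[OF st1 S1, folded s2_def]
  have r3: "rmem s3 ''r'' [i] = rho i" if "i < p" for i
    unfolding s3_def F3_def
    by (rule exec_map(1)[where k = p and ix = "\<lambda>i. [i]" and val = rho])
      (use that ev in \<open>auto simp: stat_simps[OF st2] same_def inj_on_def rho_def\<close>)
  have S3: "brep s3 ''S'' A" using S1 by (simp add: brep_def s3_def s2_def exec_imem F3_def)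
  note marg = exec_marg[OF st3 S3, folded s4_def]
  have r4: "rmem s4 ''r'' = rmem s3 ''r''" by (simp add: s4_def exec_rmem)
  have A4: "brep s4 ''A'' A" using A by (simp add: brep_def s4_def s3_def s2_def s1_def exec_imem F1_def F3_def)
  have U5: "brep s5 ''U'' U"
    unfolding brep_def s5_def F5_def
  proof (rule exec_FOR[where I = "\<lambda>k s'. \<forall>j<k. imem s' ''U'' [j] = of_bool (j \<in> U)"])
    let ?B = "F5a ;;; F5b ;;; F5c"
    fix j sa assume j: "j < n" "imem sa ''j'' [] = j" "\<forall>j'<j. imem sa ''U'' [j'] = of_bool (j' \<in> U)"
      and sm: "same (insert ''j'' (iw ?B)) (rw ?B) s4 sa"
    have sta: "stat bs sa" by (rule stat_same[OF st4 sm]) (auto simp: Fs static_reals_def)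
    have ra: "rmem sa a = rmem s4 a" for a by (rule same_rmem[OF sm]) (simp add: Fs)
    have Aa: "imem sa ''A'' [j] = of_bool (j \<in> A)"
      using same_imem[OF sm, of "''A''"] A4 j(1) by (simp add: Fs brep_def)
    define sb where "sb = exec n f F5a sa"
    define sc where "sc = exec n f F5b sb"
    define sd where "sd = exec n f F5c sc"
    have sb: "sb = seti ''U'' [j] (1 - of_bool (j \<in> A)) sa" using j Aa by (simp add: sb_def F5a_def)
    have stb: "stat bs sb" unfolding sb_def by (rule stat_exec[OF sta]) (auto simp: Fs static_reals_def)
    have stc: "stat bs sc" unfolding sc_def by (rule stat_exec[OF stb]) (auto simp: Fs static_reals_def)
    have jb: "imem sb ''j'' [] = j" using j(2) by (simp add: sb imem_seti)
    have rb: "rmem sb a = rmem s4 a" for a by (simp add: sb ra)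
    have rc: "rmem sc a = rmem s4 a" for a unfolding sc_def rb[symmetric] by (rule exec_rmem) (simp add: Fs)
    have jc: "imem sc ''j'' [] = j" using jb by (simp add: sc_def exec_imem F5b_def)
    have e1: "real_of_rat (1 / of_nat (e1d p c t w)) = e1" "real_of_rat (1 / of_nat (e2d p w)) = e2"
      by (simp_all add: e1_def e2_def of_rat_divide)
    have Uc: "imem sc ''U'' [j] = (if \<exists>i<t + c. e1 < G i (insert j A) - G i A then 0 else imem sb ''U'' [j])"
      unfolding sc_def F5b_def
      by (rule exec_flag(1)) (use jb marg j(1) in \<open>auto simp: stat_simps[OF st4] same_def rb e1\<close>)
    have Uc': "imem sc ''U'' [j'] = imem sb ''U'' [j']" if "j' \<noteq> j" for j'
      unfolding sc_def F5b_def
      by (rule exec_flag(2)[where k = "t + c" and js = "[j]" and Q = "\<lambda>i. e1 < G i (insert j A) - G i A"])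
        (use that jb marg j(1) in \<open>auto simp: stat_simps[OF st4] same_def rb e1\<close>)
    have Ud: "imem sd ''U'' [j] = (if \<exists>i<p. e2 * rho i < P $$ (i, j) then 0 else imem sc ''U'' [j])"
      unfolding sd_def F5c_def
      by (rule exec_flag(1)) (use jc r3 r4 j(1) in \<open>auto simp: stat_simps[OF st4] same_def rc e1\<close>)
    have Ud': "imem sd ''U'' [j'] = imem sc ''U'' [j']" if "j' \<noteq> j" for j'
      unfolding sd_def F5c_def
      by (rule exec_flag(2)[where k = p and js = "[j]" and Q = "\<lambda>i. e2 * rho i < P $$ (i, j)"])
        (use that jc r3 r4 j(1) in \<open>auto simp: stat_simps[OF st4] same_def rc e1\<close>)
    have "imem sd ''U'' [j] = of_bool (j \<in> U)"
      unfolding Ud Uc ex_less_iff using j(1) by (simp add: U_def sb imem_seti)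
    moreover have "imem sd ''U'' [j'] = of_bool (j' \<in> U)" if "j' < j" for j'
      using that Ud'[of j'] Uc'[of j'] j(3) by (simp add: sb imem_seti)
    moreover have "exec n f ?B sa = sd" by (simp add: sb_def sc_def sd_def)
    ultimately show "\<forall>j'<Suc j. imem (exec n f ?B sa) ''U'' [j'] = of_bool (j' \<in> U)"
      by (auto simp: less_Suc_eq)
  qed (auto simp: stat_simps[OF st4] Fs imem_seti)
  have r5: "rmem s5 a = rmem s4 a" for a unfolding s5_def by (rule exec_rmem) (simp add: Fs)
  have D6: "rmem s6 ''D'' [i] = 1 - h - G i A" if "i < t + c" for i
    unfolding s6_def F6_def
    by (rule exec_map(1)[where k = "t + c" and ix = "\<lambda>i. [i]" and val = "\<lambda>i. 1 - h - G i A"])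
      (use that marg in \<open>auto simp: stat_simps[OF st4] same_def inj_on_def r5 h_def of_rat_diff of_rat_divide\<close>)
  have D8: "rmem s8 ''D'' [i] = Ds i" if i: "t \<le> i" "i < M" for i
  proof (cases "i < t + c")
    case True
    have "rmem s8 ''D'' [i] = rmem s7 ''D'' [i]"
      unfolding s8_def F8_def
      by (rule exec_map(2)[where k = p and ix = "\<lambda>i. [t + c + i]" and val = "\<lambda>_. - 1"])
        (use True in \<open>auto simp: stat_simps[OF st7] same_def inj_on_def\<close>)
    then show ?thesis using D6[OF True] True i by (simp add: s7_def exec_rmem F7_def Ds_def \<beta>_def)
  next
    case False
    then obtain q where q: "i = t + c + q" "q < p" using i by (metis add_diff_inverse_nat add_less_cancel_left)
    have "rmem s8 ''D'' [t + c + q] = - 1"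
      unfolding s8_def F8_def
      by (rule exec_map(1)[where k = p and ix = "\<lambda>i. [t + c + i]" and val = "\<lambda>_. - 1"])
        (use q in \<open>auto simp: stat_simps[OF st7] same_def inj_on_def\<close>)
    then show ?thesis using q by (simp add: Ds_def)
  qed
  have W7: "rmem s7 ''W'' [i, j] = G i (insert j A) - G i A" if "i < t + c" "j < n" for i j
    unfolding s7_def F7_def
    by (rule exec_map2(1)[where k = "t + c" and k' = n and ix = "\<lambda>i j. [i, j]" and val = "\<lambda>i j. G i (insert j A) - G i A"])
      (use that marg in \<open>auto simp: stat_simps[OF st4] same_def s6_def F6_def exec_rmem r5\<close>)
  have r8: "rmem s8 ''r'' = rmem s3 ''r''"
    using r4 r5[of "''r''"] by (simp add: s8_def s7_def s6_def exec_rmem F6_def F7_def F8_def)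
  have W9: "rmem s9 ''W'' [i, j] = Ws i j" if i: "i < M" "j < n" for i j
  proof (cases "i < t + c")
    case True
    have "rmem s9 ''W'' [i, j] = rmem s8 ''W'' [i, j]"
      unfolding s9_def F9_def
      by (rule exec_map2(2)[where k = p and k' = n and ix = "\<lambda>i j. [t + c + i, j]" and val = "\<lambda>i j. - (P $$ (i, j) / rho i)"])
        (use True r8 r3 in \<open>auto simp: stat_simps[OF st8] same_def stat_simps[OF st8]\<close>)
    then show ?thesis using W7[OF True i(2)] True by (simp add: s8_def exec_rmem F8_def Ws_def)
  next
    case False
    then obtain q where q: "i = t + c + q" "q < p" using i by (metis add_diff_inverse_nat add_less_cancel_left)
    have "rmem s9 ''W'' [t + c + q, j] = - (P $$ (q, j) / rho q)"
      unfolding s9_def F9_def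
      by (rule exec_map2(1)[where k = p and k' = n and ix = "\<lambda>i j. [t + c + i, j]" and val = "\<lambda>i j. - (P $$ (i, j) / rho i)"])
        (use q i(2) r8 r3 in \<open>auto simp: stat_simps[OF st8] same_def\<close>)
    then show ?thesis using q by (simp add: Ws_def)
  qed
  have D9: "rmem s9 ''D'' = rmem s8 ''D''" by (simp add: s9_def exec_rmem F9_def)
  have i10: "imem s10 a = imem s5 a" if "a \<notin> {''i'', ''j'', ''X''}" for a
    using that by (simp add: s10_def s9_def s8_def s7_def s6_def exec_imem imem_seti F6_def F7_def F8_def F9_def)
  have i': "imem s' a = imem s5 a" if "a \<notin> {''i'', ''j'', ''X''}" for a
    unfolding s' i10[OF that, symmetric] by (rule exec_imem) (use that in \<open>simp add: F11_def\<close>)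
  have r': "rmem s' a = rmem s9 a" for a
  proof -
    have "rmem s' a = rmem s10 a" unfolding s' by (rule exec_rmem) (simp add: F11_def)
    then show ?thesis by (simp add: s10_def)
  qed
  have A5: "imem s5 ''A'' = imem s4 ''A''" unfolding s5_def by (rule exec_imem) (simp add: Fs)
  show "ready s'"
    using U5 A4 A5 i' r' D8 D9 W9 by (simp add: ready_def brep_def)
  have r10: "rmem s10 ''r'' [i] = rho i" if "i < p" for i
    using r3[OF that] r8 by (simp add: s10_def s9_def exec_rmem F9_def)
  have "imem s' ''X'' [] = (if \<exists>i<p. rho i < 0 then 1 else imem s10 ''X'' [])"
    unfolding s' F11_def
    by (rule exec_flag(1)) (use r10 in \<open>auto simp: stat_simps[OF st10] same_def\<close>)
  then show "imem s' ''X'' [] = (if valid then 0 else 1)"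
    by (auto simp: valid_def s10_def imem_seti not_le not_less)
qed

end

section \<open>Enumeration of the guesses\<close>

text \<open>All these names begin with two letters x, which separates them from every other array.
  Only constantly many occur, since the number of guessed elements does not depend on
  \<open>n\<close>.\<close>

definition digit :: "nat \<Rightarrow> string" where
  "digit k = CHR ''x'' # CHR ''x'' # replicate k CHR ''x''"

lemma inj_digit: "digit j = digit k \<longleftrightarrow> j = k"
  by (auto simp: digit_def)

text \<open>Each digit runs through \<open>n + 1\<close> values; the value \<open>n\<close> lies
  outside the ground set and stands for guessing no element.\<close>

primrec nest :: "nat \<Rightarrow> prog \<Rightarrow> prog" where
  "nest 0 body = body"
| "nest (Suc k) body = FOR (digit k) ''nn'' (nest k body)"

primrec p_marks :: "nat \<Rightarrow> prog" where
  "p_marks 0 = NOP"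
| "p_marks (Suc k) = p_marks k ;;; IS ''A'' [V (digit k)] (Nat 1)"

text \<open>The sets of digit values in the order in which \<open>nest\<close> visits them.\<close>

primrec glist :: "nat \<Rightarrow> nat \<Rightarrow> nat set \<Rightarrow> nat set list" where
  "glist n 0 X = [X]"
| "glist n (Suc k) X = concat (map (\<lambda>d. glist n k (insert d X)) [0..<Suc n])"

lemma length_glist: "length (glist n k X) = (n + 1) ^ k"
  by (induction k arbitrary: X) (auto simp: length_concat comp_def sum_list_triv)

text \<open>Sets with fewer than \<open>k\<close> elements are reached through the filler value
  \<open>n\<close>, which the intersection with the ground set removes.\<close>

lemma glist_complete:
  assumes "Y \<subseteq> {..<n}" "card Y \<le> k"
  shows "\<exists>Z\<in>set (glist n k X). Z \<inter> {..<n} = (X \<union> Y) \<inter> {..<n}"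
  using assms
proof (induction k arbitrary: X Y)
  case 0
  then have "Y = {}" using finite_subset[of Y "{..<n}"] by auto
  then show ?case by simp
next
  case (Suc k)
  have fin: "finite Y" using Suc.prems(1) finite_subset by blast
  obtain d Y' where d: "d \<le> n" "Y' \<subseteq> {..<n}" "card Y' \<le> k"
    "(insert d X \<union> Y') \<inter> {..<n} = (X \<union> Y) \<inter> {..<n}"
  proof (cases "Y = {}")
    case True
    then show ?thesis using that[of n "{}"] by auto
  next
    case False
    then obtain d where "d \<in> Y" by blast
    moreover from this have "insert d X \<union> (Y - {d}) = X \<union> Y" by blast
    ultimately show ?thesis
      using that[of d "Y - {d}"] Suc.prems fin by (auto simp: card_Diff_singleton subset_eq)
  qed
  from Suc.IH[OF d(2,3), of "insert d X"] obtain Z where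
    Z: "Z \<in> set (glist n k (insert d X))" "Z \<inter> {..<n} = (insert d X \<union> Y') \<inter> {..<n}" by blast
  have "d \<in> set [0..<Suc n]" using d(1) by auto
  then have "Z \<in> set (glist n (Suc k) X)"
    using Z(1) unfolding glist.simps set_concat set_map by blast
  then show ?case using Z(2) d(4) by (intro bexI[of _ Z]) simp_all
qed

lemma nest_sets:
  "iw (nest k body) = iw body \<union> digit ` {..<k}" "rw (nest k body) = rw body"
  "bounds (nest k body) = bounds body \<union> (if k = 0 then {} else {''nn''})"
  by (induction k) (auto simp: lessThan_Suc)

lemma wf_nest:
  assumes "wf_prog body" "iw body \<inter> range digit = {}"
  shows "wf_prog (nest k body)"
  using assms by (induction k) (auto simp: nest_sets inj_digit)

lemma p_marks_sets: "iw (p_marks k) \<subseteq> {''A''}" "rw (p_marks k) = {}" "bounds (p_marks k) = {}" "wf_prog (p_marks k)"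
  by (induction k) auto

lemma digit_neq_A: "digit k \<noteq> ''A''"
  by (simp add: digit_def)

lemma exec_marks:
  "imem (exec n f (p_marks k) s) ''A'' [j]
    = (if j \<in> (\<lambda>i. imem s (digit i) []) ` {..<k} then 1 else imem s ''A'' [j])"
proof (induction k)
  case (Suc k)
  have "imem (exec n f (p_marks k) s) (digit k) = imem s (digit k)"
    by (rule exec_imem) (use p_marks_sets(1)[of k] digit_neq_A in auto)
  then show ?case using Suc by (auto simp: imem_seti lessThan_Suc)
qed simp

text \<open>The invariant carries the list of digit sets processed so far, so that properties of the
  whole enumeration can refer to the position of a guess. At depth \<open>k\<close> the outer digits
  are already fixed in memory and form the accumulator of \<open>glist\<close>.\<close>

lemma exec_nest:
  assumes body: "\<And>As s. I As s \<Longrightarrow> I (As @ [(\<lambda>i. imem s (digit i) []) ` {..<K}]) (exec n f body s)"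
    and nn: "\<And>As s. I As s \<Longrightarrow> rmem s ''nn'' [] = real (n + 1)"
    and stable: "\<And>As s k d. I As s \<Longrightarrow> I As (seti (digit k) [] d s)"
    and iw: "iw body \<inter> range digit = {}"
  shows "k \<le> K \<Longrightarrow> I As s \<Longrightarrow>
    I (As @ glist n k ((\<lambda>i. imem s (digit i) []) ` {k..<K})) (exec n f (nest k body) s)"
proof (induction k arbitrary: As s)
  case 0
  then show ?case using body by (simp add: atLeast0LessThan)
next
  case (Suc k)
  let ?X = "(\<lambda>i. imem s (digit i) []) ` {Suc k..<K}"
  let ?gs = "\<lambda>d. concat (map (\<lambda>d. glist n k (insert d ?X)) [0..<d])"
  have "I (As @ ?gs (n + 1)) (exec n f (FOR (digit k) ''nn'' (nest k body)) s)"
  proof (rule exec_FOR[where I = "\<lambda>d s'. I (As @ ?gs d) s'"])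
    show "rmem s ''nn'' [] = real (n + 1)" by (rule nn[OF Suc.prems(2)])
    show "digit k \<notin> iw (nest k body)" using iw by (auto simp: nest_sets inj_digit)
    show "I (As @ ?gs 0) s" using Suc.prems by simp
  next
    fix d s' assume d: "d < n + 1" "imem s' (digit k) [] = d" "I (As @ ?gs d) s'"
      and sm: "same (insert (digit k) (iw (nest k body))) (rw (nest k body)) s s'"
    have "imem s' (digit i) = imem s (digit i)" if "i \<in> {Suc k..<K}" for i
      using that iw by (intro same_imem[OF sm]) (auto simp: nest_sets inj_digit)
    then have "(\<lambda>i. imem s' (digit i) []) ` {Suc k..<K} = ?X" by (intro image_cong) auto
    moreover have "{k..<K} = insert k {Suc k..<K}" using Suc.prems by auto
    ultimately have X: "(\<lambda>i. imem s' (digit i) []) ` {k..<K} = insert d ?X" using d(2) by simp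
    have "I ((As @ ?gs d) @ glist n k ((\<lambda>i. imem s' (digit i) []) ` {k..<K})) (exec n f (nest k body) s')"
      using Suc.prems d(3) by (intro Suc.IH) auto
    then show "I (As @ ?gs (Suc d)) (exec n f (nest k body) s')" unfolding X by simp
  qed (use stable in auto)
  then show ?case by simp
qed

text \<open>The loop counter \<open>r\<close> is a natural and the budgets \<open>r\<close> are
  reals; they live in different memories.\<close>

definition p_body :: "nat \<Rightarrow> nat \<Rightarrow> nat \<Rightarrow> nat \<Rightarrow> rat \<Rightarrow> prog" where
  "p_body p c t w \<kappa> =
    FOR ''j'' ''n'' (IS ''A'' [V ''j''] (Nat 0)) ;;;
    p_marks (guesses p c t w) ;;;
    p_init p c t w ;;;
    FOR ''r'' ''K'' (p_run w t \<kappa>) ;;;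
    IF (ILess (Nat 0) (V ''X'')) NOP (IS ''Z'' [] (Nat 1))"

lemma p_body_sets:
  "iw (p_body p c t w \<kappa>) \<subseteq> {''i'', ''j'', ''l'', ''u'', ''b'', ''q'', ''S'', ''m'', ''o'', ''Y'', ''X'', ''k'', ''s'',
     ''O'', ''F'', ''out'', ''U'', ''A'', ''r'', ''Z''}"
  "rw (p_body p c t w \<kappa>) = {''D'', ''W'', ''g'', ''h'', ''a'', ''d'', ''z'', ''l'', ''x'', ''e'', ''y'', ''r''}"
  "bounds (p_body p c t w \<kappa>) = {''t'', ''c'', ''p'', ''n'', ''tc'', ''m'', ''b'', ''M'', ''T'', ''K''}"
  "wf_prog (p_body p c t w \<kappa>)"
proof -
  note m = p_marks_sets[of "guesses p c t w"]
  have "iw (p_marks (guesses p c t w)) \<subseteq> X" if "''A'' \<in> X" for X using m(1) that by blast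
  then show "iw (p_body p c t w \<kappa>) \<subseteq> {''i'', ''j'', ''l'', ''u'', ''b'', ''q'', ''S'', ''m'', ''o'', ''Y'', ''X'', ''k'', ''s'',
     ''O'', ''F'', ''out'', ''U'', ''A'', ''r'', ''Z''}"
    by (simp add: p_body_def)
  show "rw (p_body p c t w \<kappa>) = {''D'', ''W'', ''g'', ''h'', ''a'', ''d'', ''z'', ''l'', ''x'', ''e'', ''y'', ''r''}"
    "bounds (p_body p c t w \<kappa>) = {''t'', ''c'', ''p'', ''n'', ''tc'', ''m'', ''b'', ''M'', ''T'', ''K''}"
    by (auto simp: p_body_def m(2,3))
  show "wf_prog (p_body p c t w \<kappa>)" by (simp add: p_body_def m(4))
qed

lemma p_body_digit: "iw (p_body p c t w \<kappa>) \<inter> range digit = {}"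
proof -
  have "digit k \<notin> iw (p_body p c t w \<kappa>)" for k
    by (rule contra_subsetD[OF p_body_sets(1)]) (simp add: digit_def)
  then show ?thesis by blast
qed

section \<open>The search over all guesses\<close>

context inst
begin

abbreviation cert_of :: "nat set \<Rightarrow> bool list \<Rightarrow> bool" where
  "cert_of \<equiv> guess.certified p c t n w f P C v"
abbreviation rounded_of :: "nat set \<Rightarrow> bool list \<Rightarrow> nat set" where
  "rounded_of \<equiv> guess.rounded p c t n w f P C v"

text \<open>Every run is executed, even after a success, so run \<open>k\<close> of guess
  \<open>\<gamma>\<close> reads its bits at a fixed position. This keeps the runs
  independent.\<close>

definition refuted :: "bool list \<Rightarrow> nat set \<Rightarrow> nat \<Rightarrow> bool" where
  "refuted bs A \<gamma> \<longleftrightarrow> \<not> guess.valid p n P A \<or> (\<exists>k<reps. cert_of A (blk Q (\<gamma> * reps + k) bs))"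

definition unsolved :: "bool list \<Rightarrow> nat set \<Rightarrow> nat \<Rightarrow> bool" where
  "unsolved bs A \<gamma> \<longleftrightarrow> (\<forall>k<reps. \<not> ok (rounded_of A (blk Q (\<gamma> * reps + k) bs)))"

text \<open>Everything beyond \<open>stat\<close> is conditional on there being enough bits, because
  \<open>exec_nest\<close> demands a step for arbitrary lists, without a bound on their
  length.\<close>

definition searched :: "bool list \<Rightarrow> nat set list \<Rightarrow> state \<Rightarrow> bool" where
  "searched bs As s \<longleftrightarrow> stat bs s \<and> (length As * reps * Q \<le> length bs \<longrightarrow>
     imem s ''q'' [] = length As * reps * Q \<and>
     (imem s ''F'' [] \<noteq> 0 \<longrightarrow> (\<exists>S\<subseteq>{..<n}. ok S \<and> brep s ''out'' S)) \<and>
     (imem s ''F'' [] = 0 \<longrightarrow> (\<forall>\<gamma><length As. unsolved bs (As ! \<gamma> \<inter> {..<n}) \<gamma>)) \<and>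
     (imem s ''Z'' [] = 0 \<longleftrightarrow> (\<forall>\<gamma><length As. refuted bs (As ! \<gamma> \<inter> {..<n}) \<gamma>)))"

lemma searched_step:
  assumes I: "searched bs As s"
  shows "searched bs (As @ [(\<lambda>i. imem s (digit i) []) ` {..<guesses p c t w}])
    (exec n f (p_body p c t w \<kappa>) s)"
proof -
  let ?X = "(\<lambda>i. imem s (digit i) []) ` {..<guesses p c t w}"
  define A where "A = ?X \<inter> {..<n}"
  interpret guess p c t n w f P C v \<kappa> A by unfold_locales (simp add: A_def)
  define F1 where "F1 = FOR ''j'' ''n'' (IS ''A'' [V ''j''] (Nat 0))"
  define F4 where "F4 = FOR ''r'' ''K'' (p_run w t \<kappa>)"
  define F5 where "F5 = IF (ILess (Nat 0) (V ''X'')) NOP (IS ''Z'' [] (Nat 1))"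
  define s1 where "s1 = exec n f F1 s"
  define s2 where "s2 = exec n f (p_marks (guesses p c t w)) s1"
  define s3 where "s3 = exec n f (p_init p c t w) s2"
  define s4 where "s4 = exec n f F4 s3"
  define s' where "s' = exec n f F5 s4"
  have s': "exec n f (p_body p c t w \<kappa>) s = s'"
    by (simp only: p_body_def exec.simps(4) F1_def F4_def F5_def s1_def s2_def s3_def s4_def s'_def)
  have st: "stat bs s" using I by (simp add: searched_def)
  have st1: "stat bs s1" unfolding s1_def by (rule stat_exec[OF st]) (auto simp: F1_def static_reals_def)
  have st2: "stat bs s2" unfolding s2_def
    by (rule stat_exec[OF st1]) (use p_marks_sets[of "guesses p c t w"] in \<open>auto simp: static_reals_def\<close>)
  have st3: "stat bs s3" unfolding s3_def by (rule stat_exec[OF st2]) (auto simp: static_reals_def)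
  have st4: "stat bs s4" unfolding s4_def by (rule stat_exec[OF st3]) (auto simp: F4_def static_reals_def)
  have st': "stat bs s'" unfolding s'_def by (rule stat_exec[OF st4]) (auto simp: F5_def static_reals_def)
  have A1: "imem s1 ''A'' [j] = 0" if "j < n" for j
    unfolding s1_def F1_def by (rule exec_imap[where k = n and val = "\<lambda>_. 0"])
      (use that in \<open>auto simp: stat_simps[OF st]\<close>)
  have d1: "imem s1 (digit i) = imem s (digit i)" for i
    unfolding s1_def by (rule exec_imem) (simp add: F1_def digit_def)
  have A2: "brep s2 ''A'' A"
    using A1 by (simp add: brep_def s2_def exec_marks d1 A_def)
  note init = exec_init[OF st2 A2, folded s3_def]
  have i3: "imem s3 a = imem s a" if "a \<in> {''q'', ''F'', ''Z'', ''out''}" for a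
  proof -
    have "imem s3 a = imem s2 a" unfolding s3_def by (rule exec_imem) (use that in auto)
    also have "\<dots> = imem s1 a" unfolding s2_def
      by (rule exec_imem) (use that p_marks_sets(1)[of "guesses p c t w"] in auto)
    also have "\<dots> = imem s a" unfolding s1_def by (rule exec_imem) (use that in \<open>auto simp: F1_def\<close>)
    finally show ?thesis .
  qed
  have "imem s' ''q'' [] = length (As @ [?X]) * reps * Q \<and>
     (imem s' ''F'' [] \<noteq> 0 \<longrightarrow> (\<exists>S\<subseteq>{..<n}. ok S \<and> brep s' ''out'' S)) \<and>
     (imem s' ''F'' [] = 0 \<longrightarrow> (\<forall>\<gamma><length (As @ [?X]). unsolved bs ((As @ [?X]) ! \<gamma> \<inter> {..<n}) \<gamma>)) \<and>
     (imem s' ''Z'' [] = 0 \<longleftrightarrow> (\<forall>\<gamma><length (As @ [?X]). refuted bs ((As @ [?X]) ! \<gamma> \<inter> {..<n}) \<gamma>))"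
    if len: "length (As @ [?X]) * reps * Q \<le> length bs"
  proof -
    let ?l = "length As"
    have len': "(?l * reps + reps) * Q \<le> length bs" using len by (simp add: algebra_simps)
    have "?l * reps * Q \<le> (?l * reps + reps) * Q" by (intro mult_le_mono1) simp
    then have "?l * reps * Q \<le> length bs" using len' by (rule order_trans)
    then have core: "imem s ''q'' [] = ?l * reps * Q"
      "imem s ''F'' [] \<noteq> 0 \<longrightarrow> (\<exists>S\<subseteq>{..<n}. ok S \<and> brep s ''out'' S)"
      "imem s ''F'' [] = 0 \<longrightarrow> (\<forall>\<gamma><?l. unsolved bs (As ! \<gamma> \<inter> {..<n}) \<gamma>)"
      "imem s ''Z'' [] = 0 \<longleftrightarrow> (\<forall>\<gamma><?l. refuted bs (As ! \<gamma> \<inter> {..<n}) \<gamma>)"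
      using I unfolding searched_def by blast+
    let ?y = "\<lambda>k. blk Q (?l * reps + k) bs"
    define J where "J k s' \<longleftrightarrow> ready s' \<and> imem s' ''q'' [] = (?l * reps + k) * Q \<and>
      (imem s' ''X'' [] = 0 \<longleftrightarrow> valid \<and> (\<forall>k'<k. \<not> certified (?y k'))) \<and>
      (imem s' ''F'' [] \<noteq> 0 \<longrightarrow> (\<exists>S\<subseteq>{..<n}. ok S \<and> brep s' ''out'' S)) \<and>
      (imem s' ''F'' [] = 0 \<longrightarrow> imem s ''F'' [] = 0 \<and> (\<forall>k'<k. \<not> ok (rounded (?y k'))))" for k and s' :: state
    have "J reps s4" unfolding s4_def F4_def
    proof (rule exec_FOR)
      show "J 0 s3" using init core(1,2) i3 by (auto simp: J_def brep_def)
    next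
      fix k sa assume k: "k < reps" "J k sa"
        and sm: "same (insert ''r'' (iw (p_run w t \<kappa>))) (rw (p_run w t \<kappa>)) s3 sa"
      have sta: "stat bs sa" by (rule stat_same[OF st3 sm]) (auto simp: static_reals_def)
      have "?l * reps + k + 1 \<le> ?l * reps + reps" using k(1) by simp
      then have "(?l * reps + k + 1) * Q \<le> (?l * reps + reps) * Q" by (rule mult_le_mono1)
      then have ql: "(?l * reps + k) * Q + Q \<le> length bs" using len' by (simp add: algebra_simps)
      have rda: "ready sa" and qa: "imem sa ''q'' [] = (?l * reps + k) * Q" using k(2) by (auto simp: J_def)
      note run = exec_run[OF sta rda qa ql, folded blk_def]
      show "J (Suc k) (exec n f (p_run w t \<kappa>) sa)"
      proof (cases "ok (rounded (?y k))")
        case True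
        then show ?thesis
          using run(1,2,3) run(4)[OF True] k(2) rounded_sub[of "?y k"]
          by (auto simp: J_def less_Suc_eq algebra_simps)
      next
        case False
        then show ?thesis
          using run(1,2,3) run(5)[OF False] k(2)
          by (auto simp: J_def less_Suc_eq algebra_simps brep_def)
      qed
    qed (auto simp: stat_simps[OF st3] J_def imem_seti ready_def brep_def)
    then have J4: "imem s4 ''q'' [] = (?l * reps + reps) * Q"
      "imem s4 ''X'' [] = 0 \<longleftrightarrow> valid \<and> (\<forall>k'<reps. \<not> certified (?y k'))"
      "imem s4 ''F'' [] \<noteq> 0 \<longrightarrow> (\<exists>S\<subseteq>{..<n}. ok S \<and> brep s4 ''out'' S)"
      "imem s4 ''F'' [] = 0 \<longrightarrow> imem s ''F'' [] = 0 \<and> (\<forall>k'<reps. \<not> ok (rounded (?y k')))"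
      by (auto simp: J_def)
    have Z4: "imem s4 ''Z'' = imem s ''Z''" using i3[of "''Z''"] by (simp add: s4_def exec_imem F4_def)
    have fr: "imem s' a = imem s4 a" if "a \<noteq> ''Z''" for a
      unfolding s'_def by (rule exec_imem) (use that in \<open>simp add: F5_def\<close>)
    have ref: "refuted bs A ?l \<longleftrightarrow> imem s4 ''X'' [] \<noteq> 0" using J4(2) by (auto simp: refuted_def)
    have Z': "imem s' ''Z'' [] = 0 \<longleftrightarrow> imem s ''Z'' [] = 0 \<and> refuted bs A ?l"
      unfolding ref s'_def F5_def using Z4 by (auto simp: imem_seti)
    show ?thesis
    proof (intro conjI)
      show "imem s' ''q'' [] = length (As @ [?X]) * reps * Q" using J4(1) fr[of "''q''"] by (simp add: algebra_simps)
      show "imem s' ''F'' [] \<noteq> 0 \<longrightarrow> (\<exists>S\<subseteq>{..<n}. ok S \<and> brep s' ''out'' S)"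
        using J4(3) fr[of "''F''"] fr[of "''out''"] by (simp add: brep_def)
      show "imem s' ''F'' [] = 0 \<longrightarrow> (\<forall>\<gamma><length (As @ [?X]). unsolved bs ((As @ [?X]) ! \<gamma> \<inter> {..<n}) \<gamma>)"
        using J4(4) fr[of "''F''"] core(3) by (auto simp: nth_append less_Suc_eq A_def[symmetric] unsolved_def)
      show "imem s' ''Z'' [] = 0 \<longleftrightarrow> (\<forall>\<gamma><length (As @ [?X]). refuted bs ((As @ [?X]) ! \<gamma> \<inter> {..<n}) \<gamma>)"
        unfolding Z' core(4) by (auto simp: nth_append less_Suc_eq A_def)
    qed
  qed
  then show ?thesis unfolding s' searched_def using st' by blast
qed

lemma searched_seti: "searched bs As s \<Longrightarrow> searched bs As (seti (digit k) [] d s)"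
proof -
  assume I: "searched bs As s"
  have "stat bs (seti (digit k) [] d s)"
    by (rule stat_same[of bs s "{digit k}" "{}"]) (use I in \<open>auto simp: searched_def same_seti digit_def\<close>)
  moreover have "imem (seti (digit k) [] d s) a = imem s a" if "a \<in> {''q'', ''F'', ''Z'', ''out''}" for a
    using that by (auto simp: imem_seti digit_def)
  ultimately show ?thesis using I unfolding searched_def brep_def by simp
qed

definition cands :: "nat set list" where
  "cands = glist n (guesses p c t w) {}"

lemma exec_search:
  assumes "stat bs s" "imem s ''q'' [] = 0" "imem s ''F'' [] = 0" "imem s ''Z'' [] = 0"
  shows "searched bs cands (exec n f (nest (guesses p c t w) (p_body p c t w \<kappa>)) s)"
proof -
  have "searched bs [] s" using assms by (simp add: searched_def)
  then have "searched bs ([] @ glist n (guesses p c t w)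
      ((\<lambda>i. imem s (digit i) []) ` {guesses p c t w..<guesses p c t w}))
      (exec n f (nest (guesses p c t w) (p_body p c t w \<kappa>)) s)"
    by (intro exec_nest[OF searched_step _ searched_seti p_body_digit])
      (auto simp: searched_def stat_simps)
  then show ?thesis by (simp add: cands_def)
qed

text \<open>Soundness of certificates for arbitrary bits: the guess that \<open>exists_guess\<close>
  extracts from a solution occurs in the enumeration, and \<open>no_certificate\<close> forbids
  refuting it.\<close>

lemma all_refuted:
  assumes "\<forall>\<gamma><length cands. refuted bs (cands ! \<gamma> \<inter> {..<n}) \<gamma>"
  shows "\<not> (\<exists>S. feasible p c n P C S \<and> (\<forall>i<t. f i S \<ge> v $ i))"
proof
  assume "\<exists>S. feasible p c n P C S \<and> (\<forall>i<t. f i S \<ge> v $ i)"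
  then obtain S where S: "feasible p c n P C S" "\<forall>i<t. f i S \<ge> v $ i" by blast
  note SG = feasible_G[OF S]
  obtain A where A: "A \<subseteq> S" "card A \<le> guesses p c t w"
    "\<forall>j\<in>S - A. \<forall>i<t + c. G i (insert j A) - G i A \<le> e1" using exists_guess[OF SG(1)] by blast
  have An: "A \<subseteq> {..<n}" using A(1) SG(1) by blast
  obtain Z where "Z \<in> set cands" "Z \<inter> {..<n} = A"
    using glist_complete[OF An A(2), of "{}"] An by (auto simp: cands_def Int_absorb2)
  then obtain \<gamma> where \<gamma>: "\<gamma> < length cands" "cands ! \<gamma> \<inter> {..<n} = A" by (auto simp: in_set_conv_nth)
  interpret guess p c t n w f P C v \<kappa> A by unfold_locales (rule An)
  have "valid" using no_certificate(1)[OF SG A(1,3)] by simp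
  moreover have "\<not> certified r" for r using no_certificate(2)[OF SG A(1,3)] by simp
  ultimately show False using assms \<gamma> by (auto simp: refuted_def)
qed

text \<open>A guess is stuck only if all its independent runs neither refute it nor yield a
  solution, which has probability at most \<open>(1 / 2) ^ reps\<close>; the union bound over the
  guesses uses \<open>n + 1 \<le> 2 ^ n\<close>.\<close>

lemma prob_stuck:
  assumes \<kappa>: "of_rat \<kappa> \<le> 1 - 1 / exp 1 - 7 * h" and R: "length cands * reps * Q \<le> R"
  shows "bavg R (\<lambda>r. of_bool (\<exists>\<gamma><length cands. \<not> refuted r (cands ! \<gamma> \<inter> {..<n}) \<gamma>
    \<and> unsolved r (cands ! \<gamma> \<inter> {..<n}) \<gamma>)) \<le> 1 / 4"
proof -
  let ?A = "\<lambda>\<gamma>. cands ! \<gamma> \<inter> {..<n}"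
  let ?B = "\<lambda>\<gamma> r. \<not> refuted r (?A \<gamma>) \<gamma> \<and> unsolved r (?A \<gamma>) \<gamma>"
  have one: "bavg R (\<lambda>r. of_bool (?B \<gamma> r)) \<le> (1 / 2) ^ reps" if \<gamma>: "\<gamma> < length cands" for \<gamma>
  proof -
    interpret guess p c t n w f P C v \<kappa> "?A \<gamma>" by unfold_locales simp
    let ?fail = "\<lambda>y. of_bool (\<not> certified y \<and> \<not> ok (rounded y)) :: real"
    show ?thesis
    proof (cases valid)
      case True
      have le: "\<gamma> * (reps * Q) + reps * Q \<le> R"
      proof -
        have "(\<gamma> + 1) * (reps * Q) \<le> length cands * (reps * Q)" using \<gamma> by (intro mult_le_mono1) simp
        then show ?thesis using R by (simp add: algebra_simps)
      qed
      have pt: "of_bool (?B \<gamma> r) \<le> (\<Prod>k<reps. ?fail (blk Q k (take (reps * Q) (drop (\<gamma> * (reps * Q)) r))))" for r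
      proof (cases "?B \<gamma> r")
        case B: True
        have "blk Q k (take (reps * Q) (drop (\<gamma> * (reps * Q)) r)) = blk Q (\<gamma> * reps + k) r" if "k < reps" for k
          using blk_take_drop[OF that, of Q "\<gamma> * (reps * Q)" r] by (simp add: blk_def algebra_simps)
        then have "(\<Prod>k<reps. ?fail (blk Q k (take (reps * Q) (drop (\<gamma> * (reps * Q)) r)))) = 1"
          using B by (intro prod.neutral) (auto simp: refuted_def unsolved_def)
        then show ?thesis by simp
      next
        case False
        then show ?thesis by (simp only: of_bool_eq) (rule prod_nonneg, simp)
      qed
      have "bavg R (\<lambda>r. of_bool (?B \<gamma> r))
          \<le> bavg R (\<lambda>r. \<Prod>k<reps. ?fail (blk Q k (take (reps * Q) (drop (\<gamma> * (reps * Q)) r))))"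
        by (intro bavg_le pt)
      also have "\<dots> \<le> (1 / 2) ^ reps"
      proof (rule bavg_adaptive[where h = "\<lambda>_ y. \<Prod>k<reps. ?fail (blk Q k y)"])
        have "bavg Q ?fail ^ reps \<le> (1 / 2) ^ reps"
        proof (rule power_mono)
          show "bavg Q ?fail \<le> 1 / 2" by (rule run_failure[OF True \<kappa>])
          show "0 \<le> bavg Q ?fail" using bavg_le[of Q "\<lambda>_. 0" ?fail] by simp
        qed
        then show "bavg (reps * Q) (\<lambda>y. \<Prod>k<reps. ?fail (blk Q k y)) \<le> (1 / 2) ^ reps"
          using bavg_blk_prod[of reps Q ?fail] by (simp only:)
      qed (rule le)
      finally show ?thesis .
    next
      case False
      then have "refuted r (?A \<gamma>) \<gamma>" for r by (simp add: refuted_def)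
      then show ?thesis by simp
    qed
  qed
  have pt: "of_bool (\<exists>\<gamma><length cands. ?B \<gamma> r) \<le> (\<Sum>\<gamma><length cands. of_bool (?B \<gamma> r) :: real)" for r
  proof (cases "\<exists>\<gamma><length cands. ?B \<gamma> r")
    case True
    then obtain \<gamma> where \<gamma>: "\<gamma> < length cands" "?B \<gamma> r" by blast
    have "(of_bool (?B \<gamma> r) :: real) \<le> (\<Sum>\<gamma><length cands. of_bool (?B \<gamma> r))"
      by (rule member_le_sum) (use \<gamma>(1) in auto)
    moreover have "(of_bool (?B \<gamma> r) :: real) = 1" using \<gamma>(2) by simp
    moreover have "(of_bool (\<exists>\<gamma><length cands. ?B \<gamma> r) :: real) = 1" using True by simp
    ultimately show ?thesis by linarith
  next
    case False
    then have "(of_bool (\<exists>\<gamma><length cands. ?B \<gamma> r) :: real) = 0" by simp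
    moreover have "0 \<le> (\<Sum>\<gamma><length cands. of_bool (?B \<gamma> r) :: real)" by (rule sum_nonneg) simp
    ultimately show ?thesis by linarith
  qed
  have "bavg R (\<lambda>r. of_bool (\<exists>\<gamma><length cands. ?B \<gamma> r))
      \<le> bavg R (\<lambda>r. \<Sum>\<gamma><length cands. of_bool (?B \<gamma> r))" by (intro bavg_le pt)
  also have "\<dots> = (\<Sum>\<gamma><length cands. bavg R (\<lambda>r. of_bool (?B \<gamma> r)))" by (rule bavg_sum)
  also have "\<dots> \<le> (\<Sum>\<gamma><length cands. (1 / 2) ^ reps)" using one by (intro sum_mono) auto
  also have "\<dots> = real ((n + 1) ^ guesses p c t w) * (1 / 2) ^ reps" by (simp add: cands_def length_glist)
  also have "\<dots> \<le> (2 ^ n) ^ guesses p c t w * (1 / 2) ^ reps"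
  proof (intro mult_right_mono)
    have "n + 1 \<le> 2 ^ n" by (induction n) auto
    then have "(n + 1) ^ guesses p c t w \<le> (2 ^ n) ^ guesses p c t w" by (rule power_mono) simp
    then have "real ((n + 1) ^ guesses p c t w) \<le> real ((2 ^ n) ^ guesses p c t w)" by (rule of_nat_mono)
    then show "real ((n + 1) ^ guesses p c t w) \<le> (2 ^ n) ^ guesses p c t w" by simp
  qed simp
  also have "\<dots> = 1 / 4"
    by (simp add: reps_def power_add power_mult[symmetric] mult.commute power_one_over power2_eq_square)
  finally show ?thesis .
qed

end

section \<open>Running time and the main theorem\<close>

primrec rpow :: "rexp \<Rightarrow> nat \<Rightarrow> rexp" where
  "rpow e 0 = Rat 1"
| "rpow e (Suc k) = RMul e (rpow e k)"

lemma rval_rpow [simp]: "rval n f s (rpow e k) = rval n f s e ^ k"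
  by (induction k) auto

definition p_consts :: "nat \<Rightarrow> nat \<Rightarrow> nat \<Rightarrow> nat \<Rightarrow> nat \<Rightarrow> nat \<Rightarrow> prog" where
  "p_consts p c t w a k =
    RS ''n'' [] (OfNat (V ''n'')) ;;;
    RS ''nn'' [] (RAdd (OfNat (V ''n'')) (Rat 1)) ;;;
    RS ''t'' [] (Rat (of_nat t)) ;;;
    RS ''c'' [] (Rat (of_nat c)) ;;;
    RS ''p'' [] (Rat (of_nat p)) ;;;
    RS ''tc'' [] (Rat (of_nat (t + c))) ;;;
    RS ''M'' [] (Rat (of_nat (t + c + p))) ;;;
    RS ''Nm'' [] (RMul (Rat (of_nat ((t + c + p + 1) * (Hc w)\<^sup>2))) (rpow (RAdd (OfNat (V ''n'')) (Rat 2)) 2)) ;;;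
    RS ''K'' [] (RAdd (RMul (Rat (of_nat (guesses p c t w))) (OfNat (V ''n''))) (Rat 2)) ;;;
    RS ''L'' [] (RMul (Rat (of_nat a)) (rpow (RAdd (OfNat (V ''n'')) (Rat 2)) k)) ;;;
    IS ''N'' [] (Nat 1)"

text \<open>Programs have no logarithm and no rounding, so \<open>2 ^ b\<close> and \<open>b\<close>
  are found by repeated doubling, computing with naturals to have \<open>b\<close> exactly.\<close>

definition p_bitlen :: prog where
  "p_bitlen = FOR ''a'' ''Nm'' (IF (RLess (OfNat (V ''N'')) (RGet ''Nm'' []))
     (IS ''N'' [] (IAdd (V ''N'') (V ''N'')) ;;; IS ''B'' [] (IAdd (V ''B'') (Nat 1))) NOP)"

definition p_params :: "nat \<Rightarrow> nat \<Rightarrow> prog" where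
  "p_params t w =
    RS ''N'' [] (OfNat (V ''N'')) ;;;
    RS ''b'' [] (OfNat (V ''B'')) ;;;
    RS ''T'' [] (RMul (OfNat (V ''N'')) (Rat (1 - 2 / of_nat (Hc w)))) ;;;
    RS ''m'' [] (RMul (Rat (of_nat (4 * (t + 1) * (Hc w)\<^sup>2)))
      (RMul (OfNat (V ''N'')) (rpow (RAdd (OfNat (V ''n'')) (Rat 2)) 3)))"

text \<open>A certificate is issued only if no solution was found and every guess was refuted. If
  there is neither a solution nor a complete refutation, the flag stays 0 and the answer may be
  wrong; this is the event bounded by \<open>prob_stuck\<close>.\<close>

definition p_finish :: prog where
  "p_finish = IF (ILess (Nat 0) (IAdd (V ''F'') (V ''Z''))) NOP
    (IS ''flag'' [] (Nat 1) ;;; FOR ''a'' ''L'' (IS ''out'' [V ''a''] (IGet ''bits'' [V ''a''])))"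

definition p_search :: "nat \<Rightarrow> nat \<Rightarrow> nat \<Rightarrow> nat \<Rightarrow> rat \<Rightarrow> prog" where
  "p_search p c t w \<kappa> = nest (guesses p c t w) (p_body p c t w \<kappa>)"

text \<open>The same program serves as algorithm and as verifier: its certificates are its own random
  bits.\<close>

definition solver :: "nat \<Rightarrow> nat \<Rightarrow> nat \<Rightarrow> nat \<Rightarrow> rat \<Rightarrow> nat \<Rightarrow> nat \<Rightarrow> com" where
  "solver p c t w \<kappa> a k = Seq (compile (p_consts p c t w a k)) (Seq (compile p_bitlen)
     (Seq (compile (p_params t w)) (Seq (compile (p_search p c t w \<kappa>)) (compile p_finish))))"

definition solver_cost :: "nat \<Rightarrow> nat \<Rightarrow> nat \<Rightarrow> nat \<Rightarrow> rat \<Rightarrow> nat \<Rightarrow> nat \<Rightarrow> nat \<Rightarrow> nat" where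
  "solver_cost p c t w \<kappa> a k \<beta> = cost \<beta> (p_consts p c t w a k) + (cost \<beta> p_bitlen
     + (cost \<beta> (p_params t w) + (cost \<beta> (p_search p c t w \<kappa>) + cost \<beta> p_finish)))"

section \<open>Polynomial growth of the parameters\<close>

lemma two_bitlen_le: "1 \<le> k \<Longrightarrow> 2 ^ bitlen k \<le> 2 * k"
proof (cases "bitlen k")
  case (Suc b)
  then have "\<not> k \<le> 2 ^ b" using bitlen_le_iff[of k b] by simp
  then show ?thesis using Suc by simp
qed simp

lemma bitlen_le: "bitlen k \<le> 2 ^ bitlen k"
  using less_exp[of "bitlen k"] by simp

lemma bitlen_le_self: "bitlen k \<le> k"
  unfolding bitlen_le_iff using less_exp[of k] by simp

text \<open>The base \<open>n + 2\<close> is at least 2 even for \<open>n = 0\<close>, so larger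
  exponents dominate smaller ones, and single monomials are closed under sums up to
  constants.\<close>

definition polybdd :: "(nat \<Rightarrow> nat) \<Rightarrow> bool" where
  "polybdd g \<longleftrightarrow> (\<exists>a k. \<forall>n. g n \<le> a * (n + 2) ^ k)"

lemma polybdd_mono: "polybdd g \<Longrightarrow> (\<And>n. h n \<le> g n) \<Longrightarrow> polybdd h"
  unfolding polybdd_def by (meson order_trans)

lemma polybdd_mono_poly: "polybdd (\<lambda>n. a * (n + 2) ^ k)"
  unfolding polybdd_def by blast

lemma polybdd_const: "polybdd (\<lambda>_. a)"
  unfolding polybdd_def by (rule exI[of _ a], rule exI[of _ 0]) simp

lemma polybdd_id: "polybdd (\<lambda>n. n)"
  unfolding polybdd_def by (rule exI[of _ 1], rule exI[of _ 1]) simp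

lemma polybdd_mult:
  assumes "polybdd g" "polybdd h" shows "polybdd (\<lambda>n. g n * h n)"
proof -
  obtain a k a' k' where "\<And>n. g n \<le> a * (n + 2) ^ k" "\<And>n. h n \<le> a' * (n + 2) ^ k'"
    using assms unfolding polybdd_def by blast
  then have "g n * h n \<le> (a * (n + 2) ^ k) * (a' * (n + 2) ^ k')" for n by (intro mult_le_mono)
  then have "g n * h n \<le> (a * a') * (n + 2) ^ (k + k')" for n by (simp add: power_add mult_ac)
  then show ?thesis unfolding polybdd_def by blast
qed

lemma polybdd_add:
  assumes "polybdd g" "polybdd h" shows "polybdd (\<lambda>n. g n + h n)"
proof -
  obtain a k a' k' where *: "\<And>n. g n \<le> a * (n + 2) ^ k" "\<And>n. h n \<le> a' * (n + 2) ^ k'"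
    using assms unfolding polybdd_def by blast
  have "g n + h n \<le> (a + a') * (n + 2) ^ (k + k')" for n
  proof -
    have "(n + 2) ^ k \<le> (n + 2) ^ (k + k')" "(n + 2) ^ k' \<le> (n + 2) ^ (k + k')"
      by (rule power_increasing; simp)+
    then have "a * (n + 2) ^ k \<le> a * (n + 2) ^ (k + k')" "a' * (n + 2) ^ k' \<le> a' * (n + 2) ^ (k + k')"
      by (simp_all add: mult_le_mono2 del: add_2_eq_Suc')
    then show ?thesis using *[of n] unfolding distrib_right by linarith
  qed
  then show ?thesis unfolding polybdd_def by blast
qed

lemma polybdd_power: "polybdd g \<Longrightarrow> polybdd (\<lambda>n. g n ^ k)"
  by (induction k) (auto intro: polybdd_const polybdd_mult)

lemma polybdd_cost:
  assumes "polybdd \<beta>" shows "polybdd (\<lambda>n. cost (\<beta> n) q)"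
  by (induction q) (auto intro!: polybdd_const polybdd_add polybdd_mult assms
      intro: polybdd_add[OF _ polybdd_const[of 1], simplified] polybdd_add[OF _ polybdd_const[of 2], simplified])

lemma polybdd_Nmin: "polybdd (Nmin p c t w)"
  unfolding Nmin_def[abs_def]
  by (intro polybdd_mult polybdd_const polybdd_power polybdd_add polybdd_id)

lemma polybdd_two_bitlen: "polybdd (\<lambda>n. 2 ^ bitlen (Nmin p c t w n))"
proof (rule polybdd_mono)
  show "polybdd (\<lambda>n. 2 * Nmin p c t w n)" by (intro polybdd_mult polybdd_const polybdd_Nmin)
  show "2 ^ bitlen (Nmin p c t w n) \<le> 2 * Nmin p c t w n" for n
    by (rule two_bitlen_le) (simp add: Nmin_def Hc_def Suc_le_eq)
qed

lemma polybdd_poly: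
  assumes "polybdd g" shows "\<exists>q :: nat poly. \<forall>n. g n \<le> poly q n"
proof -
  obtain a k where "\<And>n. g n \<le> a * (n + 2) ^ k" using assms unfolding polybdd_def by blast
  then have "g n \<le> poly ([:a:] * [:2, 1:] ^ k) n" for n by (simp add: poly_power add.commute)
  then show ?thesis by blast
qed

lemma p_finish_sets: "bounds p_finish = {''L''}" "wf_prog p_finish" "rw p_finish = {}"
  by (auto simp: p_finish_def)

section \<open>Execution of the complete program\<close>

context inst
begin

definition loop_bound :: "nat \<Rightarrow> nat \<Rightarrow> nat" where
  "loop_bound a k = n + 1 + M + b + m + N0 + reps + Nmin p c t w n + a * (n + 2) ^ k"

lemma exec_prelude:
  assumes bs: "length bs = a * (n + 2) ^ k"
  defines "s0 \<equiv> input n P C v bs"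
  defines "s1 \<equiv> exec n f (p_consts p c t w a k) s0"
  defines "s2 \<equiv> exec n f p_bitlen s1"
  defines "s3 \<equiv> exec n f (p_params t w) s2"
  shows "rmem s1 ''Nm'' [] = real (Nmin p c t w n)" "stat bs s3" "rmem s3 ''L'' [] = real (length bs)"
    "\<And>a. a \<in> {''q'', ''F'', ''Z'', ''flag''} \<Longrightarrow> imem s3 a [] = 0"
proof -
  show Nm: "rmem s1 ''Nm'' [] = real (Nmin p c t w n)"
    by (simp add: s1_def p_consts_def rmem_setr s0_def input_def Nmin_def of_rat_add of_rat_mult of_rat_power add.commute)
  have N1: "imem s1 ''N'' [] = 1" "imem s1 ''B'' [] = 0"
    by (simp_all add: s1_def p_consts_def imem_seti s0_def input_def)
  \<comment> \<open>After \<open>b\<close> doublings the guard fails and the remaining iterations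
    are idle; there are enough iterations because \<open>b\<close> is at most
    \<open>Nmin\<close>.\<close>
  have NB: "imem s2 ''B'' [] = min (Nmin p c t w n) b \<and> imem s2 ''N'' [] = 2 ^ min (Nmin p c t w n) b"
    unfolding s2_def p_bitlen_def
  proof (rule exec_FOR[where I = "\<lambda>i s'. imem s' ''B'' [] = min i b \<and> imem s' ''N'' [] = 2 ^ min i b"])
    let ?B = "IF (RLess (OfNat (V ''N'')) (RGet ''Nm'' []))
     (IS ''N'' [] (IAdd (V ''N'') (V ''N'')) ;;; IS ''B'' [] (IAdd (V ''B'') (Nat 1))) NOP"
    fix i and s' :: state
    assume i: "imem s' ''B'' [] = min i b \<and> imem s' ''N'' [] = 2 ^ min i b"
      and sm: "same (insert ''a'' (iw ?B)) (rw ?B) s1 s'"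
    have "rmem s' ''Nm'' [] = real (Nmin p c t w n)" using same_rmem[OF sm, of "''Nm''"] Nm by simp
    moreover have "real (2 ^ min i b) < real (Nmin p c t w n) \<longleftrightarrow> i < b"
    proof -
      have "b \<le> min i b \<longleftrightarrow> Nmin p c t w n \<le> 2 ^ min i b" by (rule bitlen_le_iff)
      then show ?thesis unfolding of_nat_less_iff by linarith
    qed
    ultimately show "imem (exec n f ?B s') ''B'' [] = min (Suc i) b
        \<and> imem (exec n f ?B s') ''N'' [] = 2 ^ min (Suc i) b"
      using i by (auto simp: imem_seti min_def)
  qed (use Nm N1 in \<open>auto simp: imem_seti\<close>)
  then have NB: "imem s2 ''B'' [] = b" "imem s2 ''N'' [] = 2 ^ b"
    using bitlen_le_self[of "Nmin p c t w n"] by (simp_all add: min_def)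
  have r2: "rmem s2 = rmem s1"
    unfolding s2_def by (rule ext) (rule exec_rmem, simp add: p_bitlen_def)
  have i2: "imem s2 a = imem s0 a" if "a \<notin> {''a'', ''N'', ''B''}" for a
  proof -
    have "imem s2 a = imem s1 a" unfolding s2_def by (rule exec_imem) (use that in \<open>simp add: p_bitlen_def\<close>)
    then show ?thesis using that by (simp add: s1_def exec_imem p_consts_def imem_seti)
  qed
  have i3: "imem s3 = imem s2" by (simp add: s3_def p_params_def)
  have n2: "imem s2 ''n'' [] = n" using i2[of "''n''"] by (simp add: s0_def input_def)
  have T: "2 ^ b * (1 - 2 / real (Hc w)) = real N0" by (simp add: N0_eq h_def)
  have m: "(4 + 4 * real t) * (real (Hc w))\<^sup>2 * (2 ^ b * (real n + 2) ^ 3) = real m"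
    by (simp add: m_def add.commute)
  show "stat bs s3"
    unfolding stat_def
  proof (intro conjI allI impI)
    show "imem s3 ''bits'' [k] = of_bool (k < length bs \<and> bs ! k)" for k
      using i2[of "''bits''"] by (simp add: i3 s0_def input_def)
    show "rmem s3 ''b'' [] = real b" "rmem s3 ''N'' [] = 2 ^ b" "rmem s3 ''T'' [] = real N0"
      "rmem s3 ''m'' [] = real m"
      using T m by (simp_all add: s3_def p_params_def rmem_setr NB n2 of_rat_diff of_rat_divide of_rat_add
          of_rat_mult of_rat_power)
    have c3: "rmem s3 a = rmem s1 a" if "a \<notin> {''N'', ''b'', ''T'', ''m''}" for a
      using that by (simp add: s3_def exec_rmem p_params_def r2 rmem_setr)
    show "rmem s3 ''n'' [] = real n" "rmem s3 ''nn'' [] = real (n + 1)" "rmem s3 ''t'' [] = real t"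
      "rmem s3 ''c'' [] = real c" "rmem s3 ''p'' [] = real p" "rmem s3 ''tc'' [] = real (t + c)"
      "rmem s3 ''M'' [] = real M" "rmem s3 ''K'' [] = real reps"
      by (simp_all add: c3 s1_def p_consts_def rmem_setr s0_def input_def reps_def of_rat_add of_rat_mult)
    show "rmem s3 ''v'' [i] = v $ i" if "i < t" for i
      using that v_carrier by (simp add: c3 s1_def p_consts_def rmem_setr s0_def input_def)
    show "rmem s3 ''P'' [q, j] = P $$ (q, j)" if "q < p" "j < n" for q j
      using that P_carrier by (simp add: c3 s1_def p_consts_def rmem_setr s0_def input_def)
    show "rmem s3 ''C'' [q, j] = C $$ (q, j)" if "q < c" "j < n" for q j
      using that C_carrier by (simp add: c3 s1_def p_consts_def rmem_setr s0_def input_def)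
  qed
  show "rmem s3 ''L'' [] = real (length bs)"
    using r2 by (simp add: s3_def p_params_def rmem_setr s1_def p_consts_def s0_def input_def bs add.commute)
  show "imem s3 a [] = 0" if "a \<in> {''q'', ''F'', ''Z'', ''flag''}" for a
    using that i2[of a] by (auto simp: i3 s0_def input_def)
qed

lemma solver_run:
  assumes bs: "length bs = a * (n + 2) ^ k" and len: "length cands * reps * Q \<le> length bs"
  shows "\<exists>s. halts_within n f (solver p c t w \<kappa> a k) (input n P C v bs)
      (solver_cost p c t w \<kappa> a k (loop_bound a k)) s \<and>
    (imem s ''flag'' [] = 0 \<longrightarrow> (\<exists>S\<subseteq>{..<n}. ok S \<and> brep s ''out'' S)
      \<or> (\<exists>\<gamma><length cands. \<not> refuted bs (cands ! \<gamma> \<inter> {..<n}) \<gamma> \<and> unsolved bs (cands ! \<gamma> \<inter> {..<n}) \<gamma>)) \<and>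
    (imem s ''flag'' [] \<noteq> 0 \<longrightarrow> (\<forall>\<gamma><length cands. refuted bs (cands ! \<gamma> \<inter> {..<n}) \<gamma>) \<and>
      (\<forall>l<length bs. imem s ''out'' [l] = of_bool (bs ! l)))"
proof -
  define s0 where "s0 = input n P C v bs"
  define s1 where "s1 = exec n f (p_consts p c t w a k) s0"
  define s2 where "s2 = exec n f p_bitlen s1"
  define s3 where "s3 = exec n f (p_params t w) s2"
  define s4 where "s4 = exec n f (p_search p c t w \<kappa>) s3"
  define s5 where "s5 = exec n f p_finish s4"
  let ?\<beta> = "loop_bound a k"
  note pre = exec_prelude[OF bs, folded s0_def, folded s1_def, folded s2_def, folded s3_def]
  note sets = nest_sets[of "guesses p c t w" "p_body p c t w \<kappa>"]
  have rwS: "rw (p_search p c t w \<kappa>) = rw (p_body p c t w \<kappa>)"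
    and iwS: "iw (p_search p c t w \<kappa>) = iw (p_body p c t w \<kappa>) \<union> digit ` {..<guesses p c t w}"
    and boundsS: "bounds (p_search p c t w \<kappa>) \<subseteq> insert ''nn'' (bounds (p_body p c t w \<kappa>))"
    using sets by (auto simp: p_search_def)
  have 1: "\<exists>l\<le>cost ?\<beta> (p_consts p c t w a k). big_step n f (compile (p_consts p c t w a k)) s0 l s1"
    unfolding s1_def by (rule comp_exec) (auto simp: p_consts_def)
  have 2: "\<exists>l\<le>cost ?\<beta> p_bitlen. big_step n f (compile p_bitlen) s1 l s2"
    unfolding s2_def by (rule comp_exec) (use pre(1) in \<open>auto simp: p_bitlen_def loop_bound_def\<close>)
  have 3: "\<exists>l\<le>cost ?\<beta> (p_params t w). big_step n f (compile (p_params t w)) s2 l s3"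
    unfolding s3_def by (rule comp_exec) (auto simp: p_params_def)
  have 4: "\<exists>l\<le>cost ?\<beta> (p_search p c t w \<kappa>). big_step n f (compile (p_search p c t w \<kappa>)) s3 l s4"
    unfolding s4_def
  proof (rule comp_exec)
    show "wf_prog (p_search p c t w \<kappa>)"
      unfolding p_search_def by (intro wf_nest p_body_sets p_body_digit)
    show "bounds (p_search p c t w \<kappa>) \<inter> rw (p_search p c t w \<kappa>) = {}"
    proof -
      have "insert ''nn'' (bounds (p_body p c t w \<kappa>)) \<inter> rw (p_body p c t w \<kappa>) = {}"
        by (simp add: p_body_sets(2,3))
      then show ?thesis using boundsS unfolding rwS by blast
    qed
    fix x assume "x \<in> bounds (p_search p c t w \<kappa>)"
    then have "x \<in> {''nn'', ''t'', ''c'', ''p'', ''n'', ''tc'', ''m'', ''b'', ''M'', ''T'', ''K''}"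
      using subsetD[OF boundsS] by (simp only: p_body_sets(3))
    then show "rmem s3 x [] \<le> real ?\<beta>"
      using stat_simps(1-11)[OF pre(2)] by (auto simp: loop_bound_def)
  qed
  have L4: "rmem s4 ''L'' [] = real (length bs)"
    unfolding s4_def pre(3)[symmetric]
    by (subst exec_rmem) (auto simp: rwS p_body_sets(2))
  have 5: "\<exists>l\<le>cost ?\<beta> p_finish. big_step n f (compile p_finish) s4 l s5"
    unfolding s5_def by (rule comp_exec) (use L4 bs in \<open>auto simp: p_finish_sets loop_bound_def\<close>)
  have halts: "halts_within n f (solver p c t w \<kappa> a k) (input n P C v bs) (solver_cost p c t w \<kappa> a k ?\<beta>) s5"
  proof -
    from 1 2 3 4 5 obtain l1 l2 l3 l4 l5 where l: "l1 \<le> cost ?\<beta> (p_consts p c t w a k)" "l2 \<le> cost ?\<beta> p_bitlen"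
      "l3 \<le> cost ?\<beta> (p_params t w)" "l4 \<le> cost ?\<beta> (p_search p c t w \<kappa>)" "l5 \<le> cost ?\<beta> p_finish"
      and bigs: "big_step n f (compile (p_consts p c t w a k)) s0 l1 s1" "big_step n f (compile p_bitlen) s1 l2 s2"
      "big_step n f (compile (p_params t w)) s2 l3 s3" "big_step n f (compile (p_search p c t w \<kappa>)) s3 l4 s4"
      "big_step n f (compile p_finish) s4 l5 s5" by blast
    have "big_step n f (solver p c t w \<kappa> a k) s0 (l1 + (l2 + (l3 + (l4 + l5)))) s5"
      unfolding solver_def using bigs by (intro big_step.Seq)
    moreover have "l1 + (l2 + (l3 + (l4 + l5))) \<le> solver_cost p c t w \<kappa> a k ?\<beta>"
      unfolding solver_cost_def using l by (intro add_mono)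
    ultimately show ?thesis unfolding halts_within_def s0_def by blast
  qed
  have "searched bs cands s4"
    unfolding s4_def p_search_def by (rule exec_search[OF pre(2)]) (simp_all add: pre(4))
  then have S4: "stat bs s4" "imem s4 ''F'' [] \<noteq> 0 \<longrightarrow> (\<exists>S\<subseteq>{..<n}. ok S \<and> brep s4 ''out'' S)"
    "imem s4 ''F'' [] = 0 \<longrightarrow> (\<forall>\<gamma><length cands. unsolved bs (cands ! \<gamma> \<inter> {..<n}) \<gamma>)"
    "imem s4 ''Z'' [] = 0 \<longleftrightarrow> (\<forall>\<gamma><length cands. refuted bs (cands ! \<gamma> \<inter> {..<n}) \<gamma>)"
    using len unfolding searched_def by blast+
  have flag4: "imem s4 ''flag'' [] = 0"
  proof -
    have "''flag'' \<notin> iw (p_body p c t w \<kappa>)" by (rule contra_subsetD[OF p_body_sets(1)]) simp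
    then have "imem s4 ''flag'' = imem s3 ''flag''"
      unfolding s4_def by (intro exec_imem) (auto simp: iwS digit_def)
    then show ?thesis using pre(4)[of "''flag''"] by simp
  qed
  have final: "(imem s5 ''flag'' [] = 0 \<longrightarrow> (\<exists>S\<subseteq>{..<n}. ok S \<and> brep s5 ''out'' S)
      \<or> (\<exists>\<gamma><length cands. \<not> refuted bs (cands ! \<gamma> \<inter> {..<n}) \<gamma> \<and> unsolved bs (cands ! \<gamma> \<inter> {..<n}) \<gamma>)) \<and>
    (imem s5 ''flag'' [] \<noteq> 0 \<longrightarrow> (\<forall>\<gamma><length cands. refuted bs (cands ! \<gamma> \<inter> {..<n}) \<gamma>) \<and>
      (\<forall>l<length bs. imem s5 ''out'' [l] = of_bool (bs ! l)))"
  proof (cases "imem s4 ''F'' [] = 0 \<and> imem s4 ''Z'' [] = 0")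
    case False
    then have eq: "s5 = s4" by (auto simp: s5_def p_finish_def)
    show ?thesis
    proof (cases "imem s4 ''F'' [] = 0")
      case F: True
      then obtain \<gamma> where "\<gamma> < length cands" "\<not> refuted bs (cands ! \<gamma> \<inter> {..<n}) \<gamma>" using False S4(4) by auto
      then show ?thesis using F S4(3) flag4 by (auto simp: eq)
    qed (use S4(2) flag4 eq in auto)
  next
    case True
    let ?F = "FOR ''a'' ''L'' (IS ''out'' [V ''a''] (IGet ''bits'' [V ''a'']))"
    define s6 where "s6 = seti ''flag'' [] 1 s4"
    have s5: "s5 = exec n f ?F s6" using True by (simp add: s5_def p_finish_def s6_def)
    have "imem s5 ''flag'' [] = 1" by (simp add: s5 exec_imem s6_def imem_seti)
    moreover have "imem s5 ''out'' [l] = of_bool (bs ! l)" if "l < length bs" for l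
      unfolding s5
      by (rule exec_imap[where k = "length bs" and val = "\<lambda>l. of_bool (bs ! l)"])
        (use that L4 in \<open>auto simp: s6_def same_def imem_seti stat_simps[OF S4(1)]\<close>)
    ultimately show ?thesis using True S4(4) by auto
  qed
  show ?thesis by (rule exI[of _ s5], rule conjI[OF halts final])
qed

end

lemma cost_mono: "\<beta> \<le> \<beta>' \<Longrightarrow> cost \<beta> q \<le> cost \<beta>' q"
proof (induction q)
  case (FOR x a q)
  then have "\<beta> * (cost \<beta> q + 2) \<le> \<beta>' * (cost \<beta>' q + 2)" by (intro mult_le_mono) auto
  then show ?case by simp
qed (auto intro: add_mono)

lemma solver_cost_mono: "\<beta> \<le> \<beta>' \<Longrightarrow> solver_cost p c t w \<kappa> a k \<beta> \<le> solver_cost p c t w \<kappa> a k \<beta>'"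
  unfolding solver_cost_def by (intro add_mono cost_mono)

lemma halts_within_mono: "halts_within n f q s T s' \<Longrightarrow> T \<le> T' \<Longrightarrow> halts_within n f q s T' s'"
  unfolding halts_within_def by (meson order_trans)

text \<open>The number of random bits is written into the program through \<open>a\<close> and
  \<open>k\<close>, since the certificate is copied in a loop of that length. So these two are fixed
  first, and only then the time bound, which depends on them.\<close>

lemma exists_parameters:
  obtains a k and T :: "nat poly" where
    "\<And>n f P C v. inst p c t n f P C v \<Longrightarrow>
      length (inst.cands p c t n w) * inst.reps p c t n w * inst.Q p c t n w \<le> a * (n + 2) ^ k"
    "\<And>n f P C v. inst p c t n f P C v \<Longrightarrow>
      solver_cost p c t w \<kappa> a k (inst.loop_bound p c t n w a k) \<le> poly T n"
proof -
  let ?b = "\<lambda>n. bitlen (Nmin p c t w n)"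
  define fN where "fN n = (2 :: nat) ^ ?b n" for n
  define fm where "fm n = 4 * (t + 1) * (Hc w)\<^sup>2 * fN n * (n + 2) ^ 3" for n
  define fr where "fr n = guesses p c t w * n + 2" for n
  define fQ where "fQ n = fN n * (fm n * (n * ?b n)) + n * ?b n" for n
  have N: "polybdd fN" unfolding fN_def[abs_def] by (rule polybdd_two_bitlen)
  have b: "polybdd ?b" by (rule polybdd_mono[OF polybdd_two_bitlen bitlen_le])
  have m: "polybdd fm" unfolding fm_def[abs_def]
    by (intro polybdd_mult polybdd_const polybdd_power polybdd_add polybdd_id N)
  have r: "polybdd fr" unfolding fr_def[abs_def]
    by (intro polybdd_mult polybdd_const polybdd_add polybdd_id)
  have Q: "polybdd fQ" unfolding fQ_def[abs_def]
    by (intro polybdd_mult polybdd_add polybdd_id N m b)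
  have "polybdd (\<lambda>n. (n + 1) ^ guesses p c t w * fr n * fQ n)"
    by (intro polybdd_mult polybdd_power polybdd_add polybdd_id polybdd_const r Q)
  then obtain a k where ak: "\<And>n. (n + 1) ^ guesses p c t w * fr n * fQ n \<le> a * (n + 2) ^ k"
    unfolding polybdd_def by blast
  define lb where "lb n = n + 1 + (t + c + p) + ?b n + fm n + fN n + fr n + Nmin p c t w n + a * (n + 2) ^ k" for n
  have lb: "polybdd lb" unfolding lb_def[abs_def]
    by (intro polybdd_add polybdd_id polybdd_const b m N r polybdd_Nmin polybdd_mono_poly)
  have "polybdd (\<lambda>n. solver_cost p c t w \<kappa> a k (lb n))"
    unfolding solver_cost_def by (intro polybdd_add polybdd_cost lb)
  then obtain T where T: "\<And>n. solver_cost p c t w \<kappa> a k (lb n) \<le> poly T n"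
    using polybdd_poly by blast
  show thesis
  proof (rule that)
    fix n f P C v assume "inst p c t n f P C v"
    \<comment> \<open>No size depends on the tested ratio, so 0 serves as well as any.\<close>
    then interpret inst p c t n w f P C v 0 .
    have eq: "reps = fr n" "inst.m p c t n w = fm n" by (simp_all add: reps_def fr_def fm_def fN_def inst.m_def[OF inst_axioms])
    have N0: "N0 \<le> fN n" using N0_le by (simp add: fN_def)
    have "inst.Q p c t n w \<le> fQ n"
      unfolding inst.Q_def[OF inst_axioms] fQ_def eq using N0 by (intro add_mono mult_le_mono) auto
    then have "length cands * reps * inst.Q p c t n w \<le> (n + 1) ^ guesses p c t w * fr n * fQ n"
      unfolding cands_def length_glist eq by (rule mult_le_mono2)
    then show "length cands * reps * inst.Q p c t n w \<le> a * (n + 2) ^ k" using ak[of n] by (rule order_trans)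
    have "loop_bound a k \<le> lb n" using N0 by (simp add: loop_bound_def lb_def eq)
    then show "solver_cost p c t w \<kappa> a k (loop_bound a k) \<le> poly T n"
      using solver_cost_mono T[of n] by (meson order_trans)
  qed
qed

theorem theorem3:
  fixes p c t :: nat and \<epsilon> :: real
  assumes "\<epsilon> > 0"
  shows "\<exists>(alg :: com) (ver :: com) (T :: nat poly) (R :: nat poly) (L :: nat poly).
    \<forall>n f P C v.
      pcmsm_instance p c t n f P C \<and> v \<in> carrier_vec t \<and> (\<forall>i<t. 0 \<le> v $ i) \<longrightarrow>
      sound_verifier_on p c t n f P C v ver (poly T n) (poly L n) \<and>
      (\<forall>r. length r = poly R n \<longrightarrow>
        (\<exists>s. halts_within n f alg (input n P C v r) (poly T n) s)) \<and>
      measure_pmf.prob (random_bits (poly R n))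
        {r. \<exists>s. halts_within n f alg (input n P C v r) (poly T n) s \<and>
            correct_answer p c t \<epsilon> n f P C v ver (poly T n) (answer_of n (poly L n) s)} \<ge> 2 / 3"
proof -
  obtain w where "(1 / 2 :: real) ^ w < \<epsilon>" using real_arch_pow_inv[OF assms, of "1 / 2"] by auto
  then have w: "1 / 2 ^ w < \<epsilon>" by (simp add: power_one_over)
  have "7 * (1 / real (Hc w)) \<le> 1 / 2 ^ w" by (simp add: Hc_def power_add field_simps)
  then have "1 - 1 / exp 1 - \<epsilon> < 1 - 1 / exp 1 - 7 * (1 / real (Hc w))" using w by linarith
  \<comment> \<open>The lower bound makes accepted sets good enough, the upper bound makes
    acceptance likely; there is room since \<open>7 * h\<close> is less than
    \<open>\<epsilon>\<close>.\<close>
  then obtain \<kappa> where \<kappa>: "1 - 1 / exp 1 - \<epsilon> < of_rat \<kappa>" "of_rat \<kappa> < 1 - 1 / exp 1 - 7 * (1 / real (Hc w))"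
    using of_rat_dense by blast
  obtain a k and T :: "nat poly" where par:
    "\<And>n f P C v. inst p c t n f P C v \<Longrightarrow>
      length (inst.cands p c t n w) * inst.reps p c t n w * inst.Q p c t n w \<le> a * (n + 2) ^ k"
    "\<And>n f P C v. inst p c t n f P C v \<Longrightarrow>
      solver_cost p c t w \<kappa> a k (inst.loop_bound p c t n w a k) \<le> poly T n"
    by (rule exists_parameters[where p = p and c = c and t = t and w = w and \<kappa> = \<kappa>]) blast
  define R :: "nat poly" where "R = [:a:] * [:2, 1:] ^ k"
  have R: "poly R n = a * (n + 2) ^ k" for n by (simp add: R_def poly_power add.commute)
  let ?alg = "solver p c t w \<kappa> a k"
  have main: "sound_verifier_on p c t n f P C v ?alg (poly T n) (poly R n) \<and>
      (\<forall>r. length r = poly R n \<longrightarrow> (\<exists>s. halts_within n f ?alg (input n P C v r) (poly T n) s)) \<and>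
      measure_pmf.prob (random_bits (poly R n))
        {r. \<exists>s. halts_within n f ?alg (input n P C v r) (poly T n) s \<and>
            correct_answer p c t \<epsilon> n f P C v ?alg (poly T n) (answer_of n (poly R n) s)} \<ge> 2 / 3"
    if asm: "pcmsm_instance p c t n f P C" "v \<in> carrier_vec t" "\<forall>i<t. 0 \<le> v $ i" for n f P C v
  proof -
    interpret inst p c t n w f P C v \<kappa> by unfold_locales (use asm in auto)
    have len: "length cands * reps * Q \<le> poly R n" using par(1)[OF inst_axioms] by (simp add: R)
    let ?stuck = "\<lambda>r. \<exists>\<gamma><length cands. \<not> refuted r (cands ! \<gamma> \<inter> {..<n}) \<gamma> \<and> unsolved r (cands ! \<gamma> \<inter> {..<n}) \<gamma>"
    have run: "\<exists>s. halts_within n f ?alg (input n P C v r) (poly T n) s \<and>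
        (imem s ''flag'' [] = 0 \<longrightarrow> (\<exists>S\<subseteq>{..<n}. ok S \<and> brep s ''out'' S) \<or> ?stuck r) \<and>
        (imem s ''flag'' [] \<noteq> 0 \<longrightarrow> (\<forall>\<gamma><length cands. refuted r (cands ! \<gamma> \<inter> {..<n}) \<gamma>) \<and>
          (\<forall>l<length r. imem s ''out'' [l] = of_bool (r ! l)))"
      if "length r = poly R n" for r
    proof -
      have lr: "length r = a * (n + 2) ^ k" "length cands * reps * Q \<le> length r"
        using that len by (simp_all add: R)
      from solver_run[OF lr] obtain s
        where s: "halts_within n f ?alg (input n P C v r) (solver_cost p c t w \<kappa> a k (loop_bound a k)) s"
          "imem s ''flag'' [] = 0 \<longrightarrow> (\<exists>S\<subseteq>{..<n}. ok S \<and> brep s ''out'' S) \<or> ?stuck r"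
          "imem s ''flag'' [] \<noteq> 0 \<longrightarrow> (\<forall>\<gamma><length cands. refuted r (cands ! \<gamma> \<inter> {..<n}) \<gamma>) \<and>
            (\<forall>l<length r. imem s ''out'' [l] = of_bool (r ! l))"
        by (elim exE conjE)
      show ?thesis
        by (intro exI[of _ s] conjI halts_within_mono[OF s(1) par(2)[OF inst_axioms]] s(2,3))
    qed
    have sound: "sound_verifier_on p c t n f P C v ?alg (poly T n) (poly R n)"
      unfolding sound_verifier_on_def accepts_def
    proof (intro allI impI)
      fix r :: "bool list" assume "length r = poly R n"
      from run[OF this] obtain s where "halts_within n f ?alg (input n P C v r) (poly T n) s"
        "imem s ''flag'' [] \<noteq> 0 \<longrightarrow> (\<forall>\<gamma><length cands. refuted r (cands ! \<gamma> \<inter> {..<n}) \<gamma>)"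
        by (elim exE conjE) (metis (no_types))
      then show "\<exists>s. halts_within n f ?alg (input n P C v r) (poly T n) s \<and>
          (imem s ''flag'' [] \<noteq> 0 \<longrightarrow> \<not> (\<exists>S. feasible p c n P C S \<and> (\<forall>i<t. v $ i \<le> f i S)))"
        using all_refuted by (intro exI[of _ s] conjI) auto
    qed
    have "\<exists>s. halts_within n f ?alg (input n P C v r) (poly T n) s \<and>
        correct_answer p c t \<epsilon> n f P C v ?alg (poly T n) (answer_of n (poly R n) s)"
      if r: "length r = poly R n" "\<not> ?stuck r" for r
    proof -
      obtain s where s: "halts_within n f ?alg (input n P C v r) (poly T n) s"
        "imem s ''flag'' [] = 0 \<longrightarrow> (\<exists>S\<subseteq>{..<n}. ok S \<and> brep s ''out'' S)"
        "imem s ''flag'' [] \<noteq> 0 \<longrightarrow> (\<forall>l<length r. imem s ''out'' [l] = of_bool (r ! l))"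
        using run[OF r(1)] r(2) by (elim exE conjE) (metis (no_types))
      have "correct_answer p c t \<epsilon> n f P C v ?alg (poly T n) (answer_of n (poly R n) s)"
      proof (cases "imem s ''flag'' [] = 0")
        case True
        then obtain S where S: "S \<subseteq> {..<n}" "ok S" "brep s ''out'' S" using s(2) by blast
        then have "{j. j < n \<and> imem s ''out'' [j] \<noteq> 0} = S" by (auto simp: brep_def)
        then have "answer_of n (poly R n) s = Solution S" using True by (simp add: answer_of_def)
        then show ?thesis
          using ok_correct[OF S(2,1) less_imp_le[OF w] less_imp_le[OF \<kappa>(1)]] by (simp add: correct_answer_def)
      next
        case False
        \<comment> \<open>The certificate is the random string itself, so the verifier is the same
          program on the same input and ends in the same state.\<close>
        then have "map (\<lambda>l. imem s ''out'' [l] \<noteq> 0) [0..<poly R n] = r"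
          using s(3) r(1) by (intro nth_equalityI) auto
        then have "answer_of n (poly R n) s = Certificate r" using False by (simp add: answer_of_def)
        then show ?thesis using s(1) False by (auto simp: correct_answer_def accepts_def)
      qed
      then show ?thesis using s(1) by blast
    qed
    then have "bavg (poly R n) (\<lambda>r. 1 - of_bool (?stuck r))
        \<le> bavg (poly R n) (\<lambda>r. of_bool (\<exists>s. halts_within n f ?alg (input n P C v r) (poly T n) s \<and>
            correct_answer p c t \<epsilon> n f P C v ?alg (poly T n) (answer_of n (poly R n) s)))"
      by (intro bavg_le) (auto simp: of_bool_def)
    moreover have "bavg (poly R n) (\<lambda>r. of_bool (?stuck r)) \<le> 1 / 4"
      by (rule prob_stuck[OF _ len]) (use \<kappa>(2) in \<open>simp add: h_def\<close>)
    \<comment> \<open>The success probability is in fact at least 3/4.\<close>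
    ultimately have "2 / 3 \<le> bavg (poly R n) (\<lambda>r. of_bool (\<exists>s. halts_within n f ?alg (input n P C v r) (poly T n) s \<and>
        correct_answer p c t \<epsilon> n f P C v ?alg (poly T n) (answer_of n (poly R n) s)))"
      unfolding bavg_diff bavg_const by linarith
    then have prob: "2 / 3 \<le> measure_pmf.prob (random_bits (poly R n))
        {r. \<exists>s. halts_within n f ?alg (input n P C v r) (poly T n) s \<and>
            correct_answer p c t \<epsilon> n f P C v ?alg (poly T n) (answer_of n (poly R n) s)}"
      by (simp only: prob_random_bits)
    have halts: "\<forall>r. length r = poly R n \<longrightarrow> (\<exists>s. halts_within n f ?alg (input n P C v r) (poly T n) s)"
      using run by (metis (no_types, lifting))
    show ?thesis by (rule conjI[OF sound conjI[OF halts prob]])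
  qed
  show ?thesis
    by (rule exI[of _ ?alg], rule exI[of _ ?alg], rule exI[of _ T], rule exI[of _ R], rule exI[of _ R])
      (use main in blast)
qed

end
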